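(* Let $r\ge 2$. (i) Let $D_{r-1}\subset\mathbb{C}_{(1)}^{r-1}$ be a bounded closed set such that $(D_{r-1}\times\mathbb{C}_{(1)})\cap S_{1,r}=\emptyset$. Let $(s_1^{(m)},\ldots,s_r^{(m)})$ $(m=1,2,3,\ldots)$ be a sequence of points on a zero-set of $\zeta_r(s_1,\ldots,s_r)$. Assume that $\sigma_1^{(m)}=\Re s_1^{(m)}$ tends to $+\infty$ as $m\to\infty$, while $(s_2^{(m)},\ldots,s_r^{(m)})\in D_{r-1}$ for all $m$. Then, uniformly on $D_{r-1}$, the sequence $(s_2^{(m)},\ldots,s_r^{(m)})$ approaches the hypersurface $\mathcal{H}_{r-1}$ (i.e. its distance to $\mathcal{H}_{r-1}$ tends to $0$). Therefore there is a subsequence $(s_2^{(k_m)},\ldots,s_r^{(k_m)})$ $(m=1,2,3,\ldots)$ which converges to a point $(\rho_2,\ldots,\rho_r)$ on $\mathcal{H}_{r-1}$. (ii) Conversely, for any solution $(\rho_2,\ldots,\rho_r)$ of $F_{r-1}(\rho_2,\ldots,\rho_r)=0$, there is a sequence of points $(s_1^{(m)},\ldots,s_r^{(m)})$ $(m=1,2,3,\ldots)$ on a zero-set of $\zeta_r(s_1,\ldots,s_r)$ such that $(s_2^{(m)},\ldots,s_r^{(m)})$ converges to $(\rho_2,\ldots,\rho_r)$ as $m\to\infty$.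
   Context: For $r\ge1$, $\zeta_r(s_1,\ldots,s_r)$ denotes the Euler-Zagier $r$-fold sum $$\zeta_r(s_1,\ldots,s_r)=\sum_{1\le n_1<\cdots<n_r}\frac{1}{n_1^{s_1}\cdots n_r^{s_r}}$$ (absolutely convergent e.g. when $\Re s_k>1$ for all $k$), together with its meromorphic continuation to $\mathbb{C}^r$; $\zeta_1=\zeta$ is the Riemann zeta-function. Its possible singularities lie only on the hyperplanes $$A_r^{(j,n)}=\{(s_1,\ldots,s_r)\in\mathbb{C}^r : s_{r-j+1}+\cdots+s_r=j-n\}\quad(2\le j\le r,\ n=0,1,2,\ldots),$$ $$A_r^{(1)}=\{(s_1,\ldots,s_r)\in\mathbb{C}^r : s_r=1\}.$$ A zero of $\zeta_r$ is a point at which $\zeta_r$ is holomorphic and equal to $0$; a zero-set of $\zeta_r$ is an analytic set in $\mathbb{C}^r$ formed by zeros of $\zeta_r$. Write $\mathbb{C}^r=\mathbb{C}_{(1)}^{r-1}\times\mathbb{C}_{(1)}$, where $\mathbb{C}_{(1)}^{r-1}$ is the space of all $(s_2,\ldots,s_r)$ and $\mathbb{C}_{(1)}$ is the $s_1$-plane (so $D\times\mathbb{C}_{(1)}$ is the set of $(s_1,\ldots,s_r)\in\mathbb{C}^r$ with $(s_2,\ldots,s_r)\in D$). $S_{1,r}$ is the union of those of the hyperplanes $A_r^{(j,n)}$ $(2\le j\le r,\ n=0,1,2,\ldots)$ and $A_r^{(1)}$ whose defining equation does not include $s_1$: for $r\ge3$, $S_{1,r}=\bigl(\bigcup_{2\le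 j\le r-1}\bigcup_{n=0}^{\infty}A_r^{(j,n)}\bigr)\cup A_r^{(1)}$, and $S_{1,2}=A_2^{(1)}$. Define $$F_{r-1}(s_2,\ldots,s_r)=\sum_{j=1}^{r-1}(-1)^{r-j+1}\zeta_j(s_{r-j+1},\ldots,s_r)-(-1)^r,$$ and let $\mathcal{H}_{r-1}$ be the hypersurface in $\mathbb{C}_{(1)}^{r-1}$ defined by the equation $F_{r-1}(s_2,\ldots,s_r)=0$. *)

theory Defs
  imports "HOL-Analysis.Analysis"
begin

text \<open>
  Since the dimension varies inside the statement, a point of complex affine space with coordinates
  indexed by a finite set \<open>I\<close> of naturals is a function \<^typ>\<open>nat \<Rightarrow> complex\<close> vanishing outside \<open>I\<close>.
  Thus \<open>cspace {1..r}\<close> is the space of all $(s_1,\ldots,s_r)$ and \<open>cspace {2..r}\<close> the space of all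
  $(s_2,\ldots,s_r)$; the projection from the former to the latter is \<open>\<lambda>s. s(1 := 0)\<close>.
  The subspace topology inherited from the product topology on \<^typ>\<open>nat \<Rightarrow> complex\<close> is the usual one.
  (The library's \<open>dist\<close> and \<open>bounded\<close> on this function type come from a bounded metric and are
  deliberately not used: every set is \<open>bounded\<close> for it.)
\<close>

definition cspace :: "nat set \<Rightarrow> (nat \<Rightarrow> complex) set" where
  "cspace I = {s. \<forall>i. i \<notin> I \<longrightarrow> s i = 0}"

definition cdist :: "nat set \<Rightarrow> (nat \<Rightarrow> complex) \<Rightarrow> (nat \<Rightarrow> complex) \<Rightarrow> real" where
  "cdist I s t = L2_set (\<lambda>i. cmod (s i - t i)) I"

definition cbounded :: "nat set \<Rightarrow> (nat \<Rightarrow> complex) set \<Rightarrow> bool" where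
  "cbounded I D \<longleftrightarrow> (\<exists>B. \<forall>s\<in>D. \<forall>i\<in>I. cmod (s i) \<le> B)"

text \<open>Holomorphy in several variables: continuous, and holomorphic in each variable separately.\<close>

definition holo_on :: "nat set \<Rightarrow> ((nat \<Rightarrow> complex) \<Rightarrow> complex) \<Rightarrow> (nat \<Rightarrow> complex) set \<Rightarrow> bool" where
  "holo_on I f U \<longleftrightarrow>
     openin (top_of_set (cspace I)) U \<and> continuous_on U f \<and>
     (\<forall>s\<in>U. \<forall>i\<in>I. (\<lambda>z. f (s(i := z))) field_differentiable at (s i))"

text \<open>\<open>V\<close> is an analytic subset of the open set \<open>W\<close>: near every point of \<open>W\<close> (not just of \<open>V\<close>) it
  is the common zero set of finitely many holomorphic functions.\<close>

definition analytic_subset :: "nat set \<Rightarrow> (nat \<Rightarrow> complex) set \<Rightarrow> (nat \<Rightarrow> complex) set \<Rightarrow> bool" where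
  "analytic_subset I W V \<longleftrightarrow> V \<subseteq> W \<and>
     (\<forall>p\<in>W. \<exists>U \<Phi>. p \<in> U \<and> U \<subseteq> W \<and> finite \<Phi> \<and> (\<forall>\<phi>\<in>\<Phi>. holo_on I \<phi> U) \<and>
        openin (top_of_set (cspace I)) U \<and> V \<inter> U = {s\<in>U. \<forall>\<phi>\<in>\<Phi>. \<phi> s = 0})"

definition EZ_sum :: "nat \<Rightarrow> (nat \<Rightarrow> complex) \<Rightarrow> complex" where
  "EZ_sum r s =
     (\<Sum>\<^sub>\<infinity>n\<in>{n \<in> {1..r} \<rightarrow>\<^sub>E {1::nat..}. strict_mono_on {1..r} n}.
        1 / (\<Prod>i=1..r. of_nat (n i) powr s i))"

definition hyp :: "nat \<Rightarrow> nat \<Rightarrow> nat \<Rightarrow> (nat \<Rightarrow> complex) set" where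
  "hyp r j n = {s \<in> cspace {1..r}. (\<Sum>i=r-j+1..r. s i) = of_nat j - of_nat n}"

definition hyp1 :: "nat \<Rightarrow> (nat \<Rightarrow> complex) set" where
  "hyp1 r = {s \<in> cspace {1..r}. s r = 1}"

definition EZ_sing :: "nat \<Rightarrow> (nat \<Rightarrow> complex) set" where
  "EZ_sing r = (\<Union>j\<in>{2..r}. \<Union>n. hyp r j n) \<union> hyp1 r"

text \<open>The hyperplanes whose equation does not involve the first coordinate (for \<open>r = 2\<close> the
  union over \<open>j\<close> is empty).\<close>

definition S1 :: "nat \<Rightarrow> (nat \<Rightarrow> complex) set" where
  "S1 r = (\<Union>j\<in>{2..r-1}. \<Union>n. hyp r j n) \<union> hyp1 r"

text \<open>
  The continuation is pinned down off the hyperplanes of possible singularities: their complement is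
  connected and contains the region of convergence used here, so by the identity theorem two functions
  satisfying the predicate agree there. This already determines the meromorphic continuation, so no
  condition is imposed at the hyperplanes; the values on them are left unspecified.
\<close>

definition is_EZ_continuation :: "nat \<Rightarrow> ((nat \<Rightarrow> complex) \<Rightarrow> complex) \<Rightarrow> bool" where
  "is_EZ_continuation r f \<longleftrightarrow>
     holo_on {1..r} f (cspace {1..r} - EZ_sing r) \<and>
     (\<forall>s\<in>cspace {1..r}. (\<forall>k\<in>{1..r}. Re (s k) > 1) \<longrightarrow> f s = EZ_sum r s)"

definition EZ_cont :: "nat \<Rightarrow> (nat \<Rightarrow> complex) \<Rightarrow> complex" where
  "EZ_cont r = (SOME f. is_EZ_continuation r f)"

text \<open>
  Some of the hyperplanes carry no singularity at all. So \<open>r\<close>-fold zeta is taken to be holomorphic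
  at \<open>s\<close>, with value \<open>v\<close>, if it extends holomorphically to a neighbourhood of \<open>s\<close>, with value \<open>v\<close>
  at \<open>s\<close>; \<open>v\<close> is then unique, as the hyperplanes have dense complement.
\<close>

definition EZ_value_at :: "nat \<Rightarrow> (nat \<Rightarrow> complex) \<Rightarrow> complex \<Rightarrow> bool" where
  "EZ_value_at r s v \<longleftrightarrow>
     (\<exists>U g. s \<in> U \<and> holo_on {1..r} g U \<and> (\<forall>t\<in>U - EZ_sing r. g t = EZ_cont r t) \<and> g s = v)"

definition EZ_holomorphic_at :: "nat \<Rightarrow> (nat \<Rightarrow> complex) \<Rightarrow> bool" where
  "EZ_holomorphic_at r s \<longleftrightarrow> (\<exists>v. EZ_value_at r s v)"

definition EZ_zeta :: "nat \<Rightarrow> (nat \<Rightarrow> complex) \<Rightarrow> complex" where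
  "EZ_zeta r s = (THE v. EZ_value_at r s v)"

definition EZ_zero :: "nat \<Rightarrow> (nat \<Rightarrow> complex) \<Rightarrow> bool" where
  "EZ_zero r s \<longleftrightarrow> EZ_holomorphic_at r s \<and> EZ_zeta r s = 0"

text \<open>
  Zeros lie by definition in the open set where the function is holomorphic, and analyticity is
  understood in that set. Analyticity at all points of the whole space would exclude the zero
  hypersurfaces whose closure meets points of indeterminacy.
\<close>

definition EZ_zero_set :: "nat \<Rightarrow> (nat \<Rightarrow> complex) set \<Rightarrow> bool" where
  "EZ_zero_set r V \<longleftrightarrow>
     analytic_subset {1..r} {s. EZ_holomorphic_at r s} V \<and> (\<forall>s\<in>V. EZ_zero r s)"

text \<open>The point $(s_{r-j+1},\ldots,s_r)$ of $j$-space.\<close>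

definition last_coords :: "nat \<Rightarrow> nat \<Rightarrow> (nat \<Rightarrow> complex) \<Rightarrow> nat \<Rightarrow> complex" where
  "last_coords r j s = (\<lambda>i. if i \<in> {1..j} then s (r - j + i) else 0)"

text \<open>\<open>F r\<close> and \<open>H r\<close> are $F_{r-1}$ and $\mathcal{H}_{r-1}$. The sum defining $F_{r-1}$ has a value
  exactly where each of its terms is holomorphic; elsewhere \<open>F r\<close> is junk, hence the guard in \<open>H\<close>.\<close>

definition F :: "nat \<Rightarrow> (nat \<Rightarrow> complex) \<Rightarrow> complex" where
  "F r s = (\<Sum>j=1..r-1. (-1) ^ (r - j + 1) * EZ_zeta j (last_coords r j s)) - (-1) ^ r"

definition H :: "nat \<Rightarrow> (nat \<Rightarrow> complex) set" where
  "H r = {s \<in> cspace {2..r}.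
     (\<forall>j\<in>{1..r-1}. EZ_holomorphic_at j (last_coords r j s)) \<and> F r s = 0}"

end

theory Submission
  imports Defs "HOL-Complex_Analysis.Complex_Analysis"
begin

text \<open>
  The tail $\sum_{N<n_1<\cdots<n_j} n_1^{-s_1}\cdots n_j^{-s_j}$ is continued in \<open>s\<close> by induction on \<open>j\<close>,
  together with an asymptotic expansion $\sum_k c_k(s) N^{j-s_1-\cdots-s_j-k}$ as $N\to\infty$. If $a(n)$ has such
  an expansion with exponents $-w-k$, one finds $d_k$ with
  $\sum_k d_k((n-1)^{1-w-k}-n^{1-w-k})\sim a(n)$; the $k$-th equation is solvable as long as $w+k\neq 1$, and this
  is where the hyperplanes come from. Then $\sum_{n\le N}a(n)+\sum_{k<K}d_kN^{1-w-k}$ converges locally uniformly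
  for large \<open>K\<close>, and its limit is the continuation of $\sum_n a(n)$.

  As $\Re s_1\to\infty$ only the terms with $n_1=1$ survive, so $\zeta_r(s)$ tends to the tail $n_2>1$, which is
  $F_{r-1}$; the expansion makes this locally uniform. Part (i) follows by compactness. For part (ii), join
  $\rho$ to a real point where $F_{r-1}\neq 0$ by a complex line and apply Hurwitz's theorem to $\zeta_r$ with
  $s_1=k\to\infty$. The zeros found this way are usable unless they all sit at $\rho$ itself, which may be a removable
  singularity; in that case a Dirichlet series in $s_1$ vanishes for all large \<open>k\<close>, so all its coefficients, the tails at
  $\rho$, vanish, which is impossible.
\<close>

subsection \<open>Holomorphic functions of several variables\<close>

text \<open>The induction runs over tails because summing over the first index multiplies
  \<open>n powr (- s 1)\<close> by the tail beyond \<open>n\<close> in the remaining variables. What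
  matters of that tail is its behaviour in \<open>n\<close>, locally uniformly in \<open>s\<close>
  and with holomorphic coefficients, and summation reproduces this property. The first step is
  exceptional: the empty tail is exactly 1, so the recurrence has an explicit solution that is
  singular only at \<open>s 1 = 1\<close>, whereas its general solution would also lose
  \<open>s 1 = 0, -1, ...\<close>.

  In part (ii) the obstacle is that \<open>\<rho>\<close> may lie on hyperplanes at which every term
  of \<open>F\<close> still extends holomorphically. The coefficients of the expansion give no
  control of the tails there, so the uniform convergence that Hurwitz's theorem requires is not
  immediate. On a complex line the singular parameters do not accumulate. Hence the tails are
  extended along the line by their recursion in \<open>N\<close>, bounded polynomially on a small
  circle of regular points, and the maximum principle carries the bound to the centre.\<close>

type_synonym pt = "nat \<Rightarrow> complex"

text \<open>Dropping the first coordinate and renumbering from 1 identifies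
  \<open>cspace {2..Suc m}\<close> with \<open>cspace {1..m}\<close>. Index 0 is reset so that the
  old first coordinate does not survive there and the image stays in \<open>cspace\<close>.\<close>

definition shift :: "pt \<Rightarrow> pt" where
  "shift s = (\<lambda>i. if i = 0 then 0 else s (Suc i))"

definition line :: "pt \<Rightarrow> pt \<Rightarrow> complex \<Rightarrow> pt" where
  "line a b w = (\<lambda>i. a i + w * b i)"

text \<open>Requiring holomorphy along every complex line, and not only in each coordinate, makes
  compositions with lines holomorphic without Osgood's lemma.\<close>

definition hol :: "pt set \<Rightarrow> (pt \<Rightarrow> complex) \<Rightarrow> bool" where
  "hol U f \<longleftrightarrow> continuous_on U f \<and> (\<forall>a b. (\<lambda>w. f (line a b w)) holomorphic_on {w. line a b w \<in> U})"

lemma continuous_on_line [continuous_intros]: "continuous_on A (line a b)"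
  unfolding line_def
  by (intro continuous_on_coordinatewise_then_product continuous_intros)

lemma open_line_vimage: "open U \<Longrightarrow> open {w. line a b w \<in> U}"
  using open_vimage[OF _ continuous_on_line] by (simp add: vimage_def)

lemma continuous_on_coord [continuous_intros]: "continuous_on A (\<lambda>s::pt. s i)"
  by (rule continuous_on_subset[OF continuous_on_product_coordinates]) simp

lemma continuous_on_shift [continuous_intros]: "continuous_on A shift"
proof (rule continuous_on_coordinatewise_then_product)
  show "continuous_on A (\<lambda>s. shift s i)" for i
    by (cases "i = 0") (simp_all add: shift_def continuous_on_coord)
qed

lemma shift_line: "shift (line a b w) = line (shift a) (shift b) w"
  by (auto simp: shift_def line_def)

lemma hol_continuous: "hol U f \<Longrightarrow> continuous_on U f"
  by (simp add: hol_def)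

lemma hol_along_line: "hol U f \<Longrightarrow> (\<lambda>w. f (line a b w)) holomorphic_on {w. line a b w \<in> U}"
  by (simp add: hol_def)

lemma holI:
  assumes "continuous_on U f"
    "\<And>a b. (\<lambda>w. f (line a b w)) holomorphic_on {w. line a b w \<in> U}"
  shows "hol U f"
  using assms by (simp add: hol_def)

lemma hol_const [simp, intro]: "hol U (\<lambda>s. c)"
  by (intro holI continuous_intros holomorphic_intros)

lemma hol_coord [simp, intro]: "hol U (\<lambda>s. s i)"
  unfolding line_def by (intro holI) (auto simp: line_def intro!: continuous_intros holomorphic_intros)

lemma hol_add [intro]:
  assumes f: "hol U f" and g: "hol U g" shows "hol U (\<lambda>s. f s + g s)"
  by (intro holI continuous_intros holomorphic_intros hol_continuous[OF f] hol_continuous[OF g]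
      hol_along_line[OF f] hol_along_line[OF g])

lemma hol_diff [intro]:
  assumes f: "hol U f" and g: "hol U g" shows "hol U (\<lambda>s. f s - g s)"
  by (intro holI continuous_intros holomorphic_intros hol_continuous[OF f] hol_continuous[OF g]
      hol_along_line[OF f] hol_along_line[OF g])

lemma hol_mult [intro]:
  assumes f: "hol U f" and g: "hol U g" shows "hol U (\<lambda>s. f s * g s)"
  by (intro holI continuous_intros holomorphic_intros hol_continuous[OF f] hol_continuous[OF g]
      hol_along_line[OF f] hol_along_line[OF g])

lemma hol_minus [intro]: 
  assumes f: "hol U f" shows "hol U (\<lambda>s. - f s)"
  by (intro holI continuous_intros holomorphic_intros hol_continuous[OF f] hol_along_line[OF f])

lemma hol_divide [intro]:
  assumes f: "hol U f" and g: "hol U g" and nz: "\<And>s. s \<in> U \<Longrightarrow> g s \<noteq> 0"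
  shows "hol U (\<lambda>s. f s / g s)"
  by (intro holI continuous_intros holomorphic_intros ballI hol_continuous[OF f] hol_continuous[OF g]
      hol_along_line[OF f] hol_along_line[OF g] nz) simp_all

lemma hol_sum [intro]:
  assumes f: "\<And>i. i \<in> A \<Longrightarrow> hol U (f i)" shows "hol U (\<lambda>s. \<Sum>i\<in>A. f i s)"
  by (intro holI continuous_intros holomorphic_intros hol_continuous[OF f] hol_along_line[OF f])

lemma hol_prod [intro]:
  assumes f: "\<And>i. i \<in> A \<Longrightarrow> hol U (f i)" shows "hol U (\<lambda>s. \<Prod>i\<in>A. f i s)"
  by (intro holI continuous_intros holomorphic_intros hol_continuous[OF f] hol_along_line[OF f])

lemma hol_powr:
  assumes "n \<ge> 1" and f: "hol U f" shows "hol U (\<lambda>s. of_nat n powr f s)"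
proof -
  have eq: "of_nat n powr z = exp (z * of_real (ln (real n)))" for z :: complex
    using assms(1) by (simp add: powr_def Ln_of_nat)
  show ?thesis unfolding eq
    by (intro holI continuous_intros holomorphic_intros hol_continuous[OF f] hol_along_line[OF f])
qed

lemma hol_shift: 
  assumes "hol U f" shows "hol {s. shift s \<in> U} (\<lambda>s. f (shift s))"
proof (rule holI)
  have "shift ` {s. shift s \<in> U} \<subseteq> U" by blast
  from continuous_on_compose2[OF hol_continuous[OF assms] continuous_on_shift this]
  show "continuous_on {s. shift s \<in> U} (\<lambda>s. f (shift s))" .
  show "(\<lambda>w. f (shift (line a b w))) holomorphic_on {w. line a b w \<in> {s. shift s \<in> U}}" for a b
    using hol_along_line[OF assms, of "shift a" "shift b"] unfolding shift_line mem_Collect_eq .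
qed

lemma hol_subset:
  assumes "hol U f" "V \<subseteq> U" shows "hol V f"
proof (rule holI)
  show "continuous_on V f" by (rule continuous_on_subset[OF hol_continuous[OF assms(1)] assms(2)])
  show "(\<lambda>w. f (line a b w)) holomorphic_on {w. line a b w \<in> V}" for a b
    by (rule holomorphic_on_subset[OF hol_along_line[OF assms(1)]]) (use assms(2) in auto)
qed

lemma hol_local:
  assumes "\<And>p. p \<in> U \<Longrightarrow> \<exists>V. open V \<and> p \<in> V \<and> hol V f"
  shows "hol U f"
proof (rule holI)
  show "continuous_on U f"
  proof (rule continuous_at_imp_continuous_on, rule ballI)
    fix p assume "p \<in> U"
    then obtain V where "open V" "p \<in> V" "hol V f" using assms by blast
    then show "isCont f p" using continuous_on_eq_continuous_at[of V f] hol_continuous[of V f] by simp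
  qed
next
  fix a b :: pt
  show "(\<lambda>w. f (line a b w)) holomorphic_on {w. line a b w \<in> U}"
    unfolding holomorphic_on_def
  proof
    fix w assume "w \<in> {w. line a b w \<in> U}"
    then obtain V where V: "open V" "line a b w \<in> V" "hol V f" using assms by blast
    then have "(\<lambda>w. f (line a b w)) field_differentiable at w"
      by (intro holomorphic_on_imp_differentiable_at[OF hol_along_line open_line_vimage]) auto
    then show "(\<lambda>w. f (line a b w)) field_differentiable (at w within {w. line a b w \<in> U})"
      by (rule field_differentiable_at_within)
  qed
qed

text \<open>Weierstrass' theorem on each slice: closed discs inside the open slice inherit the
  uniform convergence from \<open>V\<close>.\<close>

lemma hol_uniform_limit:
  assumes "open V" "\<And>n. hol V (X n)" "uniform_limit V X f sequentially"
  shows "hol V f"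
proof (rule holI)
  show "continuous_on V f"
    
    by (rule uniform_limit_theorem[OF _ assms(3)]) (simp_all add: hol_continuous[OF assms(2)])
next
  fix a b :: pt
  show "(\<lambda>w. f (line a b w)) holomorphic_on {w. line a b w \<in> V}"
  proof (rule holomorphic_uniform_sequence)
    show op: "open {w. line a b w \<in> V}" by (rule open_line_vimage[OF assms(1)])
    show "(\<lambda>w. X n (line a b w)) holomorphic_on {w. line a b w \<in> V}" for n
      by (rule hol_along_line[OF assms(2)])
    fix w assume "w \<in> {w. line a b w \<in> V}"
    then obtain d where "d > 0" "cball w d \<subseteq> {w. line a b w \<in> V}"
      using op unfolding open_contains_cball by blast
    moreover from this have "uniform_limit (cball w d) (\<lambda>n w. X n (line a b w)) (\<lambda>w. f (line a b w)) sequentially"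
      by (intro uniform_limit_compose'[OF assms(3)]) auto
    ultimately show "\<exists>d>0. cball w d \<subseteq> {w. line a b w \<in> V} \<and>
        uniform_limit (cball w d) (\<lambda>n w. X n (line a b w)) (\<lambda>w. f (line a b w)) sequentially" by blast
  qed
qed

lemma hol_imp_holo_on:
  assumes "open U" "hol U f"
  shows "holo_on I f (U \<inter> cspace I)"
  unfolding holo_on_def
proof (intro conjI ballI)
  show "openin (top_of_set (cspace I)) (U \<inter> cspace I)" using assms by (auto simp: openin_open)
  show "continuous_on (U \<inter> cspace I) f" 
    by (rule continuous_on_subset[OF hol_continuous[OF assms(2)]]) simp
  fix s i assume s: "s \<in> U \<inter> cspace I"
  \<comment> \<open>Varying the \<open>i\<close>-th coordinate alone is motion along the line in the
    direction of the \<open>i\<close>-th unit vector.\<close>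
  let ?a = "s(i := 0)" and ?b = "(\<lambda>j. 0)(i := 1)"
  have eq: "line ?a ?b w = s(i := w)" for w by (auto simp: line_def)
  have "(\<lambda>w. f (line ?a ?b w)) holomorphic_on {w. line ?a ?b w \<in> U}"
    by (rule hol_along_line[OF assms(2)])
  then have "(\<lambda>w. f (line ?a ?b w)) field_differentiable at (s i)"
    by (rule holomorphic_on_imp_differentiable_at)
       (use s open_line_vimage[OF assms(1), of ?a ?b] in \<open>auto simp: eq\<close>)
  then show "(\<lambda>z. f (s(i := z))) field_differentiable at (s i)" unfolding eq .
qed

subsection \<open>Locally uniform polynomial bounds\<close>

text \<open>The constant is uniform near \<open>p\<close>, while the exponent moves with
  \<open>s\<close>. Keeping the exact exponent lets bounds be multiplied and transported along
  \<open>shift\<close> without giving away an epsilon each time.\<close>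

definition bigO_near :: "pt \<Rightarrow> (nat \<Rightarrow> pt \<Rightarrow> complex) \<Rightarrow> (pt \<Rightarrow> real) \<Rightarrow> bool" where
  "bigO_near p f e \<longleftrightarrow> (\<exists>C. \<forall>\<^sub>F s in nhds p. \<forall>N\<ge>1. norm (f N s) \<le> C * real N powr e s)"

lemma bigO_nearI:
  assumes "\<forall>\<^sub>F s in nhds p. \<forall>N\<ge>1. norm (f N s) \<le> C * real N powr e s" shows "bigO_near p f e"
  using assms unfolding bigO_near_def by (rule exI)

lemma bigO_nearE:
  assumes "bigO_near p f e"
  obtains C where "C \<ge> 0" "\<forall>\<^sub>F s in nhds p. \<forall>N\<ge>1. norm (f N s) \<le> C * real N powr e s"
proof -
  from assms obtain C where C: "\<forall>\<^sub>F s in nhds p. \<forall>N\<ge>1. norm (f N s) \<le> C * real N powr e s"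
    unfolding bigO_near_def by (rule exE)
  show ?thesis
  proof (rule that)
    show "max C 0 \<ge> 0" by simp
    show "\<forall>\<^sub>F s in nhds p. \<forall>N\<ge>1. norm (f N s) \<le> max C 0 * real N powr e s"
      using C
    proof (rule eventually_mono, intro allI impI)
      fix s N assume a: "\<forall>N\<ge>1. norm (f N s) \<le> C * real N powr e s" and "(N::nat) \<ge> 1"
      then have "norm (f N s) \<le> C * real N powr e s" by simp
      also have "\<dots> \<le> max C 0 * real N powr e s" by (intro mult_right_mono) auto
      finally show "norm (f N s) \<le> max C 0 * real N powr e s" .
    qed
  qed
qed

lemma bigO_near_cong:
  assumes "bigO_near p f e" "\<forall>\<^sub>F s in nhds p. \<forall>N\<ge>1. f N s = g N s" shows "bigO_near p g e"
proof -
  obtain C where "\<forall>\<^sub>F s in nhds p. \<forall>N\<ge>1. norm (f N s) \<le> C * real N powr e s"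
    using bigO_nearE[OF assms(1)] by blast
  then show ?thesis using assms(2) by (intro bigO_nearI[where C = C]) (auto elim: eventually_elim2)
qed

lemma bigO_near_mono:
  assumes "bigO_near p f e" "\<forall>\<^sub>F s in nhds p. e s \<le> e' s" shows "bigO_near p f e'"
proof -
  obtain C where C: "C \<ge> 0" and ev: "\<forall>\<^sub>F s in nhds p. \<forall>N\<ge>1. norm (f N s) \<le> C * real N powr e s"
    using bigO_nearE[OF assms(1)] .
  show ?thesis
  proof (rule bigO_nearI[where C = C], use ev assms(2) in eventually_elim, intro allI impI)
    fix s N assume a: "\<forall>N\<ge>1. norm (f N s) \<le> C * real N powr e s" "e s \<le> e' s" "(N::nat) \<ge> 1"
    then have "norm (f N s) \<le> C * real N powr e s" by simp
    also have "\<dots> \<le> C * real N powr e' s" using a C by (intro mult_left_mono powr_mono) auto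
    finally show "norm (f N s) \<le> C * real N powr e' s" .
  qed
qed

lemma bigO_near_add:
  assumes "bigO_near p f e" "bigO_near p g e" shows "bigO_near p (\<lambda>N s. f N s + g N s) e"
proof -
  obtain C where C: "\<forall>\<^sub>F s in nhds p. \<forall>N\<ge>1. norm (f N s) \<le> C * real N powr e s"
    using bigO_nearE[OF assms(1)] .
  obtain C' where C': "\<forall>\<^sub>F s in nhds p. \<forall>N\<ge>1. norm (g N s) \<le> C' * real N powr e s"
    using bigO_nearE[OF assms(2)] .
  show ?thesis
    by (rule bigO_nearI[where C = "C + C'"], use C C' in eventually_elim)
       (auto simp: distrib_right intro!: norm_triangle_le add_mono)
qed

lemma bigO_near_mult:
  assumes "bigO_near p f e" "bigO_near p g e'" shows "bigO_near p (\<lambda>N s. f N s * g N s) (\<lambda>s. e s + e' s)"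
proof -
  obtain C where C0: "C \<ge> 0" and C: "\<forall>\<^sub>F s in nhds p. \<forall>N\<ge>1. norm (f N s) \<le> C * real N powr e s"
    using bigO_nearE[OF assms(1)] .
  obtain C' where C': "\<forall>\<^sub>F s in nhds p. \<forall>N\<ge>1. norm (g N s) \<le> C' * real N powr e' s"
    using bigO_nearE[OF assms(2)] .
  show ?thesis
  proof (rule bigO_nearI[where C = "C * C'"], use C C' in eventually_elim, intro allI impI)
    fix s N assume a: "\<forall>N\<ge>1. norm (f N s) \<le> C * real N powr e s"
       "\<forall>N\<ge>1. norm (g N s) \<le> C' * real N powr e' s" "(N::nat) \<ge> 1"
    have "norm (f N s) * norm (g N s) \<le> (C * real N powr e s) * (C' * real N powr e' s)"
      using a C0 by (intro mult_mono) auto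
    then show "norm (f N s * g N s) \<le> C * C' * real N powr (e s + e' s)"
      by (simp add: norm_mult powr_add mult_ac)
  qed
qed

lemma norm_of_nat_powr: "N \<ge> 1 \<Longrightarrow> norm (of_nat N powr z :: complex) = real N powr Re z"
  by (subst norm_powr_real_powr) auto

lemma bigO_near_powr: "bigO_near p (\<lambda>N s. of_nat N powr g s) (\<lambda>s. Re (g s))"
  by (rule bigO_nearI[where C = 1]) (simp add: norm_of_nat_powr)

lemma isCont_eventually_norm_le:
  fixes z :: "pt \<Rightarrow> complex"
  assumes "isCont z p" shows "\<forall>\<^sub>F s in nhds p. norm (z s) \<le> norm (z p) + 1"
proof -
  have "(z \<longlongrightarrow> z p) (nhds p)" using assms by (simp add: isCont_def tendsto_at_iff_tendsto_nhds)
  then have "\<forall>\<^sub>F s in nhds p. dist (z s) (z p) < 1" by (auto simp: tendsto_iff)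
  then show ?thesis
  proof eventually_elim
    case (elim s)
    have "norm (z s) \<le> norm (z p) + norm (z s - z p)" by (metis add.commute norm_triangle_sub)
    then show ?case using elim by (auto simp: dist_norm)
  qed
qed

lemma bigO_near_isCont:
  assumes "isCont c p" shows "bigO_near p (\<lambda>N s. c s) (\<lambda>s. 0)"
  by (rule bigO_nearI[where C = "norm (c p) + 1"], use isCont_eventually_norm_le[OF assms] in eventually_elim) auto

lemma bigO_near_minus: "bigO_near p f e \<Longrightarrow> bigO_near p (\<lambda>N s. - f N s) e"
  by (simp add: bigO_near_def)

lemma bigO_near_diff: "bigO_near p f e \<Longrightarrow> bigO_near p g e \<Longrightarrow> bigO_near p (\<lambda>N s. f N s - g N s) e"
  using bigO_near_add[OF _ bigO_near_minus] by simp

lemma bigO_near_zero: "bigO_near p (\<lambda>N s. 0) e"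
  by (rule bigO_nearI[where C = 0]) simp

lemma bigO_near_sum:
  assumes "\<And>i. i \<in> A \<Longrightarrow> bigO_near p (f i) e" shows "bigO_near p (\<lambda>N s. \<Sum>i\<in>A. f i N s) e"
  using assms by (induction A rule: infinite_finite_induct) (auto intro: bigO_near_zero bigO_near_add)

lemma tendsto_shift: "filterlim shift (nhds (shift p)) (nhds p)"
  using continuous_on_shift[of UNIV]
  by (simp add: continuous_on_eq_continuous_at isCont_def tendsto_at_iff_tendsto_nhds)

lemma bigO_near_shift:
  assumes "bigO_near (shift p) f e" shows "bigO_near p (\<lambda>N s. f N (shift s)) (\<lambda>s. e (shift s))"
proof -
  obtain C where "\<forall>\<^sub>F s in nhds (shift p). \<forall>N\<ge>1. norm (f N s) \<le> C * real N powr e s"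
    using bigO_nearE[OF assms] .
  from eventually_compose_filterlim[OF this tendsto_shift] show ?thesis by (rule bigO_nearI)
qed

text \<open>The coefficients of the binomial series of $(1-x)^{-z}$.\<close>

definition rising_binomial :: "complex \<Rightarrow> nat \<Rightarrow> complex" where
  "rising_binomial z m = pochhammer z m / fact m"

lemma norm_rising_binomial_le: "norm z \<le> R \<Longrightarrow> norm (rising_binomial z m) \<le> pochhammer R m / fact m"
proof -
  assume "norm z \<le> R"
  then have "norm (z + of_nat i) \<le> R + real i" for i
    by (metis add_right_mono norm_of_nat norm_triangle_mono order_refl)
  then have "norm (pochhammer z m) \<le> pochhammer R m"
    unfolding pochhammer_prod prod_norm[symmetric] by (intro prod_mono) auto
  then show ?thesis by (simp add: rising_binomial_def norm_divide divide_right_mono)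
qed

lemma gbinomial_minus_power:
  "((-z) gchoose m) * (- x) ^ m = pochhammer z m / fact m * x ^ m" for x z :: "'a::field_char_0"
  by (simp add: gbinomial_pochhammer power_minus[of x])

text \<open>Uniformity in \<open>z\<close> comes from a majorant: for \<open>norm z \<le> R\<close>
  the coefficients are dominated by those of the series of \<open>(1 - x) powr (- R)\<close>, which
  converges at \<open>x = 1/2\<close>. Pulling \<open>x ^ Suc M\<close> out of the remainder leaves
  a sum bounded by the constant \<open>C\<close>.\<close>

lemma binomial_remainder:
  fixes R :: real
  assumes R: "R \<ge> 0"
  shows "\<exists>C. \<forall>z x. norm z \<le> R \<longrightarrow> 0 \<le> x \<longrightarrow> x \<le> 1/2 \<longrightarrow>
     norm ((1 - of_real x) powr (-z) - (\<Sum>m\<le>M. rising_binomial z m * of_real x ^ m)) \<le> C * x ^ Suc M"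
proof -
  define b where "b = (\<lambda>m. pochhammer R m / fact m)"
  have b_eq: "b m = pochhammer R m / fact m" for m by (simp add: b_def)
  have b0: "b m \<ge> 0" for m using R by (simp add: b_def pochhammer_prod prod_nonneg)
  have "summable (\<lambda>m. ((-R) gchoose m) * (- (1/2)) ^ m)"
    using gen_binomial_real[of "- (1/2)" "-R"] by (auto simp: sums_iff)
  moreover have "((-R) gchoose m) * (- (1/2)) ^ m = b m * (1/2) ^ m" for m
    unfolding b_def by (rule gbinomial_minus_power)
  ultimately have sm: "summable (\<lambda>m. b m * (1/2) ^ m)" by simp
  define C where "C = (\<Sum>m. b (m + Suc M) * (1/2) ^ m)"
  have "summable (\<lambda>m. b (m + Suc M) * (1/2) ^ (m + Suc M))"
    using sm by (rule summable_ignore_initial_segment)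
  then have "summable (\<lambda>m. 2 ^ Suc M * (b (m + Suc M) * (1/2) ^ (m + Suc M)))"
    by (rule summable_mult)
  moreover have "2 ^ Suc M * (b (m + Suc M) * (1/2) ^ (m + Suc M)) = b (m + Suc M) * (1/2) ^ m" for m
    by (simp add: power_add field_simps)
  ultimately have smC: "summable (\<lambda>m. b (m + Suc M) * (1/2) ^ m)" by (simp only:)
  show ?thesis
  proof (intro exI allI impI)
    fix z :: complex and x :: real assume z: "norm z \<le> R" and x: "0 \<le> x" "x \<le> 1/2"
    have "(\<lambda>m. ((-z) gchoose m) * (- of_real x) ^ m) sums (1 + - of_real x) powr (-z)"
      using x by (intro gen_binomial_complex) auto
    moreover have "((-z) gchoose m) * (- of_real x) ^ m = rising_binomial z m * of_real x ^ m" for m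
      unfolding rising_binomial_def by (rule gbinomial_minus_power)
    ultimately have S: "(\<lambda>m. rising_binomial z m * of_real x ^ m) sums (1 - of_real x) powr (-z)" by simp
    have "(\<lambda>m. rising_binomial z (m + Suc M) * of_real x ^ (m + Suc M)) sums
       ((1 - of_real x) powr (-z) - (\<Sum>m<Suc M. rising_binomial z m * of_real x ^ m))"
      using S by (subst sums_iff_shift)  auto
    then have eq: "(1 - of_real x) powr (-z) - (\<Sum>m\<le>M. rising_binomial z m * of_real x ^ m) =
       (\<Sum>m. rising_binomial z (m + Suc M) * of_real x ^ (m + Suc M))"
      by (simp add: sums_iff lessThan_Suc_atMost)
    have le: "norm (rising_binomial z (m + Suc M) * of_real x ^ (m + Suc M)) \<le> (b (m + Suc M) * (1/2) ^ m) * x ^ Suc M" for m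
    proof -
      have "norm (rising_binomial z (m + Suc M) * of_real x ^ (m + Suc M)) = norm (rising_binomial z (m + Suc M)) * x ^ m * x ^ Suc M"
        using x by (simp add: norm_mult norm_power power_add mult_ac)
      also have "\<dots> \<le> (b (m + Suc M) * (1/2) ^ m) * x ^ Suc M"
        using norm_rising_binomial_le[OF z, of "m + Suc M", folded b_eq] x b0[of "m + Suc M"]
        by (intro mult_mono power_mono mult_nonneg_nonneg) simp_all
      finally show ?thesis .
    qed
    show "norm ((1 - of_real x) powr (-z) - (\<Sum>m\<le>M. rising_binomial z m * of_real x ^ m)) \<le> C * x ^ Suc M"
      unfolding eq C_def suminf_mult2[OF smC]
      by (rule norm_suminf_le[OF le summable_mult2[OF smC]])
  qed
qed

text \<open>For \<open>N = 1\<close> the first term is \<open>0 powr _ = 0\<close>, so the bound extends to that case.\<close>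

lemma bigO_near_pred_powr:
  assumes z: "isCont z p"
  shows "bigO_near p (\<lambda>N s. of_nat (N - 1) powr (- z s) - (\<Sum>m\<le>M. rising_binomial (z s) m * of_nat N powr (- z s - of_nat m)))
     (\<lambda>s. - Re (z s) - real (Suc M))"
proof -
  define R where "R = norm (z p) + 1"
  have R: "R \<ge> 0" by (simp add: R_def add_nonneg_nonneg)
  obtain C where C: "\<And>z x. norm z \<le> R \<Longrightarrow> 0 \<le> x \<Longrightarrow> x \<le> 1/2 \<Longrightarrow>
     norm ((1 - of_real x) powr (-z) - (\<Sum>m\<le>M. rising_binomial z m * of_real x ^ m)) \<le> C * x ^ Suc M"
    using binomial_remainder[OF R, of M] by blast
  \<comment> \<open>This instance serves only to show that the constant is nonnegative: the
    left-hand side is a norm and \<open>(1/2) ^ Suc M\<close> is positive.\<close>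
  have "norm ((1 - of_real (1/2)) powr (-0) - (\<Sum>m\<le>M. rising_binomial 0 m * of_real (1/2) ^ m)) \<le> C * (1/2) ^ Suc M"
    using R by (intro C) auto
  then have "0 \<le> C * (1/2) ^ Suc M" using norm_ge_zero order_trans by blast
  moreover have "(1/2 :: real) ^ Suc M > 0" by simp
  ultimately have C0: "C \<ge> 0" using zero_le_mult_iff[of C "(1/2) ^ Suc M"] by linarith
  define B where "B = (\<Sum>m\<le>M. pochhammer R m / fact m)"
  have B0: "B \<ge> 0" unfolding B_def using R by (simp add: pochhammer_prod prod_nonneg sum_nonneg)
  show ?thesis
  proof (rule bigO_nearI[where C = "C + B"], use isCont_eventually_norm_le[OF z] in eventually_elim, intro allI impI)
    fix s and N :: nat assume "norm (z s) \<le> norm (z p) + 1" and N: "N \<ge> 1"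
    then have zs: "norm (z s) \<le> R" by (simp add: R_def)
    let ?L = "of_nat (N - 1) powr (- z s) - (\<Sum>m\<le>M. rising_binomial (z s) m * of_nat N powr (- z s - of_nat m))"
    show "norm ?L \<le> (C + B) * real N powr (- Re (z s) - real (Suc M))"
    proof (cases "N = 1")
      case True
      then have "norm ?L = norm (\<Sum>m\<le>M. rising_binomial (z s) m)" by simp
      also have "\<dots> \<le> B" unfolding B_def using zs by (intro sum_norm_le norm_rising_binomial_le)
      also have "\<dots> \<le> (C + B) * real N powr (- Re (z s) - real (Suc M))" using C0 True by simp
      finally show ?thesis .
    next
      case False
      define x where "x = 1 / real N"
      have x: "0 \<le> x" "x \<le> 1/2" using False N by (auto simp: x_def field_simps)
      have "of_nat (N - 1) powr (- z s) = (of_nat N * (1 - of_real x)) powr (- z s)"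
      proof -
        have "of_nat N * (1 - of_real x) = (of_nat (N - 1) :: complex)"
          using N by (simp add: x_def of_nat_diff right_diff_distrib)
        then show ?thesis by simp
      qed
      also have "\<dots> = of_nat N powr (- z s) * (1 - of_real x) powr (- z s)"
        using x by (intro powr_times_real) auto
      finally have 1: "of_nat (N - 1) powr (- z s) = of_nat N powr (- z s) * (1 - of_real x) powr (- z s)" .
      have 2: "of_nat N powr (- z s - of_nat m) = of_nat N powr (- z s) * of_real x ^ m" for m
        using N by (simp add: powr_diff x_def powr_nat' field_simps power_one_over)
      have "?L = of_nat N powr (- z s) * ((1 - of_real x) powr (- z s) - (\<Sum>m\<le>M. rising_binomial (z s) m * of_real x ^ m))"
        unfolding 1 2 by (simp add: sum_distrib_left right_diff_distrib mult_ac)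
      then have "norm ?L = real N powr (- Re (z s)) * norm ((1 - of_real x) powr (- z s) - (\<Sum>m\<le>M. rising_binomial (z s) m * of_real x ^ m))"
        using N by (simp add: norm_mult norm_of_nat_powr)
      also have "\<dots> \<le> real N powr (- Re (z s)) * (C * x ^ Suc M)"
        using C[OF zs x] by (intro mult_left_mono) auto
      also have "real N powr (- Re (z s)) * (C * x ^ Suc M) = C * real N powr (- Re (z s) - real (Suc M))"
      proof -
        have "real N powr (- Re (z s) - real (Suc M)) = real N powr (- Re (z s)) / real N ^ Suc M"
          using N by (simp add: powr_diff powr_add flip: powr_realpow)
        then show ?thesis by (simp add: x_def power_divide)
      qed
      also have "\<dots> \<le> (C + B) * real N powr (- Re (z s) - real (Suc M))"
        using B0 by (intro mult_right_mono) auto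
      finally show ?thesis .
    qed
  qed
qed

subsection \<open>Regularized summation\<close>

text \<open>For \<open>n > N\<close> the term \<open>n powr \<alpha>\<close> is at most
  \<open>N powr (\<alpha> + 2)\<close> times \<open>n powr (-2)\<close>, because
  \<open>\<alpha> + 2 \<le> 0\<close>. The second factor is bounded by \<open>1/(n-1) - 1/n\<close>,
  which telescopes to \<open>1/N\<close>.\<close>

lemma tail_sum_bound:
  fixes x :: "nat \<Rightarrow> complex"
  assumes x: "\<And>n. n \<ge> 1 \<Longrightarrow> norm (x n) \<le> C * real n powr \<alpha>" and \<alpha>: "\<alpha> \<le> -2" and C: "C \<ge> 0"
  shows "summable (\<lambda>n. x (Suc n))"
    and "N \<ge> 1 \<Longrightarrow> norm ((\<Sum>n. x (Suc n)) - (\<Sum>n=1..N. x n)) \<le> C * real N powr (\<alpha> + 1)"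
proof -
  have main: "summable (\<lambda>k. x (Suc (k + N))) \<and> norm (\<Sum>k. x (Suc (k + N))) \<le> C * real N powr (\<alpha> + 1)"
    if N: "N \<ge> 1" for N
  proof -
    define g where "g = (\<lambda>k. 1 / real (N + k))"
    have "g \<longlonglongrightarrow> 0" unfolding g_def
      using LIMSEQ_ignore_initial_segment[OF lim_1_over_n[where 'a=real], of N] by (simp add: add.commute)
    then have g: "(\<lambda>k. g k - g (Suc k)) sums (1 / real N)"
      using telescope_sums'[of g 0] by (simp add: g_def)
    define D where "D = C * real N powr (\<alpha> + 2)"
    have le: "norm (x (Suc (k + N))) \<le> D * (g k - g (Suc k))" for k
    proof -
      let ?n = "Suc (k + N)"
      have "norm (x ?n) \<le> C * real ?n powr \<alpha>" by (rule x) simp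
      also have "real ?n powr \<alpha> = real ?n powr (\<alpha> + 2) * real ?n powr (- 2)"
        by (simp flip: powr_add)
      also have "\<dots> \<le> real N powr (\<alpha> + 2) * (g k - g (Suc k))"
      proof (rule mult_mono)
        show "real ?n powr (\<alpha> + 2) \<le> real N powr (\<alpha> + 2)"
          using \<alpha> N by (intro powr_mono2') auto
        have "real ?n powr (- 2) = 1 / (real ?n * real ?n)"
          by (simp add: powr_minus power2_eq_square divide_inverse)
        also have "\<dots> \<le> 1 / (real (N + k) * real ?n)"
          using N by (intro divide_left_mono mult_right_mono mult_pos_pos) auto
        also have "\<dots> = g k - g (Suc k)" using N by (simp add: g_def field_simps)
        finally show "real ?n powr (- 2) \<le> g k - g (Suc k)" .
      qed auto
      finally show ?thesis using C by (simp add: D_def mult_left_mono mult.assoc)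
    qed
    have gs: "(\<lambda>k. D * (g k - g (Suc k))) sums (D * (1 / real N))" by (rule sums_mult[OF g])
    have "D * (1 / real N) = C * real N powr (\<alpha> + 1)"
    proof -
      have "real N powr (\<alpha> + 2) = real N powr (\<alpha> + 1) * real N powr 1"
        unfolding powr_add[symmetric] by (simp add: add.assoc)
      then show ?thesis using N by (simp add: D_def)
    qed
    moreover have "summable (\<lambda>k. x (Suc (k + N)))"
      by (rule summable_comparison_test'[OF sums_summable[OF gs], of 0]) (use le in simp)
    ultimately show ?thesis
      using norm_suminf_le[OF le sums_summable[OF gs]] gs by (simp add: sums_iff)
  qed
  show 1: "summable (\<lambda>n. x (Suc n))"
    using main[of 1] summable_iff_shift[of "\<lambda>n. x (Suc n)" 1] by simp
  assume N: "N \<ge> 1"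
  have "(\<Sum>n. x (Suc n)) = (\<Sum>k. x (Suc (k + N))) + (\<Sum>n<N. x (Suc n))"
    using suminf_split_initial_segment[OF 1, of N] by simp
  moreover have "(\<Sum>n<N. x (Suc n)) = (\<Sum>n=1..N. x n)"
    by (simp add: sum.atLeast1_atMost_eq)
  ultimately show "norm ((\<Sum>n. x (Suc n)) - (\<Sum>n=1..N. x n)) \<le> C * real N powr (\<alpha> + 1)"
    using main[OF N] by simp
qed

lemma tendsto_nat_powr_neg: "Re z < 0 \<Longrightarrow> (\<lambda>N. of_nat N powr z :: complex) \<longlonglongrightarrow> 0"
proof -
  assume z: "Re z < 0"
  have "(\<lambda>N. real N powr Re z) \<longlonglongrightarrow> 0"
    using z by (intro tendsto_neg_powr filterlim_real_sequentially)
  then show ?thesis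
    by (rule Lim_null_comparison[rotated])
       (auto simp: norm_of_nat_powr intro!: eventually_sequentiallyI[of 1])
qed

lemma sum_triangle_swap:
  fixes f :: "nat \<Rightarrow> nat \<Rightarrow> 'a::comm_monoid_add"
  shows "(\<Sum>l<K. \<Sum>k=l..<K. f l k) = (\<Sum>k<K. \<Sum>l\<le>k. f l k)"
proof -
  have "(\<Sum>l<K. \<Sum>k=l..<K. f l k) = (\<Sum>(l,k)\<in>(SIGMA l:{..<K}. {l..<K}). f l k)"
    by (simp add: sum.Sigma)
  also have "\<dots> = (\<Sum>(k,l)\<in>(SIGMA k:{..<K}. {..k}). f l k)"
    by (rule sum.reindex_bij_witness[of _ prod.swap prod.swap]) auto
  finally show ?thesis by (simp add: sum.Sigma)
qed

text \<open>The recurrence \<open>rec\<close> is obtained by comparing the coefficients of $n^{-w-k}$ in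
  $\sum_l d_l((n-1)^{1-w-l}-n^{1-w-l})\sim\sum_k c_kn^{-w-k}$.\<close>

locale reg_sum =
  fixes U :: "pt set" and w :: "pt \<Rightarrow> complex" and a :: "nat \<Rightarrow> pt \<Rightarrow> complex"
    and c d :: "nat \<Rightarrow> pt \<Rightarrow> complex"
  assumes opn: "open U" and hw: "hol U w" and hd: "\<And>k. hol U (d k)"
    and ha: "\<And>N. N \<ge> 1 \<Longrightarrow> hol U (a N)"
    and rem: "\<And>p K. p \<in> U \<Longrightarrow>
      bigO_near p (\<lambda>N s. a N s - (\<Sum>k<K. c k s * of_nat N powr (- w s - of_nat k))) (\<lambda>s. - Re (w s) - real K)"
    and rec: "\<And>s k. s \<in> U \<Longrightarrow> (\<Sum>l\<le>k. d l s * rising_binomial (w s - 1 + of_nat l) (k + 1 - l)) = c k s"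
begin

lemma isCont_of_hol: "hol U f \<Longrightarrow> p \<in> U \<Longrightarrow> isCont f p"
  using opn hol_continuous continuous_on_eq_continuous_at by blast

lemma ev_U: "p \<in> U \<Longrightarrow> \<forall>\<^sub>F s in nhds p. s \<in> U"
  using opn by (rule eventually_nhds_in_open)

definition main_part :: "nat \<Rightarrow> nat \<Rightarrow> pt \<Rightarrow> complex" where
  "main_part K N s = (\<Sum>k<K. d k s * of_nat N powr (1 - w s - of_nat k))"

definition corrected :: "nat \<Rightarrow> nat \<Rightarrow> pt \<Rightarrow> complex" where
  "corrected K N s = (\<Sum>n=1..N. a n s) + main_part K N s"

definition incr :: "nat \<Rightarrow> nat \<Rightarrow> pt \<Rightarrow> complex" where
  "incr K n s = a n s + main_part K n s - main_part K (n - 1) s"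

text \<open>The telescoping can start at \<open>N = 0\<close> without a boundary term:
  \<open>0 powr z = 0\<close> makes \<open>main_part K 0\<close> vanish.\<close>

lemma corrected_eq: "corrected K N s = (\<Sum>n=1..N. incr K n s)"
proof (induction N)
  case 0 show ?case by (simp add: corrected_def main_part_def)
next
  case (Suc N)
  have "corrected K (Suc N) s = corrected K N s + incr K (Suc N) s" by (simp add: corrected_def incr_def)
  with Suc show ?case by simp
qed

lemma hol_corrected: "hol U (corrected K N)"
proof (cases "N = 0")
  case True
  then have "corrected K N = (\<lambda>s. 0)" by (simp add: corrected_def main_part_def fun_eq_iff)
  then show ?thesis by simp
next
  case False
  then show ?thesis unfolding corrected_def main_part_def
    by (intro hol_add hol_sum hol_mult hol_powr hol_diff hd hw hol_const ha) auto
qed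

text \<open>Each power of \<open>n - 1\<close> in \<open>main_part K (n - 1)\<close> is replaced by
  its binomial expansion in powers of \<open>n\<close>. The leading terms cancel
  \<open>main_part K n\<close>, and \<open>rec\<close> makes the others cancel the first
  \<open>K\<close> terms of the expansion of \<open>a\<close>. What remains is the remainder of
  \<open>a\<close> and the binomial remainders.\<close>

lemma bigO_near_incr:
  assumes p: "p \<in> U" shows "bigO_near p (incr K) (\<lambda>s. - Re (w s) - real K)"
proof -
  define z where "z = (\<lambda>l s. w s - 1 + of_nat l)"
  \<comment> \<open>Truncation at \<open>K - l\<close> gives all \<open>l\<close> the same remainder
    exponent: \<open>z l\<close> plus \<open>K - l + 1\<close> equals \<open>w + K\<close>.\<close>
  define D where "D = (\<lambda>l N s. of_nat (N - 1) powr (- z l s) -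
      (\<Sum>m\<le>K-l. rising_binomial (z l s) m * of_nat N powr (- z l s - of_nat m)))"
  have D: "bigO_near p (\<lambda>N s. d l s * D l N s) (\<lambda>s. - Re (w s) - real K)" if "l < K" for l
  proof -
    have "hol U (z l)" unfolding z_def by (intro hol_add hol_diff hw hol_const)
    then have "bigO_near p (D l) (\<lambda>s. - Re (z l s) - real (Suc (K - l)))"
      unfolding D_def using p by (intro bigO_near_pred_powr isCont_of_hol)
    from bigO_near_mult[OF bigO_near_isCont[OF isCont_of_hol[OF hd p]] this, of l]
    moreover have "0 + (- Re (z l s) - real (Suc (K - l))) = - Re (w s) - real K" for s
      using that by (simp add: z_def of_nat_diff)
    ultimately show ?thesis by (simp only:)
  qed
  have L: "bigO_near p (\<lambda>N s. (a N s - (\<Sum>k<K. c k s * of_nat N powr (- w s - of_nat k))) - (\<Sum>l<K. d l s * D l N s))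
     (\<lambda>s. - Re (w s) - real K)"
    by (intro bigO_near_diff rem p bigO_near_sum D) auto
  show ?thesis
  proof (rule bigO_near_cong[OF L], use ev_U[OF p] in eventually_elim, intro allI impI)
    fix s N assume s: "s \<in> U" and N: "(N::nat) \<ge> 1"
    let ?p = "\<lambda>z. (of_nat N :: complex) powr z"
    have inner: "(\<Sum>m\<le>K-l. rising_binomial (z l s) m * ?p (- z l s - of_nat m)) =
        ?p (1 - w s - of_nat l) + (\<Sum>k=l..<K. rising_binomial (z l s) (k + 1 - l) * ?p (- w s - of_nat k))" if "l < K" for l
    proof -
      have "(\<Sum>m\<le>K-l. rising_binomial (z l s) m * ?p (- z l s - of_nat m)) =
          rising_binomial (z l s) 0 * ?p (- z l s) + (\<Sum>m\<in>{..K-l}-{0}. rising_binomial (z l s) m * ?p (- z l s - of_nat m))"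
        by (subst sum.remove[of _ 0]) auto
      \<comment> \<open>The substitution is \<open>k = m + l - 1\<close>. The term
        \<open>m = 0\<close> was split off because it carries the exponent \<open>1 - w - l\<close>
        and belongs to \<open>main_part\<close>.\<close>
      also have "(\<Sum>m\<in>{..K-l}-{0}. rising_binomial (z l s) m * ?p (- z l s - of_nat m)) =
          (\<Sum>k=l..<K. rising_binomial (z l s) (k + 1 - l) * ?p (- w s - of_nat k))"
        by (rule sum.reindex_bij_witness[of _ "\<lambda>k. k + 1 - l" "\<lambda>m. m + l - 1"])
           (use that in \<open>auto simp: z_def of_nat_diff algebra_simps\<close>)
      finally show ?thesis by (simp add: rising_binomial_def z_def algebra_simps)
    qed
    have "(\<Sum>l<K. d l s * D l N s) = (\<Sum>l<K. d l s * of_nat (N - 1) powr (- z l s)) -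
        (\<Sum>l<K. d l s * ?p (1 - w s - of_nat l)) -
        (\<Sum>l<K. \<Sum>k=l..<K. d l s * rising_binomial (z l s) (k + 1 - l) * ?p (- w s - of_nat k))"
      unfolding sum_subtractf[symmetric]
      by (intro sum.cong refl) (simp add: D_def inner right_diff_distrib distrib_left sum_distrib_left mult.assoc)
    also have "(\<Sum>l<K. \<Sum>k=l..<K. d l s * rising_binomial (z l s) (k + 1 - l) * ?p (- w s - of_nat k)) =
       (\<Sum>k<K. c k s * ?p (- w s - of_nat k))"
      unfolding sum_triangle_swap rec[OF s, symmetric] z_def by (simp add: sum_distrib_right)
    also have "(\<Sum>l<K. d l s * of_nat (N - 1) powr (- z l s)) = main_part K (N - 1) s"
      by (simp add: main_part_def z_def algebra_simps)
    finally show "a N s - (\<Sum>k<K. c k s * ?p (- w s - of_nat k)) - (\<Sum>l<K. d l s * D l N s) = incr K N s"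
      by (simp add: incr_def main_part_def)
  qed
qed

lemma corrected_diff: "K \<le> K' \<Longrightarrow> corrected K' N s - corrected K N s = (\<Sum>k=K..<K'. d k s * of_nat N powr (1 - w s - of_nat k))"
  unfolding corrected_def main_part_def by (simp add: sum_diff_nat_ivl[of 0 K K', symmetric] lessThan_atLeast0)

lemma tendsto_corrected_diff:
  assumes "Re (w s) + real K > 1" "K \<le> K'"
  shows "(\<lambda>N. corrected K' N s - corrected K N s) \<longlonglongrightarrow> 0"
  unfolding corrected_diff[OF assms(2)] using assms(1)
  by (intro tendsto_null_sum tendsto_mult_right_zero tendsto_nat_powr_neg) auto

text \<open>Absolute convergence is checked for one \<open>K0\<close> that makes the increments
  O(1/n^2). Every other admissible \<open>K\<close> differs from it by finitely many powers of
  \<open>N\<close> whose exponents have negative real part, so the limit is independent of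
  \<open>K\<close>.\<close>

lemma corrected_converges:
  assumes s: "s \<in> U" shows "\<exists>L. \<forall>K. Re (w s) + real K > 1 \<longrightarrow> (\<lambda>N. corrected K N s) \<longlonglongrightarrow> L"
proof -
  define K0 where "K0 = nat \<lceil>2 - Re (w s)\<rceil>"
  have K0: "- Re (w s) - real K0 \<le> -2" unfolding K0_def by linarith
  obtain C where C: "C \<ge> 0" "\<forall>\<^sub>F t in nhds s. \<forall>N\<ge>1. norm (incr K0 N t) \<le> C * real N powr (- Re (w t) - real K0)"
    using bigO_nearE[OF bigO_near_incr[OF s]] .
  then have "\<And>n. n \<ge> 1 \<Longrightarrow> norm (incr K0 n s) \<le> C * real n powr (- Re (w s) - real K0)"
    by (auto dest: eventually_nhds_x_imp_x)
  from tail_sum_bound(1)[OF this K0 C(1)] have "(\<lambda>N. \<Sum>n<N. incr K0 (Suc n) s) \<longlonglongrightarrow> (\<Sum>n. incr K0 (Suc n) s)"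
    by (auto simp: summable_LIMSEQ)
  then obtain L where L: "(\<lambda>N. corrected K0 N s) \<longlonglongrightarrow> L"
    by (auto simp: corrected_eq sum.atLeast1_atMost_eq)
  have "(\<lambda>N. corrected K N s) \<longlonglongrightarrow> L" if K: "Re (w s) + real K > 1" for K
  proof (cases "K \<le> K0")
    case True
    from tendsto_diff[OF L tendsto_corrected_diff[OF K this]] show ?thesis by simp
  next
    case False
    have "Re (w s) + real K0 > 1" using K0 by simp
    from tendsto_add[OF L tendsto_corrected_diff[OF this, of K]] False show ?thesis by simp
  qed
  then show ?thesis by blast
qed

definition regularized :: "pt \<Rightarrow> complex" where
  "regularized s = (SOME L. \<forall>K. Re (w s) + real K > 1 \<longrightarrow> (\<lambda>N. corrected K N s) \<longlonglongrightarrow> L)"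

lemma corrected_tendsto_regularized: "s \<in> U \<Longrightarrow> Re (w s) + real K > 1 \<Longrightarrow> (\<lambda>N. corrected K N s) \<longlonglongrightarrow> regularized s"
  using someI_ex[OF corrected_converges, of s] unfolding regularized_def by simp

lemma sum_tendsto_regularized: "s \<in> U \<Longrightarrow> Re (w s) > 1 \<Longrightarrow> (\<lambda>N. \<Sum>n=1..N. a n s) \<longlonglongrightarrow> regularized s"
  using corrected_tendsto_regularized[of s 0] by (simp add: corrected_def main_part_def)

lemma regularized_bound:
  assumes p: "p \<in> U"
  obtains K0 C where "K0 \<ge> K" "C \<ge> 0"
    "\<forall>\<^sub>F s in nhds p. s \<in> U \<and> - Re (w s) - real K0 \<le> -2 \<and>
       (\<forall>N\<ge>1. norm (regularized s - corrected K0 N s) \<le> C * real N powr (1 - Re (w s) - real K0))"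
proof -
  \<comment> \<open>One \<open>K0\<close> has to serve a whole neighbourhood: 2 makes the increments
    summable and the extra 1 absorbs the variation of \<open>w\<close> near
    \<open>p\<close>.\<close>
  define K0 where "K0 = max K (nat \<lceil>2 + norm (w p) + 1\<rceil>)"
  have K0: "norm (w p) + 1 \<le> real K0 - 2" unfolding K0_def by linarith
  obtain C where C: "C \<ge> 0" "\<forall>\<^sub>F t in nhds p. \<forall>N\<ge>1. norm (incr K0 N t) \<le> C * real N powr (- Re (w t) - real K0)"
    using bigO_nearE[OF bigO_near_incr[OF p]] .
  show ?thesis
  proof (rule that)
    show "K0 \<ge> K" by (simp add: K0_def)
    show "C \<ge> 0" by fact
    show "\<forall>\<^sub>F s in nhds p. s \<in> U \<and> - Re (w s) - real K0 \<le> -2 \<and>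
       (\<forall>N\<ge>1. norm (regularized s - corrected K0 N s) \<le> C * real N powr (1 - Re (w s) - real K0))"
      using C(2) ev_U[OF p] isCont_eventually_norm_le[OF isCont_of_hol[OF hw p]]
    proof eventually_elim
      case (elim s)
      have re: "- Re (w s) - real K0 \<le> -2"
        using elim(3) K0 abs_Re_le_cmod[of "w s"] by linarith
      have x: "\<And>n. n \<ge> 1 \<Longrightarrow> norm (incr K0 n s) \<le> C * real n powr (- Re (w s) - real K0)"
        using elim by simp
      have "(\<lambda>N. \<Sum>n<N. incr K0 (Suc n) s) \<longlonglongrightarrow> (\<Sum>n. incr K0 (Suc n) s)"
        using tail_sum_bound(1)[OF x re C(1)] by (rule summable_LIMSEQ)
      moreover have "(\<lambda>N. \<Sum>n<N. incr K0 (Suc n) s) \<longlonglongrightarrow> regularized s"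
        using corrected_tendsto_regularized[OF elim(2), of K0] re by (simp add: corrected_eq sum.atLeast1_atMost_eq)
      ultimately have "(\<Sum>n. incr K0 (Suc n) s) = regularized s" by (rule LIMSEQ_unique)
      with tail_sum_bound(2)[OF x re C(1)] elim re show ?case
        by (simp add: corrected_eq algebra_simps)
    qed
  qed
qed

text \<open>The estimate is available only for some large \<open>K0\<close>. Going back to an
  arbitrary \<open>K\<close> adds the finitely many terms \<open>K \<le> k < K0\<close>, each within
  the error allowed for \<open>K\<close>.\<close>

lemma regularized_expansion:
  assumes p: "p \<in> U"
  shows "bigO_near p (\<lambda>N s. regularized s - (\<Sum>n=1..N. a n s) - (\<Sum>k<K. d k s * of_nat N powr (1 - w s - of_nat k)))
     (\<lambda>s. 1 - Re (w s) - real K)"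
proof -
  obtain K0 C where K0: "K0 \<ge> K" and C: "C \<ge> 0" "\<forall>\<^sub>F s in nhds p. s \<in> U \<and> - Re (w s) - real K0 \<le> -2 \<and>
       (\<forall>N\<ge>1. norm (regularized s - corrected K0 N s) \<le> C * real N powr (1 - Re (w s) - real K0))"
    using regularized_bound[OF p] .
  have "bigO_near p (\<lambda>N s. regularized s - corrected K0 N s) (\<lambda>s. 1 - Re (w s) - real K0)"
    by (rule bigO_nearI[where C = C]) (use C(2) in \<open>auto elim: eventually_mono\<close>)
  then have 1: "bigO_near p (\<lambda>N s. regularized s - corrected K0 N s) (\<lambda>s. 1 - Re (w s) - real K)"
    by (rule bigO_near_mono) (use K0 in auto)
  have "bigO_near p (\<lambda>N s. d k s * of_nat N powr (1 - w s - of_nat k)) (\<lambda>s. 1 - Re (w s) - real K)" if "k \<ge> K" for k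
    by (rule bigO_near_mono[OF bigO_near_mult[OF bigO_near_isCont[OF isCont_of_hol[OF hd p]] bigO_near_powr]]) (use that in auto)
  then have 2: "bigO_near p (\<lambda>N s. \<Sum>k=K..<K0. d k s * of_nat N powr (1 - w s - of_nat k)) (\<lambda>s. 1 - Re (w s) - real K)"
    by (intro bigO_near_sum) auto
  show ?thesis
    by (rule bigO_near_cong[OF bigO_near_add[OF 1 2]]) (auto simp: corrected_diff[OF K0, symmetric] corrected_def[of K] main_part_def)
qed

lemma hol_regularized: "hol U regularized"
proof (rule hol_local)
  fix p assume p: "p \<in> U"
  obtain K0 C where C: "C \<ge> 0" "\<forall>\<^sub>F s in nhds p. s \<in> U \<and> - Re (w s) - real K0 \<le> -2 \<and>
       (\<forall>N\<ge>1. norm (regularized s - corrected K0 N s) \<le> C * real N powr (1 - Re (w s) - real K0))"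
    using regularized_bound[OF p, of 0] .
  obtain V where V: "open V" "p \<in> V" and
    b: "\<And>s. s \<in> V \<Longrightarrow> s \<in> U \<and> - Re (w s) - real K0 \<le> -2 \<and>
       (\<forall>N\<ge>1. norm (regularized s - corrected K0 N s) \<le> C * real N powr (1 - Re (w s) - real K0))"
    using C(2) unfolding eventually_nhds by auto
  have ul: "uniform_limit V (corrected K0) regularized sequentially"
    unfolding uniform_limit_iff
  proof (intro allI impI)
    fix e :: real assume e: "e > 0"
    obtain N0 :: nat where N0: "real N0 > C / e" using reals_Archimedean2 by blast
    show "\<forall>\<^sub>F N in sequentially. \<forall>s\<in>V. dist (corrected K0 N s) (regularized s) < e"
    proof (rule eventually_sequentiallyI[of "max 1 N0"], intro ballI)
      fix N s assume N: "N \<ge> max 1 N0" and s: "s \<in> V"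
      have "norm (regularized s - corrected K0 N s) \<le> C * real N powr (1 - Re (w s) - real K0)" using b[OF s] N by simp
      also have "\<dots> \<le> C * real N powr (-1)" using b[OF s] N C(1)
        by (intro mult_left_mono powr_mono) auto
      also have "\<dots> = C / real N" using N by (simp add: powr_minus divide_inverse)
      also have "\<dots> < e"
      proof -
        have "C / e < real N" using N0 N by simp
        then show ?thesis using e N by (simp add: field_simps)
      qed
      finally show "dist (corrected K0 N s) (regularized s) < e" by (simp add: dist_norm norm_minus_commute)
    qed
  qed
  have hx: "hol V (corrected K0 n)" for n by (rule hol_subset[OF hol_corrected]) (use b in auto)
  have "hol V regularized" by (rule hol_uniform_limit[OF V(1) hx ul])
  then show "\<exists>V. open V \<and> p \<in> V \<and> hol V regularized" using V by auto
qed

end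

subsection \<open>Continuation of the tails\<close>

text \<open>This is the recursive form of the complement of the hyperplanes: each step adds those
  that involve all coordinates. In depth one (\<open>j = 0\<close>) only \<open>n = 0\<close> is
  removed, the pole of the Riemann zeta function.\<close>

primrec regular_pts :: "nat \<Rightarrow> pt set" where
  "regular_pts 0 = UNIV"
| "regular_pts (Suc j) = {s. shift s \<in> regular_pts j} \<inter>
     {s. \<forall>n. (j = 0 \<longrightarrow> n = 0) \<longrightarrow> (\<Sum>k=1..Suc j. s k) \<noteq> of_nat (Suc j) - of_nat n}"

text \<open>This is the order of decay of the depth-\<open>j\<close> tail: its expansion in
  \<open>N\<close> starts with exponent \<open>- excess j s\<close>. The hyperplanes involving all
  coordinates are the sets where it equals \<open>- n\<close> for a natural number
  \<open>n\<close>.\<close>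

definition excess :: "nat \<Rightarrow> pt \<Rightarrow> complex" where
  "excess j s = (\<Sum>k=1..j. s k) - of_nat j"

lemma sum_Suc_shift: "(\<Sum>k=1..Suc j. s k) = s 1 + (\<Sum>k=1..j. shift s k)"
proof -
  have "(\<Sum>k=1..Suc j. s k) = s 1 + (\<Sum>k=Suc 1..Suc j. s k)"
    by (rule sum.atLeast_Suc_atMost) simp
  also have "(\<Sum>k=Suc 1..Suc j. s k) = (\<Sum>k=1..j. s (Suc k))"
    by (rule sum.shift_bounds_cl_Suc_ivl)
  also have "\<dots> = (\<Sum>k=1..j. shift s k)"
    by (intro sum.cong) (auto simp: shift_def)
  finally show ?thesis .
qed

lemma excess_Suc: "excess (Suc j) s = s 1 + excess j (shift s) - 1"
  unfolding excess_def sum_Suc_shift by simp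

lemma hol_excess: "hol U (excess j)"
  unfolding excess_def by (intro hol_diff hol_sum hol_coord hol_const)

lemma closed_nat_diff: "closed {of_nat m - of_nat n :: complex | n. Q n}"
  by (rule closed_subset_Ints) auto

lemma open_regular_pts: "open (regular_pts j)"
proof (induction j)
  case (Suc j)
  define Z where "Z = {of_nat (Suc j) - of_nat n :: complex | n. j = 0 \<longrightarrow> n = 0}"
  have "open (shift -` regular_pts j)"
    using Suc continuous_on_shift by (rule open_vimage)
  moreover have "open ((\<lambda>s. \<Sum>k=1..Suc j. s k :: complex) -` (- Z))"
    unfolding Z_def by (intro open_vimage open_Compl closed_nat_diff continuous_intros)
  moreover have "regular_pts (Suc j) = shift -` regular_pts j \<inter> (\<lambda>s. \<Sum>k=1..Suc j. s k) -` (- Z)"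
    unfolding regular_pts.simps Z_def by blast
  ultimately show ?case by (simp only: open_Int)
qed simp

text \<open>The recurrence is a triangular system, solved here for its diagonal unknown. The
  diagonal entry \<open>rising_binomial (w - 1 + of_nat k) 1\<close> equals
  \<open>w - 1 + of_nat k\<close>, hence the denominator.\<close>

function dcoef :: "(nat \<Rightarrow> complex) \<Rightarrow> complex \<Rightarrow> nat \<Rightarrow> complex" where
  "dcoef c w k = (c k - (\<Sum>l<k. dcoef c w l * rising_binomial (w - 1 + of_nat l) (k + 1 - l))) / (w - 1 + of_nat k)"
  by auto
termination by (relation "Wellfounded.measure (\<lambda>(c, w, k). k)") auto

declare dcoef.simps [simp del]

lemma rising_binomial_1 [simp]: "rising_binomial z (Suc 0) = z"
  by (simp add: rising_binomial_def)

lemma dcoef_rec: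
  assumes "w - 1 + of_nat k \<noteq> 0"
  shows "(\<Sum>l\<le>k. dcoef c w l * rising_binomial (w - 1 + of_nat l) (k + 1 - l)) = c k"
proof -
  have "(\<Sum>l\<le>k. dcoef c w l * rising_binomial (w - 1 + of_nat l) (k + 1 - l)) =
     (\<Sum>l<k. dcoef c w l * rising_binomial (w - 1 + of_nat l) (k + 1 - l)) + dcoef c w k * (w - 1 + of_nat k)"
    by (simp flip: lessThan_Suc_atMost)
  also have "dcoef c w k * (w - 1 + of_nat k) = c k - (\<Sum>l<k. dcoef c w l * rising_binomial (w - 1 + of_nat l) (k + 1 - l))"
    by (subst dcoef.simps) (use assms in simp)
  finally show ?thesis by simp
qed

lemma hol_rising_binomial: "hol U f \<Longrightarrow> hol U (\<lambda>s. rising_binomial (f s) m)"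
  unfolding rising_binomial_def pochhammer_prod by (intro hol_divide hol_prod hol_add hol_const) auto

lemma hol_dcoef:
  assumes "\<And>k. hol U (c k)" "hol U w" "\<And>s k. s \<in> U \<Longrightarrow> w s - 1 + of_nat k \<noteq> 0"
  shows "hol U (\<lambda>s. dcoef (\<lambda>k. c k s) (w s) k)"
proof (induction k rule: less_induct)
  case (less k)
  show ?case
    by (subst dcoef.simps)
       (intro hol_divide hol_diff hol_sum hol_mult hol_rising_binomial hol_add hol_const assms less, auto)
qed

text \<open>These are \<open>B\<^sub>k / k!\<close> up to sign; only the recurrence matters.\<close>

function beta :: "nat \<Rightarrow> complex" where
  "beta k = (if k = 0 then 1 else 0) - (\<Sum>l<k. beta l / fact (k + 1 - l))"
  by auto
termination by (relation "Wellfounded.measure (\<lambda>k. k)") auto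

declare beta.simps [simp del]

lemma beta_rec: "(\<Sum>l\<le>k. beta l / fact (k + 1 - l)) = (if k = 0 then 1 else 0)"
proof -
  have "(\<Sum>l\<le>k. beta l / fact (k + 1 - l)) = (\<Sum>l<k. beta l / fact (k + 1 - l)) + beta k"
    by (simp flip: lessThan_Suc_atMost)
  also have "beta k = (if k = 0 then 1 else 0) - (\<Sum>l<k. beta l / fact (k + 1 - l))"
    by (rule beta.simps)
  finally show ?thesis by simp
qed

text \<open>The two Pochhammer symbols combine to \<open>pochhammer (w - 1) (k + 1)\<close>, which
  does not depend on \<open>l\<close>, so the numerical recurrence of \<open>beta\<close> remains.
  For \<open>k \<ge> 1\<close> the factor \<open>w - 1\<close> cancels and the coefficients are
  polynomials in \<open>w\<close>; only \<open>w = 1\<close> is singular.\<close>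

lemma bernoulli_rec:
  assumes "w \<noteq> 1"
  shows "(\<Sum>l\<le>k. (beta l * pochhammer (w - 1) l / (w - 1)) * rising_binomial (w - 1 + of_nat l) (k + 1 - l)) =
     (if k = 0 then 1 else 0)"
proof -
  have "(\<Sum>l\<le>k. (beta l * pochhammer (w - 1) l / (w - 1)) * rising_binomial (w - 1 + of_nat l) (k + 1 - l)) =
     (\<Sum>l\<le>k. pochhammer (w - 1) (k + 1) / (w - 1) * (beta l / fact (k + 1 - l)))"
  proof (intro sum.cong refl)
    fix l assume "l \<in> {..k}"
    then have "pochhammer (w - 1) (k + 1) = pochhammer (w - 1) l * pochhammer (w - 1 + of_nat l) (k + 1 - l)"
      by (intro pochhammer_product) auto
    then show "(beta l * pochhammer (w - 1) l / (w - 1)) * rising_binomial (w - 1 + of_nat l) (k + 1 - l) =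
       pochhammer (w - 1) (k + 1) / (w - 1) * (beta l / fact (k + 1 - l))"
      by (simp add: rising_binomial_def)
  qed
  also have "\<dots> = pochhammer (w - 1) (k + 1) / (w - 1) * (if k = 0 then 1 else 0)"
    unfolding sum_distrib_left[symmetric] beta_rec ..
  also have "\<dots> = (if k = 0 then 1 else 0)" using assms by simp
  finally show ?thesis .
qed

section \<open>Construction of the tails by induction on the depth\<close>

definition expansion :: "nat \<Rightarrow> (nat \<Rightarrow> pt \<Rightarrow> complex) \<Rightarrow> (nat \<Rightarrow> pt \<Rightarrow> complex) \<Rightarrow> bool" where
  "expansion j t c \<longleftrightarrow> (\<forall>k. hol (regular_pts j) (c k)) \<and> (\<forall>p\<in>regular_pts j. \<forall>K.
     bigO_near p (\<lambda>N s. t N s - (\<Sum>k<K. c k s * of_nat N powr (- excess j s - of_nat k))) (\<lambda>s. - Re (excess j s) - real K))"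

text \<open>The clause for \<open>j = 0\<close> pins the empty tail down exactly: the first step
  relies on its one-term expansion and not merely on the existence of some expansion.\<close>

definition tail_family :: "nat \<Rightarrow> (nat \<Rightarrow> pt \<Rightarrow> complex) \<Rightarrow> bool" where
  "tail_family j t \<longleftrightarrow> (j = 0 \<longrightarrow> t = (\<lambda>N s. 1)) \<and> (\<forall>N. hol (regular_pts j) (t N)) \<and> (\<exists>c. expansion j t c)"

definition summand :: "(nat \<Rightarrow> pt \<Rightarrow> complex) \<Rightarrow> nat \<Rightarrow> pt \<Rightarrow> complex" where
  "summand t n s = of_nat n powr (- s 1) * t n (shift s)"

definition tail_step :: "nat \<Rightarrow> (nat \<Rightarrow> pt \<Rightarrow> complex) \<Rightarrow> (nat \<Rightarrow> pt \<Rightarrow> complex) \<Rightarrow> bool" where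
  "tail_step j t t' \<longleftrightarrow> (\<forall>N s. t' N s = t' 0 s - (\<Sum>n=1..N. summand t n s)) \<and>
     (\<forall>s\<in>regular_pts (Suc j). Re (excess (Suc j) s) > 0 \<longrightarrow> (\<lambda>N. \<Sum>n=1..N. summand t n s) \<longlonglongrightarrow> t' 0 s)"

lemma expansion_0: "expansion 0 (\<lambda>N s. 1) (\<lambda>k s. if k = 0 then 1 else 0)"
  unfolding expansion_def
proof (intro conjI allI ballI)
  fix p :: pt and K
  show "bigO_near p (\<lambda>N s. 1 - (\<Sum>k<K. (if k = 0 then 1 else 0) * of_nat N powr (- excess 0 s - of_nat k)))
     (\<lambda>s. - Re (excess 0 s) - real K)"
  proof (cases "K = 0")
    case True
    show ?thesis using bigO_near_isCont[of p "\<lambda>s. 1"] True by (simp add: excess_def)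
  next
    case False
    have "(\<Sum>k<K. (if k = 0 then 1 else 0) * of_nat N powr (- excess 0 s - of_nat k)) = 1"
      if "N \<ge> 1" for N and s :: pt
    proof -
      have "(\<Sum>k<K. (if k = 0 then 1 else 0) * of_nat N powr (- excess 0 s - of_nat k)) =
         (\<Sum>k<K. if k = 0 then 1 else 0 :: complex)"
        using that by (intro sum.cong) (auto simp: excess_def)
      also have "\<dots> = 1" using False by (subst sum.delta) auto
      finally show ?thesis .
    qed
    then show ?thesis by (intro bigO_near_cong[OF bigO_near_zero]) simp
  qed
qed simp

lemma tail_family_0: "tail_family 0 (\<lambda>N s. 1)"
  unfolding tail_family_def using expansion_0 by auto

text \<open>In depth one \<open>dcoef\<close> would divide by \<open>s 1 - 1 + of_nat k\<close> for
  every \<open>k\<close>, although only \<open>s 1 = 1\<close> is excluded from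
  \<open>regular_pts 1\<close>; the Bernoulli coefficients avoid this. From depth two on,
  \<open>regular_pts\<close> excludes the zeros of all these denominators.\<close>

lemma tail_step_coeffs:
  assumes "tail_family j t"
  shows "\<exists>c d. expansion j t c \<and> (\<forall>k. hol (regular_pts (Suc j)) (d k)) \<and>
    (\<forall>s\<in>regular_pts (Suc j). \<forall>k. (\<Sum>l\<le>k. d l s * rising_binomial (excess (Suc j) s + of_nat l) (k + 1 - l)) = c k (shift s))"
proof (cases "j = 0")
  case True
  define d where "d = (\<lambda>k s. beta k * pochhammer (excess (Suc j) s) k / excess (Suc j) s)"
  have nz: "excess (Suc j) s \<noteq> 0" if "s \<in> regular_pts (Suc j)" for s
    using that True by (simp add: excess_def)
  have "hol (regular_pts (Suc j)) (d k)" for k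
    unfolding d_def pochhammer_prod using nz
    by (intro hol_divide hol_mult hol_prod hol_add hol_const hol_excess)
  moreover have "(\<Sum>l\<le>k. d l s * rising_binomial (excess (Suc j) s + of_nat l) (k + 1 - l)) = (if k = 0 then 1 else 0)"
    if "s \<in> regular_pts (Suc j)" for s k
    using bernoulli_rec[of "excess (Suc j) s + 1" k] nz[OF that] by (simp add: d_def)
  ultimately show ?thesis using expansion_0 True assms unfolding tail_family_def by blast
next
  case False
  obtain c where c: "expansion j t c" using assms unfolding tail_family_def by blast
  define d where "d = (\<lambda>k s. dcoef (\<lambda>k. c k (shift s)) (excess (Suc j) s + 1) k)"
  have nz: "excess (Suc j) s + 1 - 1 + of_nat k \<noteq> 0" if "s \<in> regular_pts (Suc j)" for s k
  proof -
    have "(\<Sum>k=1..Suc j. s k) \<noteq> of_nat (Suc j) - of_nat k" using that False by auto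
    then show ?thesis by (simp add: excess_def algebra_simps)
  qed
  have hc: "hol (regular_pts (Suc j)) (\<lambda>s. c k (shift s))" for k
    by (rule hol_subset[OF hol_shift[of "regular_pts j"]]) (use c in \<open>auto simp: expansion_def\<close>)
  have "hol (regular_pts (Suc j)) (d k)" for k
    unfolding d_def by (rule hol_dcoef[OF hc _ nz]) (intro hol_add hol_excess hol_const)
  moreover have "(\<Sum>l\<le>k. d l s * rising_binomial (excess (Suc j) s + of_nat l) (k + 1 - l)) = c k (shift s)"
    if "s \<in> regular_pts (Suc j)" for s k
    using dcoef_rec[OF nz[OF that], where c = "\<lambda>k. c k (shift s)"] by (simp add: d_def)
  ultimately show ?thesis using c by blast
qed

lemma hol_summand:
  assumes "N \<ge> 1" "hol (regular_pts j) (t N)" shows "hol (regular_pts (Suc j)) (summand t N)"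
proof -
  have "hol (regular_pts (Suc j)) (\<lambda>s. t N (shift s))"
    by (rule hol_subset[OF hol_shift[OF assms(2)]]) auto
  then show ?thesis unfolding summand_def
    using assms by (intro hol_mult hol_powr hol_minus hol_coord)
qed

lemma tail_step_exists:
  assumes t: "tail_family j t"
  shows "\<exists>t'. tail_family (Suc j) t' \<and> tail_step j t t'"
proof -
  obtain c d where c: "expansion j t c" and d: "\<And>k. hol (regular_pts (Suc j)) (d k)"
    and cd: "\<And>s k. s \<in> regular_pts (Suc j) \<Longrightarrow>
      (\<Sum>l\<le>k. d l s * rising_binomial (excess (Suc j) s + of_nat l) (k + 1 - l)) = c k (shift s)"
    using tail_step_coeffs[OF t] by blast
  have ht: "hol (regular_pts j) (t N)" for N using t by (simp add: tail_family_def)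
  \<comment> \<open>The summand is \<open>n powr (- s 1)\<close> times a tail of order
    \<open>- excess j (shift s)\<close>, so its leading exponent is
    \<open>- (excess (Suc j) s + 1)\<close>.\<close>
  define w where "w = (\<lambda>s. excess (Suc j) s + 1)"
  interpret reg_sum "regular_pts (Suc j)" w "summand t" "\<lambda>k s. c k (shift s)" d
  proof
    show "open (regular_pts (Suc j))" by (rule open_regular_pts)
    show "hol (regular_pts (Suc j)) w" unfolding w_def by (intro hol_add hol_excess hol_const)
    show "hol (regular_pts (Suc j)) (d k)" for k by (rule d)
    show "hol (regular_pts (Suc j)) (summand t N)" if "N \<ge> 1" for N by (rule hol_summand[OF that ht])
    show "(\<Sum>l\<le>k. d l s * rising_binomial (w s - 1 + of_nat l) (k + 1 - l)) = c k (shift s)"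
      if "s \<in> regular_pts (Suc j)" for s k using cd[OF that, of k] by (simp add: w_def)
    fix p K assume "p \<in> regular_pts (Suc j)"
    then have "shift p \<in> regular_pts j" by simp
    then have "bigO_near (shift p) (\<lambda>N s. t N s - (\<Sum>k<K. c k s * of_nat N powr (- excess j s - of_nat k)))
       (\<lambda>s. - Re (excess j s) - real K)"
      using c by (simp add: expansion_def)
    from bigO_near_mult[OF bigO_near_powr[of p "\<lambda>s. - s 1"] bigO_near_shift[OF this]]
    have L: "bigO_near p (\<lambda>N s. of_nat N powr (- s 1) * (t N (shift s) -
         (\<Sum>k<K. c k (shift s) * of_nat N powr (- excess j (shift s) - of_nat k))))
       (\<lambda>s. Re (- s 1) + (- Re (excess j (shift s)) - real K))" .
    have e: "Re (- s 1) + (- Re (excess j (shift s)) - real K) = - Re (w s) - real K" for s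
      by (simp add: w_def excess_Suc)
    have f: "of_nat N powr (- s 1) * (t N (shift s) -
         (\<Sum>k<K. c k (shift s) * of_nat N powr (- excess j (shift s) - of_nat k))) =
       summand t N s - (\<Sum>k<K. c k (shift s) * of_nat N powr (- w s - of_nat k))"
      if "N \<ge> 1" for N s
    proof -
      have "of_nat N powr (- s 1) * (c k (shift s) * of_nat N powr (- excess j (shift s) - of_nat k)) =
         c k (shift s) * of_nat N powr (- w s - of_nat k)" for k
      proof -
        have "- w s - of_nat k = - s 1 + (- excess j (shift s) - of_nat k)" by (simp add: w_def excess_Suc)
        then have "(of_nat N :: complex) powr (- w s - of_nat k) = of_nat N powr (- s 1) * of_nat N powr (- excess j (shift s) - of_nat k)"
          by (simp only: powr_add)
        then show ?thesis by simp
      qed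
      then show ?thesis unfolding summand_def right_diff_distrib sum_distrib_left by (simp only:)
    qed
    show "bigO_near p (\<lambda>N s. summand t N s - (\<Sum>k<K. c k (shift s) * of_nat N powr (- w s - of_nat k)))
       (\<lambda>s. - Re (w s) - real K)"
      by (rule bigO_near_cong[OF L[unfolded e]]) (use f in simp)
  qed
  \<comment> \<open>Subtracting the partial sum from the continued total yields the continued tail.
    By \<open>regularized_expansion\<close> its coefficients are the \<open>d k\<close>, with
    leading exponent \<open>1 - w = - excess (Suc j)\<close>.\<close>
  define t' where "t' = (\<lambda>N s. regularized s - (\<Sum>n=1..N. summand t n s))"
  have "tail_family (Suc j) t'"
    unfolding tail_family_def
  proof (intro conjI allI)
    show "hol (regular_pts (Suc j)) (t' N)" for N
      unfolding t'_def by (intro hol_diff hol_regularized hol_sum hol_summand ht) auto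
    show "\<exists>c. expansion (Suc j) t' c"
      unfolding expansion_def
    proof (intro exI[of _ d] conjI allI ballI d)
      fix p K assume "p \<in> regular_pts (Suc j)"
      from regularized_expansion[OF this, of K]
      show "bigO_near p (\<lambda>N s. t' N s - (\<Sum>k<K. d k s * of_nat N powr (- excess (Suc j) s - of_nat k)))
         (\<lambda>s. - Re (excess (Suc j) s) - real K)"
        by (simp add: w_def t'_def)
    qed
  qed simp
  moreover have "tail_step j t t'"
    unfolding tail_step_def
  proof (intro conjI allI ballI impI)
    show "t' N s = t' 0 s - (\<Sum>n=1..N. summand t n s)" for N s by (simp add: t'_def)
    show "(\<lambda>N. \<Sum>n=1..N. summand t n s) \<longlonglongrightarrow> t' 0 s" if "s \<in> regular_pts (Suc j)" "Re (excess (Suc j) s) > 0" for s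
      using sum_tendsto_regularized[OF that(1)] that(2) by (simp add: w_def t'_def)
  qed
  ultimately show ?thesis by blast
qed

text \<open>\<open>EZ_tail j N s\<close> continues the tail \<open>N < n\<^sub>1 < \<dots> < n\<^sub>j\<close> of the \<open>j\<close>-fold sum.\<close>

definition EZ_tail :: "nat \<Rightarrow> nat \<Rightarrow> pt \<Rightarrow> complex" where
  "EZ_tail = (SOME f. \<forall>j. tail_family j (f j) \<and> tail_step j (f j) (f (Suc j)))"

lemma EZ_tail_props: "tail_family j (EZ_tail j) \<and> tail_step j (EZ_tail j) (EZ_tail (Suc j))"
proof -
  have "\<exists>f. \<forall>j. tail_family j (f j) \<and> tail_step j (f j) (f (Suc j))"
    by (rule dependent_nat_choice) (use tail_family_0 tail_step_exists in blast)+
  from someI_ex[OF this] show ?thesis unfolding EZ_tail_def by blast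
qed

lemma EZ_tail_0 [simp]: "EZ_tail 0 N s = 1"
  using EZ_tail_props[of 0] by (simp add: tail_family_def)

lemma hol_EZ_tail: "hol (regular_pts j) (EZ_tail j N)"
  using EZ_tail_props[of j] by (simp add: tail_family_def)

lemma EZ_tail_Suc: "EZ_tail (Suc j) N s = EZ_tail (Suc j) 0 s - (\<Sum>n=1..N. summand (EZ_tail j) n s)"
  using EZ_tail_props[of j] unfolding tail_step_def by blast

lemma EZ_tail_tendsto:
  "s \<in> regular_pts (Suc j) \<Longrightarrow> Re (excess (Suc j) s) > 0 \<Longrightarrow> (\<lambda>N. \<Sum>n=1..N. summand (EZ_tail j) n s) \<longlonglongrightarrow> EZ_tail (Suc j) 0 s"
  using EZ_tail_props[of j] unfolding tail_step_def by blast

lemma EZ_tail_bound: "p \<in> regular_pts j \<Longrightarrow> bigO_near p (EZ_tail j) (\<lambda>s. - Re (excess j s))"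
proof -
  assume p: "p \<in> regular_pts j"
  obtain c where "expansion j (EZ_tail j) c" using EZ_tail_props[of j] unfolding tail_family_def by blast
  then have "bigO_near p (\<lambda>N s. EZ_tail j N s - (\<Sum>k<0. c k s * of_nat N powr (- excess j s - of_nat k))) (\<lambda>s. - Re (excess j s) - real 0)"
    using p unfolding expansion_def by blast
  then show ?thesis by simp
qed

subsection \<open>The region of absolute convergence\<close>

definition chains :: "nat \<Rightarrow> nat \<Rightarrow> (nat \<Rightarrow> nat) set" where
  "chains j N = {n \<in> {1..j} \<rightarrow>\<^sub>E {Suc N..}. strict_mono_on {1..j} n}"

definition EZ_term :: "nat \<Rightarrow> pt \<Rightarrow> (nat \<Rightarrow> nat) \<Rightarrow> complex" where
  "EZ_term j s n = 1 / (\<Prod>i=1..j. of_nat (n i) powr s i)"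

definition chain_cons :: "nat \<Rightarrow> nat \<Rightarrow> (nat \<Rightarrow> nat) \<Rightarrow> nat \<Rightarrow> nat" where
  "chain_cons j m n = (\<lambda>i\<in>{1..Suc j}. if i = 1 then m else n (i - 1))"

lemma EZ_term_chain_cons: "EZ_term (Suc j) s (chain_cons j m n) = of_nat m powr (- s 1) * EZ_term j (shift s) n"
proof -
  have "(\<Prod>i=1..Suc j. of_nat (chain_cons j m n i) powr s i) =
     of_nat (chain_cons j m n 1) powr s 1 * (\<Prod>i=Suc 1..Suc j. of_nat (chain_cons j m n i) powr s i)"
    by (rule prod.atLeast_Suc_atMost) simp
  also have "(\<Prod>i=Suc 1..Suc j. of_nat (chain_cons j m n i) powr s i) =
     (\<Prod>i=1..j. of_nat (chain_cons j m n (Suc i)) powr s (Suc i))"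
    by (rule prod.shift_bounds_cl_Suc_ivl)
  also have "\<dots> = (\<Prod>i=1..j. of_nat (n i) powr shift s i)"
    by (intro prod.cong) (auto simp: chain_cons_def shift_def)
  finally show ?thesis by (simp add: EZ_term_def chain_cons_def powr_minus divide_inverse)
qed

lemma bij_betw_chain_cons:
  "bij_betw (\<lambda>(m, n). chain_cons j m n) (SIGMA m:{Suc N..}. chains j m) (chains (Suc j) N)"
proof (rule bij_betwI[where g = "\<lambda>n. (n 1, \<lambda>i\<in>{1..j}. n (Suc i))"])
  show "(\<lambda>(m, n). chain_cons j m n) \<in> (SIGMA m:{Suc N..}. chains j m) \<rightarrow> chains (Suc j) N"
  proof (clarsimp simp: chains_def, intro conjI)
    fix m n assume m: "Suc N \<le> m" and n: "n \<in> {Suc 0..j} \<rightarrow>\<^sub>E {Suc m..}" "strict_mono_on {Suc 0..j} n"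
    have nm: "n i > m" if "1 \<le> i" "i \<le> j" for i
      using PiE_mem[OF n(1), of i] that by simp
    show "chain_cons j m n \<in> {Suc 0..Suc j} \<rightarrow>\<^sub>E {Suc N..}"
    proof (rule PiE_I)
      fix i assume i: "i \<in> {Suc 0..Suc j}"
      show "chain_cons j m n i \<in> {Suc N..}"
      proof (cases "i = 1")
        case False
        then have "1 \<le> i - 1 \<and> i - 1 \<le> j" using i unfolding atLeastAtMost_iff by arith
        then have "Suc m \<le> n (i - 1)" using nm by (simp add: Suc_le_eq)
        then show ?thesis using i m False by (simp add: chain_cons_def)
      qed (use m in \<open>simp add: chain_cons_def\<close>)
    qed (auto simp: chain_cons_def)
    show "strict_mono_on {Suc 0..Suc j} (chain_cons j m n)"
    proof (rule strict_mono_onI)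
      fix i k assume ik: "i \<in> {Suc 0..Suc j}" "k \<in> {Suc 0..Suc j}" "i < k"
      show "chain_cons j m n i < chain_cons j m n k"
      proof (cases "i = 1")
        case True
        then show ?thesis using nm[of "k - 1"] ik by (auto simp: chain_cons_def)
      next
        case False
        then have "n (i - 1) < n (k - 1)" using ik by (intro strict_mono_onD[OF n(2)]) auto
        then show ?thesis using ik False by (auto simp: chain_cons_def)
      qed
    qed
  qed
  show "(\<lambda>n. (n 1, \<lambda>i\<in>{1..j}. n (Suc i))) \<in> chains (Suc j) N \<rightarrow> (SIGMA m:{Suc N..}. chains j m)"
  proof (intro funcsetI SigmaI)
    fix n assume "n \<in> chains (Suc j) N"
    then have n: "n \<in> {1..Suc j} \<rightarrow>\<^sub>E {Suc N..}" "strict_mono_on {1..Suc j} n"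
      by (auto simp: chains_def)
    show "n 1 \<in> {Suc N..}" using PiE_mem[OF n(1), of 1] by simp
    have "(\<lambda>i\<in>{1..j}. n (Suc i)) \<in> {1..j} \<rightarrow>\<^sub>E {Suc (n 1)..}"
    proof (rule restrict_PiE_iff[THEN iffD2], rule ballI)
      fix i assume "i \<in> {1..j}"
      then have "n 1 < n (Suc i)" by (intro strict_mono_onD[OF n(2)]) auto
      then show "n (Suc i) \<in> {Suc (n 1)..}" by simp
    qed
    moreover have "strict_mono_on {1..j} (\<lambda>i\<in>{1..j}. n (Suc i))"
      by (rule strict_mono_onI) (auto intro!: strict_mono_onD[OF n(2)])
    ultimately show "(\<lambda>i\<in>{1..j}. n (Suc i)) \<in> chains j (n 1)" by (simp add: chains_def)
  qed
  show "(\<lambda>n. (n 1, \<lambda>i\<in>{1..j}. n (Suc i))) ((\<lambda>(m, n). chain_cons j m n) x) = x"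
    if "x \<in> (SIGMA m:{Suc N..}. chains j m)" for x
    using that by (auto simp: chain_cons_def chains_def PiE_iff extensional_def fun_eq_iff)
  show "(\<lambda>(m, n). chain_cons j m n) (n 1, \<lambda>i\<in>{1..j}. n (Suc i)) = n" if "n \<in> chains (Suc j) N" for n
    using that by (auto simp: chain_cons_def chains_def PiE_iff extensional_def fun_eq_iff)
qed

lemma excess_pos:
  assumes "\<And>k. k \<in> {1..j} \<Longrightarrow> Re (s k) > 1" "j \<ge> 1" shows "Re (excess j s) > 0"
proof -
  have "real j = (\<Sum>k=1..j. 1)" by simp
  also have "\<dots> < (\<Sum>k=1..j. Re (s k))" using assms by (intro sum_strict_mono) auto
  finally show ?thesis by (simp add: excess_def)
qed

lemma mem_regular_pts_if_Re_gt_1: "(\<And>k. k \<in> {1..j} \<Longrightarrow> Re (s k) > 1) \<Longrightarrow> s \<in> regular_pts j"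
proof (induction j arbitrary: s)
  case (Suc j)
  have "shift s \<in> regular_pts j" by (rule Suc.IH) (use Suc.prems in \<open>auto simp: shift_def\<close>)
  moreover have "(\<Sum>k=1..Suc j. s k) \<noteq> of_nat (Suc j) - of_nat n" for n
  proof
    assume "(\<Sum>k=1..Suc j. s k) = of_nat (Suc j) - of_nat n"
    then have "excess (Suc j) s = - of_nat n" unfolding excess_def by simp
    then show False using excess_pos[of "Suc j" s] Suc.prems by simp
  qed
  ultimately show ?case by simp
qed simp

text \<open>Fubini over the smallest index \<open>m\<close>, the inner sums being tails of depth
  \<open>j\<close> at \<open>shift s\<close>. Since \<open>chains j m\<close> lies inside
  \<open>chains j 0\<close>, one constant \<open>B\<close> bounds all inner absolute sums, and
  \<open>B * m powr (- Re (s 1))\<close> is summable. For the same reason absolute summability need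
  be carried through the induction only for \<open>N = 0\<close>.\<close>

lemma EZ_tail_has_sum:
  assumes "\<And>k. k \<in> {1..j} \<Longrightarrow> Re (s k) > 1"
  shows "(\<lambda>n. norm (EZ_term j s n)) summable_on chains j 0 \<and> (EZ_term j s has_sum EZ_tail j N s) (chains j N)"
  using assms
proof (induction j arbitrary: s N)
  case 0
  have "chains 0 M = {\<lambda>x. undefined}" for M
    by (auto simp: chains_def strict_mono_on_def)
  moreover have "(EZ_term 0 s has_sum sum (EZ_term 0 s) {\<lambda>x. undefined}) {\<lambda>x. undefined}"
    by (rule has_sum_finite) simp
  moreover have "EZ_term 0 s = (\<lambda>n. 1)" by (simp add: EZ_term_def fun_eq_iff)
  ultimately show ?case by simp
next
  case (Suc j)
  let ?s = "shift s"
  have re: "\<And>k. k \<in> {1..j} \<Longrightarrow> Re (?s k) > 1" using Suc.prems by (auto simp: shift_def)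
  have s1: "Re (s 1) > 1" using Suc.prems by auto
  have abs: "(\<lambda>n. norm (EZ_term j ?s n)) summable_on chains j 0"
    and hs: "\<And>m. (EZ_term j ?s has_sum EZ_tail j m ?s) (chains j m)"
    using Suc.IH[OF re] by auto
  have sub: "chains j m \<subseteq> chains j 0" for m by (auto simp: chains_def PiE_iff)
  have absm: "(\<lambda>n. norm (EZ_term j ?s n)) summable_on chains j m" for m
    by (rule summable_on_subset_banach[OF abs sub])
  define B where "B = (\<Sum>\<^sub>\<infinity>n\<in>chains j 0. norm (EZ_term j ?s n))"
  have leB: "(\<Sum>\<^sub>\<infinity>n\<in>chains j m. norm (EZ_term j ?s n)) \<le> B" for m
    unfolding B_def by (rule infsum_mono_neutral[OF absm abs]) (use sub in auto)
  have TB: "norm (EZ_tail j m ?s) \<le> B" for m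
    using norm_infsum_bound[OF absm, of m] leB[of m] infsumI[OF hs[of m]] by simp
  have B0: "B \<ge> 0" using TB[of 0] norm_ge_zero order_trans by blast
  have summ: "summable (\<lambda>n. B * real n powr (- Re (s 1)))"
    using s1 by (intro summable_mult) (simp add: summable_real_powr_iff)
  define f where "f = (\<lambda>(m, n). EZ_term (Suc j) s (chain_cons j m n))"
  have f: "f (m, n) = of_nat m powr (- s 1) * EZ_term j ?s n" for m n
    by (simp add: f_def EZ_term_chain_cons)
  have nf: "norm (of_nat m powr (- s 1) :: complex) = real m powr (- Re (s 1))" for m
    by (cases "m = 0") (simp_all add: norm_of_nat_powr)
  have absf: "(\<lambda>x. norm (f x)) summable_on (SIGMA m:{Suc M..}. chains j m)" for M
  proof (rule Infinite_Sum.abs_summable_on_Sigma_iff[THEN iffD2], intro conjI ballI)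
    show "(\<lambda>y. norm (f (m, y))) summable_on chains j m" for m
      unfolding f norm_mult by (intro summable_on_cmult_right absm)
    have eq: "(\<Sum>\<^sub>\<infinity>y\<in>chains j m. norm (f (m, y))) = real m powr (- Re (s 1)) * (\<Sum>\<^sub>\<infinity>n\<in>chains j m. norm (EZ_term j ?s n))" for m
      unfolding f norm_mult nf by (rule infsum_cmult_right) (use absm in auto)
    have "(\<lambda>m. B * real m powr (- Re (s 1))) summable_on UNIV"
      using summ B0 by (intro norm_summable_imp_summable_on) (simp add: abs_mult)
    then have "(\<lambda>m. B * real m powr (- Re (s 1))) summable_on {Suc M..}"
      by (rule summable_on_subset_banach) simp
    then show "(\<lambda>x. norm (\<Sum>\<^sub>\<infinity>y\<in>chains j x. norm (f (x, y)))) summable_on {Suc M..}"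
    proof (rule summable_on_comparison_test)
      fix m
      have "(\<Sum>\<^sub>\<infinity>n\<in>chains j m. norm (EZ_term j ?s n)) \<ge> 0" by (rule infsum_nonneg) simp
      then show "norm (\<Sum>\<^sub>\<infinity>y\<in>chains j m. norm (f (m, y))) \<le> B * real m powr (- Re (s 1))"
        unfolding eq using leB[of m] by (simp add: abs_mult mult.commute[of B] mult_left_mono)
    qed simp
  qed
  have outer: "((\<lambda>m. of_nat m powr (- s 1) * EZ_tail j m ?s) has_sum EZ_tail (Suc j) N s) {Suc N..}"
  proof -
    define x where "x = (\<lambda>k. summand (EZ_tail j) (Suc (k + N)) s)"
    have "s \<in> regular_pts (Suc j)" "Re (excess (Suc j) s) > 0"
      using mem_regular_pts_if_Re_gt_1[of "Suc j" s] excess_pos[of "Suc j" s] Suc.prems by auto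
    from EZ_tail_tendsto[OF this] have "(\<lambda>n. summand (EZ_tail j) (Suc n) s) sums EZ_tail (Suc j) 0 s"
      by (simp add: sums_def sum.atLeast1_atMost_eq)
    then have "(\<lambda>n. summand (EZ_tail j) (Suc (n + N)) s) sums (EZ_tail (Suc j) 0 s - (\<Sum>n<N. summand (EZ_tail j) (Suc n) s))"
      by (simp add: sums_iff_shift[of "\<lambda>n. summand (EZ_tail j) (Suc n) s" N])
    then have S: "x sums EZ_tail (Suc j) N s"
      unfolding x_def EZ_tail_Suc[of j N] by (simp add: sum.atLeast1_atMost_eq)
    have "summable (\<lambda>n. norm (x n))"
    proof (rule summable_comparison_test')
      show "summable (\<lambda>k. B * real (k + Suc N) powr (- Re (s 1)))"
        using summable_ignore_initial_segment[OF summ, of "Suc N"] by simp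
      show "norm (norm (x k)) \<le> B * real (k + Suc N) powr (- Re (s 1))" for k
        using TB[of "Suc (k + N)"] nf[of "Suc (k + N)"]
        by (simp add: x_def summand_def norm_mult mult.commute[of B] mult_left_mono)
    qed
    then have "(x has_sum EZ_tail (Suc j) N s) UNIV" using S by (rule norm_summable_imp_has_sum)
    then show ?thesis
      by (subst (asm) has_sum_reindex_bij_witness[of UNIV "\<lambda>m. m - Suc N" "\<lambda>k. Suc (k + N)" "{Suc N..}"
          "\<lambda>m. of_nat m powr (- s 1) * EZ_tail j m ?s"]) (auto simp: x_def summand_def)
  qed
  have inner: "((\<lambda>y. f (m, y)) has_sum of_nat m powr (- s 1) * EZ_tail j m ?s) (chains j m)" for m
    unfolding f by (intro has_sum_cmult_right hs)
  have "(f has_sum EZ_tail (Suc j) N s) (SIGMA m:{Suc N..}. chains j m)"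
    using inner outer abs_summable_summable[OF absf] by (rule has_sum_SigmaI)
  then have "(EZ_term (Suc j) s has_sum EZ_tail (Suc j) N s) (chains (Suc j) N)"
    by (subst has_sum_reindex_bij_betw[OF bij_betw_chain_cons, symmetric]) (simp add: f_def case_prod_unfold)
  moreover have "(\<lambda>n. norm (EZ_term (Suc j) s n)) summable_on chains (Suc j) 0"
    using absf[of 0]
    by (subst summable_on_reindex_bij_betw[OF bij_betw_chain_cons, symmetric]) (simp add: f_def case_prod_unfold)
  ultimately show ?case by blast
qed

lemma EZ_tail_eq_EZ_sum:
  assumes "\<And>k. k \<in> {1..j} \<Longrightarrow> Re (s k) > 1" shows "EZ_tail j 0 s = EZ_sum j s"
proof -
  have "(EZ_term j s has_sum EZ_tail j 0 s) (chains j 0)"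
    using EZ_tail_has_sum[of j s 0] assms by blast
  from infsumI[OF this] show ?thesis
    unfolding EZ_sum_def EZ_term_def[abs_def] chains_def by simp
qed

text \<open>At such a point the tail is a sum of positive terms over a nonempty set. The case
  \<open>N = 1\<close> supplies the point where the limiting function does not vanish.\<close>

lemma EZ_tail_nonzero:
  assumes s: "\<And>k. k \<in> {1..j} \<Longrightarrow> s k \<in> \<real> \<and> Re (s k) > 1"
  shows "EZ_tail j N s \<noteq> 0"
proof
  assume T0: "EZ_tail j N s = 0"
  have "\<exists>y>0. EZ_term j s n = of_real y" if "n \<in> chains j N" for n
  proof -
    have "EZ_term j s n = of_real (1 / (\<Prod>i=1..j. real (n i) powr Re (s i)))"
    proof -
      have "of_nat (n i) powr s i = of_real (real (n i) powr Re (s i))" if "i \<in> {1..j}" for i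
      proof -
        have "s i = of_real (Re (s i))" using s[OF that] by simp
        then show ?thesis using powr_of_real[of "real (n i)" "Re (s i)"] by simp
      qed
      then show ?thesis by (simp add: EZ_term_def)
    qed
    moreover have "n i \<ge> 1" if "i \<in> {1..j}" for i
      using \<open>n \<in> chains j N\<close> that by (auto simp: chains_def PiE_iff dest!: bspec)
    then have "1 / (\<Prod>i=1..j. real (n i) powr Re (s i)) > 0" by (force intro!: divide_pos_pos prod_pos)
    ultimately show ?thesis by blast
  qed
  then have pos: "Re (EZ_term j s n) > 0" if "n \<in> chains j N" for n using that by fastforce
  \<comment> \<open>The chain \<open>N + 1, ..., N + j\<close> shows that the index set is
    nonempty.\<close>
  define n where "n = (\<lambda>i\<in>{1..j}. N + i)"
  have n: "n \<in> chains j N" by (auto simp: n_def chains_def strict_mono_on_def)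
  have "(EZ_term j s has_sum 0) (chains j N)" using EZ_tail_has_sum[of j s N] s T0 by auto
  then have "((\<lambda>n. Re (EZ_term j s n)) has_sum 0) (chains j N)"
    using has_sum_Re by fastforce
  then have "(\<Sum>n\<in>{n}. Re (EZ_term j s n)) \<le> 0"
    by (rule finite_sum_le_has_sum) (use n pos in \<open>auto intro: less_imp_le\<close>)
  then show False using pos[OF n] by simp
qed

subsection \<open>Uniqueness of the continuation\<close>

lemma sum_shift_tail:
  "i \<le> j \<Longrightarrow> (\<Sum>k=j-i+1..j. shift s k) = (\<Sum>k=Suc j-i+1..Suc j. s k)"
proof -
  assume "i \<le> j"
  then have "(\<Sum>k=Suc j-i+1..Suc j. s k) = (\<Sum>k=Suc (j-i+1)..Suc j. s k)"
    by (simp add: Suc_diff_le)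
  also have "\<dots> = (\<Sum>k=j-i+1..j. s (Suc k))" by (rule sum.shift_bounds_cl_Suc_ivl)
  also have "\<dots> = (\<Sum>k=j-i+1..j. shift s k)" by (intro sum.cong) (auto simp: shift_def)
  finally show ?thesis by simp
qed

lemma mem_regular_pts_iff:
  "s \<in> regular_pts j \<longleftrightarrow> (\<forall>i\<in>{1..j}. \<forall>n. (i = 1 \<longrightarrow> n = 0) \<longrightarrow> (\<Sum>k=j-i+1..j. s k) \<noteq> of_nat i - of_nat n)"
proof (induction j arbitrary: s)
  case (Suc j)
  define Q where "Q = (\<lambda>i. \<forall>n. (i = 1 \<longrightarrow> n = 0) \<longrightarrow> (\<Sum>k=Suc j-i+1..Suc j. s k) \<noteq> of_nat i - of_nat n)"
  have "Q (Suc j) \<longleftrightarrow> (\<forall>n. (j = 0 \<longrightarrow> n = 0) \<longrightarrow> (\<Sum>k=1..Suc j. s k) \<noteq> of_nat (Suc j) - of_nat n)"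
    unfolding Q_def by simp
  moreover have "shift s \<in> regular_pts j \<longleftrightarrow> (\<forall>i\<in>{1..j}. Q i)"
    unfolding Suc.IH Q_def by (intro ball_cong refl) (simp only: sum_shift_tail atLeastAtMost_iff)
  ultimately have "s \<in> regular_pts (Suc j) \<longleftrightarrow> (\<forall>i\<in>insert (Suc j) {1..j}. Q i)"
    by (simp only: regular_pts.simps Int_iff mem_Collect_eq ball_simps conj_commute)
  also have "insert (Suc j) {1..j} = {1..Suc j}" by auto
  finally show ?case unfolding Q_def .
qed simp

lemma mem_regular_pts_iff_not_EZ_sing:
  assumes "j \<ge> 1" "s \<in> cspace {1..j}" shows "s \<in> regular_pts j \<longleftrightarrow> s \<notin> EZ_sing j"
proof -
  have "{1..j} = insert 1 {2..j}" using assms(1) by auto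
  then have "s \<in> regular_pts j \<longleftrightarrow> s j \<noteq> 1 \<and> (\<forall>i\<in>{2..j}. \<forall>n. (\<Sum>k=j-i+1..j. s k) \<noteq> of_nat i - of_nat n)"
    using assms(1) by (auto simp: mem_regular_pts_iff)
  then show ?thesis using assms by (auto simp: EZ_sing_def hyp_def hyp1_def)
qed

lemma cspace_minus_EZ_sing: "j \<ge> 1 \<Longrightarrow> cspace {1..j} - EZ_sing j = regular_pts j \<inter> cspace {1..j}"
  using mem_regular_pts_iff_not_EZ_sing by blast

lemma sum_line: "(\<Sum>k\<in>A. line a b w k) = (\<Sum>k\<in>A. a k) + w * (\<Sum>k\<in>A. b k)"
  by (simp add: line_def sum.distrib sum_distrib_left)

text \<open>A hyperplane meets the line in at most one point unless it contains the line, which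
  \<open>w0\<close> rules out; and there are countably many hyperplanes.\<close>

lemma countable_line_minus_regular_pts:
  assumes "line a b w0 \<in> regular_pts j" shows "countable {w. line a b w \<notin> regular_pts j}"
proof -
  define Z where "Z = (\<lambda>i n. {w. (\<Sum>k=j-i+1..j. line a b w k) = of_nat i - of_nat n})"
  define I where "I = {(i, n :: nat). i \<in> {1..j} \<and> (i = 1 \<longrightarrow> n = 0)}"
  have "{w. line a b w \<notin> regular_pts j} \<subseteq> (\<Union>(i, n)\<in>I. Z i n)"
  proof
    fix w assume "w \<in> {w. line a b w \<notin> regular_pts j}"
    then obtain i n where "i \<in> {1..j}" "i = 1 \<longrightarrow> n = 0" "(\<Sum>k=j-i+1..j. line a b w k) = of_nat i - of_nat n"
      unfolding mem_regular_pts_iff by blast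
    then have "(i, n) \<in> I" "w \<in> Z i n" by (simp_all add: Z_def I_def)
    then show "w \<in> (\<Union>(i, n)\<in>I. Z i n)" by blast
  qed
  moreover have "countable (\<Union>(i, n)\<in>I. Z i n)"
  proof (rule countable_UN)
    show "countable I" by (rule countableI_type)
    fix x assume x: "x \<in> I"
    obtain i n where [simp]: "x = (i, n)" by force
    have nz: "w0 \<notin> Z i n" using assms x unfolding mem_regular_pts_iff Z_def I_def by auto
    have "w1 = w2" if "w1 \<in> Z i n" "w2 \<in> Z i n" for w1 w2
    proof (rule ccontr)
      assume ne: "w1 \<noteq> w2"
      let ?A = "\<Sum>k=j-i+1..j. a k" and ?B = "\<Sum>k=j-i+1..j. b k"
      have e: "?A + w1 * ?B = of_nat i - of_nat n" "?A + w2 * ?B = of_nat i - of_nat n"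
        using that by (auto simp: Z_def sum_line)
      then have "?A + w1 * ?B = ?A + w2 * ?B" by simp
      then have "?B = 0" using ne by simp
      then show False using e nz by (simp add: Z_def sum_line)
    qed
    then have "Z i n \<subseteq> {SOME w. w \<in> Z i n}" by (metis singletonI someI subsetI)
    then show "countable (case x of (i, n) \<Rightarrow> Z i n)"
      using countable_subset by fastforce
  qed
  ultimately show ?thesis by (rule countable_subset)
qed

lemma connected_line_regular_pts:
  assumes "line a b w0 \<in> regular_pts j" shows "connected {w. line a b w \<in> regular_pts j}"
proof -
  have "connected (UNIV - {w. line a b w \<notin> regular_pts j})"
    using countable_line_minus_regular_pts[OF assms] by (intro connected_open_diff_countable) auto
  moreover have "UNIV - {w. line a b w \<notin> regular_pts j} = {w. line a b w \<in> regular_pts j}" by auto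
  ultimately show ?thesis by simp
qed

text \<open>Countability alone would allow singular parameters to accumulate at \<open>w1\<close>.
  For fixed \<open>i\<close>, however, an affine function of the parameter must avoid a set of
  integers. Near \<open>w1\<close> its values differ from \<open>\<phi> w1\<close> by less than 1,
  so an excluded value could only be \<open>\<phi> w1\<close> itself; the function is then
  nonconstant because of \<open>w0\<close>, and takes that value nowhere else. Finitely many
  \<open>i\<close> remain.\<close>

lemma eventually_line_regular_pts:
  assumes "line a b w0 \<in> regular_pts j" shows "\<forall>\<^sub>F w in at w1. line a b w \<in> regular_pts j"
proof -
  have "\<forall>\<^sub>F w in at w1. \<forall>i\<in>{1..j}. \<forall>n. (i = 1 \<longrightarrow> n = 0) \<longrightarrow> (\<Sum>k=j-i+1..j. line a b w k) \<noteq> of_nat i - of_nat n"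
  proof (rule eventually_ball_finite, simp, rule ballI)
    fix i assume i: "i \<in> {1..j}"
    let ?A = "\<Sum>k=j-i+1..j. a k" and ?B = "\<Sum>k=j-i+1..j. b k"
    define \<phi> where "\<phi> = (\<lambda>w. ?A + w * ?B)"
    define Z where "Z = {of_nat i - of_nat n :: complex | n. i = 1 \<longrightarrow> n = 0}"
    have w0: "\<phi> w0 \<notin> Z" using assms i unfolding mem_regular_pts_iff \<phi>_def Z_def sum_line[symmetric] by auto
    have lim: "(\<phi> \<longlongrightarrow> \<phi> w1) (at w1)" unfolding \<phi>_def by (intro tendsto_intros)
    have "\<forall>\<^sub>F w in at w1. \<phi> w \<notin> Z"
    proof (cases "\<phi> w1 \<in> Z")
      case False
      have "open (- Z)" unfolding Z_def by (rule open_Compl[OF closed_nat_diff])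
      from topological_tendstoD[OF lim this] False show ?thesis by simp
    next
      case True
      have "\<phi> w1 \<noteq> \<phi> w0" using True w0 by metis
      then have B: "?B \<noteq> 0" unfolding \<phi>_def by auto
      have "\<forall>\<^sub>F w in at w1. dist (\<phi> w) (\<phi> w1) < 1" using lim by (rule tendstoD) simp
      moreover have "\<forall>\<^sub>F w in at w1. w \<noteq> w1" by (simp add: eventually_at_filter)
      ultimately show ?thesis
      proof eventually_elim
        case (elim w)
        show ?case
        proof
          assume "\<phi> w \<in> Z"
          then obtain n m where "\<phi> w = of_nat i - of_nat n" "\<phi> w1 = of_nat i - of_nat m"
            using True unfolding Z_def by blast
          then have d: "\<phi> w - \<phi> w1 = of_int (int m - int n)" by simp
          have "norm (\<phi> w - \<phi> w1) < 1" using elim(1) by (simp add: dist_norm)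
          then have "\<bar>int m - int n\<bar> < 1" unfolding d norm_of_int by linarith
          then have "\<phi> w = \<phi> w1" using d by simp
          then show False using B elim(2) by (simp add: \<phi>_def)
        qed
      qed
    qed
    then show "\<forall>\<^sub>F w in at w1. \<forall>n. (i = 1 \<longrightarrow> n = 0) \<longrightarrow> (\<Sum>k=j-i+1..j. line a b w k) \<noteq> of_nat i - of_nat n"
      by (rule eventually_mono) (auto simp: sum_line \<phi>_def Z_def)
  qed
  then show ?thesis unfolding mem_regular_pts_iff .
qed

lemma EZ_tail_is_EZ_continuation: "r \<ge> 1 \<Longrightarrow> is_EZ_continuation r (EZ_tail r 0)"
  unfolding is_EZ_continuation_def cspace_minus_EZ_sing
  using hol_imp_holo_on[OF open_regular_pts hol_EZ_tail] EZ_tail_eq_EZ_sum by blast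

lemma line_upd: "line (s(i := 0)) ((\<lambda>j. 0)(i := 1)) z = s(i := z)"
  by (auto simp: line_def)

text \<open>\<open>holo_on\<close> provides differentiability only in each coordinate separately, so
  coordinates leave the half-plane \<open>Re > 1\<close> one at a time. After \<open>k\<close> steps
  the first \<open>k\<close> are free. The identity theorem applies in the next one because its
  plane, minus countably many singular values, is open and connected and still meets the
  half-plane.\<close>

lemma EZ_continuation_unique:
  assumes r: "r \<ge> 1" and f: "is_EZ_continuation r f"
    and s: "s \<in> cspace {1..r}" "s \<in> regular_pts r"
  shows "f s = EZ_tail r 0 s"
proof -
  have "f s = EZ_tail r 0 s" if "k \<le> r" "s \<in> cspace {1..r}" "s \<in> regular_pts r" "\<forall>i\<in>{k<..r}. Re (s i) > 1" for k s
    using that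
  proof (induction k arbitrary: s)
    case 0
    then have "\<And>k. k \<in> {1..r} \<Longrightarrow> Re (s k) > 1" by auto
    then show ?case using f 0 EZ_tail_eq_EZ_sum[of r s] by (simp add: is_EZ_continuation_def)
  next
    case (Suc k)
    let ?u = "\<lambda>z. s(Suc k := z)"
    define S where "S = {z. ?u z \<in> regular_pts r}"
    have line: "line (s(Suc k := 0)) ((\<lambda>j. 0)(Suc k := 1)) z = ?u z" for z by (rule line_upd)
    have u: "?u z \<in> cspace {1..r}" for z using Suc.prems by (auto simp: cspace_def)
    have sS: "s (Suc k) \<in> S" using Suc.prems by (simp add: S_def)
    have "line (s(Suc k := 0)) ((\<lambda>j. 0)(Suc k := 1)) (s (Suc k)) \<in> regular_pts r"
      using Suc.prems unfolding line by simp
    from connected_line_regular_pts[OF this] countable_line_minus_regular_pts[OF this]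
    have con: "connected S" and cnt: "countable (- S)"
      unfolding line S_def by (simp_all add: Collect_neg_eq)
    have opS: "open S"
      using open_line_vimage[OF open_regular_pts, of "s(Suc k := 0)" "(\<lambda>j. 0)(Suc k := 1)"] unfolding line S_def .
    have half: "open (S \<inter> {z. Re z > 1})" by (intro open_Int opS open_halfspace_Re_gt)
    have ne: "S \<inter> {z. Re z > 1} \<noteq> {}"
    proof
      assume "S \<inter> {z. Re z > 1} = {}"
      then have sub: "{z. Re z > 1} \<subseteq> - S" by blast
      have "ball 3 1 \<subseteq> {z. Re z > 1}"
      proof
        fix z :: complex assume "z \<in> ball 3 1"
        then have "\<bar>Re (3 - z)\<bar> < 1" using abs_Re_le_cmod[of "3 - z"] by (simp add: dist_norm)
        then show "z \<in> {z. Re z > 1}" by simp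
      qed
      from countable_subset[OF subset_trans[OF this sub] cnt] show False using uncountable_ball[of 1 "3::complex"] by simp
    qed
    have hf: "(\<lambda>z. f (?u z)) holomorphic_on S"
      unfolding holomorphic_on_def
    proof
      fix z assume z: "z \<in> S"
      then have "?u z \<in> cspace {1..r} - EZ_sing r"
        using u unfolding cspace_minus_EZ_sing[OF r] S_def by blast
      then have "(\<lambda>x. f ((?u z)(Suc k := x))) field_differentiable at (?u z (Suc k))"
      proof -
        have D: "\<forall>s\<in>cspace {1..r} - EZ_sing r. \<forall>i\<in>{1..r}. (\<lambda>z. f (s(i := z))) field_differentiable at (s i)"
          using f unfolding is_EZ_continuation_def holo_on_def by (elim conjE)
        have "Suc k \<in> {1..r}" using Suc.prems(1) by simp
        from bspec[OF bspec[OF D \<open>?u z \<in> cspace {1..r} - EZ_sing r\<close>] this] show ?thesis .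
      qed
      then show "(\<lambda>z. f (?u z)) field_differentiable at z within S"
        unfolding fun_upd_upd fun_upd_same by (rule field_differentiable_at_within)
    qed
    have hT: "(\<lambda>z. EZ_tail r 0 (?u z)) holomorphic_on S"
      using hol_along_line[OF hol_EZ_tail[of r 0], of "s(Suc k := 0)" "(\<lambda>j. 0)(Suc k := 1)"]
      unfolding line S_def .
    have "f (?u (s (Suc k))) = EZ_tail r 0 (?u (s (Suc k)))"
    proof (rule analytic_continuation_open[OF half opS ne con _ hf hT _ sS])
      fix z assume z: "z \<in> S \<inter> {z. Re z > 1}"
      show "f (?u z) = EZ_tail r 0 (?u z)"
      proof (rule Suc.IH)
        show "\<forall>i\<in>{k<..r}. Re (?u z i) > 1" using z Suc.prems(4) by auto
        show "?u z \<in> regular_pts r" using z unfolding S_def by blast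
        show "?u z \<in> cspace {1..r}" by (rule u)
        show "k \<le> r" using Suc.prems(1) by simp
      qed
    qed auto
    then show ?case by simp
  qed
  from this[of r s] show ?thesis using s by simp
qed

lemma EZ_cont_continuation: "r \<ge> 1 \<Longrightarrow> is_EZ_continuation r (EZ_cont r)"
  unfolding EZ_cont_def using someI[of "is_EZ_continuation r"] EZ_tail_is_EZ_continuation by blast

lemma EZ_cont_eq_EZ_tail: "r \<ge> 1 \<Longrightarrow> s \<in> cspace {1..r} \<Longrightarrow> s \<in> regular_pts r \<Longrightarrow> EZ_cont r s = EZ_tail r 0 s"
  using EZ_continuation_unique EZ_cont_continuation by blast

section \<open>Values at removable singularities and the set of all zeros\<close>

lemma EZ_value_cspace: "EZ_value_at r s v \<Longrightarrow> s \<in> cspace {1..r}"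
  unfolding EZ_value_at_def holo_on_def by (meson openin_imp_subset subsetD topspace_euclidean_subtopology)

lemma EZ_value_at_tail:
  assumes "r \<ge> 1" "s \<in> cspace {1..r}" "s \<in> regular_pts r" shows "EZ_value_at r s (EZ_tail r 0 s)"
  unfolding EZ_value_at_def
proof (intro exI conjI ballI)
  show "holo_on {1..r} (EZ_tail r 0) (cspace {1..r} - EZ_sing r)"
    using EZ_tail_is_EZ_continuation assms by (simp add: is_EZ_continuation_def)
  show "s \<in> cspace {1..r} - EZ_sing r" using assms cspace_minus_EZ_sing by blast
  show "EZ_tail r 0 t = EZ_cont r t" if "t \<in> cspace {1..r} - EZ_sing r - EZ_sing r" for t
    using that EZ_cont_eq_EZ_tail assms(1) mem_regular_pts_iff_not_EZ_sing by auto
qed simp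

text \<open>A local extension is continuous along the line and agrees with \<open>EZ_tail\<close> at
  all nearby parameters other than \<open>w1\<close>, whether or not the point at \<open>w1\<close>
  lies on a hyperplane. This is how values at removable singularities are computed.\<close>

lemma EZ_value_tendsto:
  assumes r: "r \<ge> 1" and v: "EZ_value_at r (line a b w1) v" and b: "\<And>w. line a b w \<in> cspace {1..r}"
    and w0: "line a b w0 \<in> regular_pts r"
  shows "((\<lambda>w. EZ_tail r 0 (line a b w)) \<longlongrightarrow> v) (at w1)"
proof -
  obtain U g where U: "line a b w1 \<in> U" "holo_on {1..r} g U" "\<forall>t\<in>U - EZ_sing r. g t = EZ_cont r t" "g (line a b w1) = v"
    using v unfolding EZ_value_at_def by blast
  have "openin (top_of_set (cspace {1..r})) U" and cg: "continuous_on U g"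
    using U unfolding holo_on_def by auto
  then obtain O' where O': "open O'" "U = cspace {1..r} \<inter> O'" unfolding openin_open by blast
  define S where "S = {w. line a b w \<in> O'}"
  have opS: "open S" unfolding S_def by (rule open_line_vimage[OF O'(1)])
  have SU: "line a b w \<in> U" if "w \<in> S" for w using that b O' by (simp add: S_def)
  have w1: "w1 \<in> S" using U O' by (simp add: S_def)
  have "continuous_on S (\<lambda>w. g (line a b w))"
    by (rule continuous_on_compose2[OF cg continuous_on_line]) (use SU in auto)
  then have "isCont (\<lambda>w. g (line a b w)) w1" using continuous_on_eq_continuous_at[OF opS] w1 by blast
  then have lim: "((\<lambda>w. g (line a b w)) \<longlongrightarrow> v) (at w1)" using U by (simp add: isCont_def)
  have "\<forall>\<^sub>F w in at w1. w \<in> S" using opS w1 by (rule eventually_at_in_open')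
  with eventually_line_regular_pts[OF w0, of w1] have "\<forall>\<^sub>F w in at w1. g (line a b w) = EZ_tail r 0 (line a b w)"
  proof eventually_elim
    case (elim w)
    then have "line a b w \<in> U - EZ_sing r" using SU b mem_regular_pts_iff_not_EZ_sing[OF r b] by auto
    then show ?case using U(3) EZ_cont_eq_EZ_tail[OF r b] elim by simp
  qed
  with lim show ?thesis by (rule Lim_transform_eventually)
qed

text \<open>A base point in the region of convergence: hence regular, and real, so that the tails
  are positive there.\<close>

definition all_threes :: "nat set \<Rightarrow> pt" where
  "all_threes I = (\<lambda>i. if i \<in> I then 3 else 0)"

lemma all_threes_regular_pts: "all_threes {1..r} \<in> regular_pts r"
  by (rule mem_regular_pts_if_Re_gt_1) (simp add: all_threes_def)

lemma line_to [simp]: "line s (\<lambda>i. q i - s i) 0 = s" "line s (\<lambda>i. q i - s i) 1 = q"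
  by (auto simp: line_def)

lemma line_cspace: "s \<in> cspace I \<Longrightarrow> q \<in> cspace I \<Longrightarrow> line s (\<lambda>i. q i - s i) w \<in> cspace I"
  by (auto simp: line_def cspace_def)

text \<open>Both values are the limit of the same function along the line towards
  \<open>all_threes\<close>.\<close>

lemma EZ_value_unique:
  assumes r: "r \<ge> 1" and "EZ_value_at r s v" "EZ_value_at r s v'" shows "v = v'"
proof -
  let ?L = "line s (\<lambda>i. all_threes {1..r} i - s i)"
  have c: "?L w \<in> cspace {1..r}" for w
    by (rule line_cspace[OF EZ_value_cspace[OF assms(2)]]) (simp add: all_threes_def cspace_def)
  have one: "?L 1 \<in> regular_pts r" unfolding line_to by (rule all_threes_regular_pts)
  have "EZ_value_at r (?L 0) v" "EZ_value_at r (?L 0) v'" using assms by simp_all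
  from EZ_value_tendsto[OF r this(1) c one] EZ_value_tendsto[OF r this(2) c one]
  show ?thesis by (rule tendsto_unique[rotated]) simp
qed

lemma EZ_zeta_eqI: "r \<ge> 1 \<Longrightarrow> EZ_value_at r s v \<Longrightarrow> EZ_zeta r s = v"
  unfolding EZ_zeta_def using EZ_value_unique by blast

lemma EZ_zeta_eq_EZ_tail: "r \<ge> 1 \<Longrightarrow> s \<in> cspace {1..r} \<Longrightarrow> s \<in> regular_pts r \<Longrightarrow> EZ_zeta r s = EZ_tail r 0 s"
  using EZ_zeta_eqI EZ_value_at_tail by blast

lemma EZ_holomorphic_at_regular_pts: "r \<ge> 1 \<Longrightarrow> s \<in> cspace {1..r} \<Longrightarrow> s \<in> regular_pts r \<Longrightarrow> EZ_holomorphic_at r s"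
  unfolding EZ_holomorphic_at_def using EZ_value_at_tail by blast

lemma EZ_zero_cspace: "EZ_zero r s \<Longrightarrow> s \<in> cspace {1..r}"
  unfolding EZ_zero_def EZ_holomorphic_at_def using EZ_value_cspace by blast

text \<open>A local extension \<open>g\<close> around one point is also a witness at every other
  point of its domain. So throughout that domain the zeros are those of the single function
  \<open>g\<close>.\<close>

lemma EZ_zero_set_all_zeros:
  assumes r: "r \<ge> 1" shows "EZ_zero_set r {s. EZ_zero r s}"
  unfolding EZ_zero_set_def analytic_subset_def
proof (intro conjI ballI)
  show "{s. EZ_zero r s} \<subseteq> {s. EZ_holomorphic_at r s}" by (auto simp: EZ_zero_def)
  fix p assume "p \<in> {s. EZ_holomorphic_at r s}"
  then obtain U g where U: "p \<in> U" "holo_on {1..r} g U" "\<forall>t\<in>U - EZ_sing r. g t = EZ_cont r t"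
    unfolding EZ_holomorphic_at_def EZ_value_at_def by blast
  then have val: "EZ_value_at r t (g t)" if "t \<in> U" for t
    using that unfolding EZ_value_at_def by blast
  have "EZ_zeta r t = g t" if "t \<in> U" for t
    using val[OF that] by (rule EZ_zeta_eqI[OF r])
  moreover have "EZ_holomorphic_at r t" if "t \<in> U" for t
    using val[OF that] unfolding EZ_holomorphic_at_def by blast
  ultimately have "{s. EZ_zero r s} \<inter> U = {s\<in>U. \<forall>\<phi>\<in>{g}. \<phi> s = 0}"
    by (auto simp: EZ_zero_def)
  moreover have "U \<subseteq> {s. EZ_holomorphic_at r s}"
    using val by (auto simp: EZ_holomorphic_at_def)
  ultimately show "\<exists>U \<Phi>. p \<in> U \<and> U \<subseteq> {s. EZ_holomorphic_at r s} \<and> finite \<Phi> \<and> (\<forall>\<phi>\<in>\<Phi>. holo_on {1..r} \<phi> U) \<and>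
      openin (top_of_set (cspace {1..r})) U \<and> {s. EZ_zero r s} \<inter> U = {s\<in>U. \<forall>\<phi>\<in>\<Phi>. \<phi> s = 0}"
    using U by (intro exI[of _ U] exI[of _ "{g}"]) (auto simp: holo_on_def)
qed simp

subsection \<open>Behaviour for large real part of the first variable\<close>

text \<open>The base \<open>Suc N\<close> is essential. For \<open>N = 1\<close> a bound in powers
  of \<open>N\<close> would not decay as \<open>Re z\<close> grows, while this one decays like
  \<open>2 powr (- Re z)\<close>. It is obtained by replacing the first \<open>N\<close> terms by
  zero and extracting \<open>Suc N powr (\<alpha> + 2)\<close> before applying
  \<open>tail_sum_bound\<close> with exponent -2.\<close>

lemma dirichlet_tail:
  fixes x :: "nat \<Rightarrow> complex"
  assumes x: "\<And>n. n \<ge> 1 \<Longrightarrow> norm (x n) \<le> C * real n powr B" and C: "C \<ge> 0" and z: "Re z \<ge> B + 2"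
  shows "summable (\<lambda>n. of_nat (Suc n) powr (- z) * x (Suc n))"
    and "N \<ge> 1 \<Longrightarrow> norm ((\<Sum>n. of_nat (Suc n) powr (- z) * x (Suc n)) - (\<Sum>n=1..N. of_nat n powr (- z) * x n))
       \<le> C * real (Suc N) powr (B + 2 - Re z)"
proof -
  define \<alpha> where "\<alpha> = B - Re z"
  have bd: "norm (of_nat n powr (- z) * x n) \<le> C * real n powr \<alpha>" if "n \<ge> 1" for n
  proof -
    have "norm (of_nat n powr (- z) * x n) \<le> real n powr (- Re z) * (C * real n powr B)"
      unfolding norm_mult norm_of_nat_powr[OF that] uminus_complex.sel using x[OF that] by (intro mult_left_mono) auto
    also have "\<dots> = C * real n powr \<alpha>" unfolding \<alpha>_def by (simp add: powr_diff powr_minus field_simps)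
    finally show ?thesis .
  qed
  have \<alpha>: "\<alpha> \<le> -2" using z by (simp add: \<alpha>_def)
  show S: "summable (\<lambda>n. of_nat (Suc n) powr (- z) * x (Suc n))"
    using tail_sum_bound(1)[OF bd \<alpha> C] by simp
  define y where "y = (\<lambda>n. if n \<le> N then 0 else of_nat n powr (- z) * x n)"
  define C' where "C' = C * real (Suc N) powr (\<alpha> + 2)"
  have C': "C' \<ge> 0" using C by (simp add: C'_def)
  have yb: "norm (y n) \<le> C' * real n powr (-2)" if n: "n \<ge> 1" for n
  proof (cases "n \<le> N")
    case True then show ?thesis using C' by (simp add: y_def)
  next
    case False
    have "norm (y n) \<le> C * real n powr \<alpha>" using bd[OF n] False by (simp add: y_def)
    also have "real n powr \<alpha> = real n powr (\<alpha> + 2) * real n powr (-2)" by (simp flip: powr_add)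
    also have "\<dots> \<le> real (Suc N) powr (\<alpha> + 2) * real n powr (-2)"
      using False \<alpha> by (intro mult_right_mono powr_mono2') auto
    finally show ?thesis using C by (simp add: C'_def mult_left_mono mult.assoc)
  qed
  have yS: "summable (\<lambda>n. y (Suc n))"
    and yB: "norm ((\<Sum>n. y (Suc n)) - (\<Sum>n=1..Suc 0. y n)) \<le> C' * real (Suc 0) powr (-2 + 1)"
    using tail_sum_bound(1)[OF yb _ C'] tail_sum_bound(2)[OF yb _ C', of "Suc 0"] by auto
  have fin: "(\<lambda>n. if n < N then of_nat (Suc n) powr (- z) * x (Suc n) else 0) sums (\<Sum>n<N. of_nat (Suc n) powr (- z) * x (Suc n))"
    using sums_If_finite_set[of "{..<N}" "\<lambda>n. of_nat (Suc n) powr (- z) * x (Suc n)"] by simp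
  have "(\<lambda>n. of_nat (Suc n) powr (- z) * x (Suc n) - (if n < N then of_nat (Suc n) powr (- z) * x (Suc n) else 0)) sums
     ((\<Sum>n. of_nat (Suc n) powr (- z) * x (Suc n)) - (\<Sum>n<N. of_nat (Suc n) powr (- z) * x (Suc n)))"
    by (rule sums_diff[OF summable_sums[OF S] fin])
  moreover have "of_nat (Suc n) powr (- z) * x (Suc n) - (if n < N then of_nat (Suc n) powr (- z) * x (Suc n) else 0) = y (Suc n)" for n
    by (simp add: y_def)
  ultimately have eq: "(\<Sum>n. y (Suc n)) = (\<Sum>n. of_nat (Suc n) powr (- z) * x (Suc n)) - (\<Sum>n=1..N. of_nat n powr (- z) * x n)"
    by (simp add: sums_iff sum.atLeast1_atMost_eq)
  assume "N \<ge> 1"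
  then have "y (Suc 0) = 0" by (simp add: y_def)
  moreover have e2: "\<alpha> + 2 = B + 2 - Re z" by (simp add: \<alpha>_def)
  ultimately show "norm ((\<Sum>n. of_nat (Suc n) powr (- z) * x (Suc n)) - (\<Sum>n=1..N. of_nat n powr (- z) * x n))
       \<le> C * real (Suc N) powr (B + 2 - Re z)"
    using yB unfolding eq C'_def e2 by simp
qed


lemma regular_pts_SucI:
  assumes "shift s \<in> regular_pts j" "Re (excess (Suc j) s) > 0" shows "s \<in> regular_pts (Suc j)"
proof -
  have "(\<Sum>k=1..Suc j. s k) \<noteq> of_nat (Suc j) - of_nat n" for n
  proof
    assume "(\<Sum>k=1..Suc j. s k) = of_nat (Suc j) - of_nat n"
    then have "excess (Suc j) s = - of_nat n" unfolding excess_def by simp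
    then show False using assms(2) by simp
  qed
  then show ?thesis using assms(1) by simp
qed

lemma EZ_tail_Suc_eq_suminf:
  assumes s: "s \<in> regular_pts (Suc m)" "Re (excess (Suc m) s) > 0"
    and x: "\<And>n. n \<ge> 1 \<Longrightarrow> norm (EZ_tail m n (shift s)) \<le> C * real n powr B" "C \<ge> 0" "Re (s 1) \<ge> B + 2"
  shows "EZ_tail (Suc m) 0 s = (\<Sum>n. of_nat (Suc n) powr (- s 1) * EZ_tail m (Suc n) (shift s))"
proof -
  from EZ_tail_tendsto[OF s] have "(\<lambda>n. summand (EZ_tail m) (Suc n) s) sums EZ_tail (Suc m) 0 s"
    by (simp add: sums_def sum.atLeast1_atMost_eq)
  then show ?thesis by (simp add: sums_iff summand_def)
qed

text \<open>The term \<open>n = 1\<close> carries the factor \<open>1 powr (- s 1) = 1\<close>; all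
  others have base at least 2.\<close>

lemma EZ_tail_approx:
  assumes s: "s \<in> regular_pts (Suc m)" "Re (excess (Suc m) s) > 0"
    and x: "\<And>n. n \<ge> 1 \<Longrightarrow> norm (EZ_tail m n (shift s)) \<le> C * real n powr B" "C \<ge> 0" "Re (s 1) \<ge> B + 2"
  shows "norm (EZ_tail (Suc m) 0 s - EZ_tail m 1 (shift s)) \<le> C * 2 powr (B + 2 - Re (s 1))"
  using dirichlet_tail(2)[OF x, of 1] EZ_tail_Suc_eq_suminf[OF s x] by simp

section \<open>The limiting function as a tail\<close>

lemma last_coords_cspace: "last_coords r j s \<in> cspace {1..j}"
  by (simp add: last_coords_def cspace_def)

lemma last_coords_Suc: "j \<le> m \<Longrightarrow> last_coords (Suc m) j s = last_coords m j (shift s)"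
  by (auto simp: last_coords_def shift_def fun_eq_iff Suc_diff_le)

lemma last_coords_self: "u \<in> cspace {1..m} \<Longrightarrow> last_coords m m u = u"
  by (auto simp: last_coords_def cspace_def fun_eq_iff)

lemma shift_last_coords: "Suc j \<le> m \<Longrightarrow> shift (last_coords m (Suc j) u) = last_coords m j u"
  by (auto simp: last_coords_def shift_def fun_eq_iff Suc_diff_Suc)

lemma last_coords_regular_pts:
  assumes "u \<in> cspace {1..m}" "u \<in> regular_pts m" "j \<le> m" shows "last_coords m j u \<in> regular_pts j"
  using assms(3)
proof (induction rule: inc_induct)
  case base show ?case using assms by (simp add: last_coords_self)
next
  case (step n)
  then show ?case using shift_last_coords[of n m u] by simp
qed

text \<open>\<open>tail_rec\<close> is the recursion satisfied by the tails \<open>EZ_tail j N\<close> at the last \<open>j\<close> coordinates of a point \<open>u\<close> of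
  \<open>m\<close>-space, with the values \<open>EZ_tail j 0\<close> replaced by arbitrary numbers \<open>e j\<close>. This allows values at
  removable singularities.\<close>

primrec tail_rec :: "nat \<Rightarrow> (nat \<Rightarrow> complex) \<Rightarrow> pt \<Rightarrow> nat \<Rightarrow> nat \<Rightarrow> complex" where
  "tail_rec m e u 0 = (\<lambda>N. 1)"
| "tail_rec m e u (Suc j) = (\<lambda>N. e (Suc j) - (\<Sum>n=1..N. of_nat n powr (- u (m - j)) * tail_rec m e u j n))"

lemma tail_rec_eq_EZ_tail:
  "j \<le> m \<Longrightarrow> (\<And>i. i \<in> {1..j} \<Longrightarrow> e i = EZ_tail i 0 (last_coords m i u)) \<Longrightarrow> tail_rec m e u j N = EZ_tail j N (last_coords m j u)"
proof (induction j arbitrary: N)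
  case (Suc j)
  have IH: "tail_rec m e u j n = EZ_tail j n (last_coords m j u)" for n
    using Suc.prems by (intro Suc.IH) auto
  have 1: "last_coords m (Suc j) u 1 = u (m - j)"
    using Suc.prems(1) by (simp add: last_coords_def Suc_diff_Suc)
  have e: "e (Suc j) = EZ_tail (Suc j) 0 (last_coords m (Suc j) u)" using Suc.prems(2)[of "Suc j"] by simp
  show ?case
    unfolding tail_rec.simps e EZ_tail_Suc[of j N] summand_def shift_last_coords[OF Suc.prems(1)] 1 IH ..
qed simp

text \<open>For \<open>N = 1\<close> the recursion reads \<open>e (Suc j)\<close> minus the previous
  value, since the only power is that of 1. Unrolling it produces alternating signs.\<close>

lemma tail_rec_1: "tail_rec m e u j 1 = (\<Sum>i=1..j. (-1) ^ (j - i) * e i) + (-1) ^ j"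
proof (induction j)
  case (Suc j)
  have "tail_rec m e u (Suc j) 1 = e (Suc j) - tail_rec m e u j 1" by simp
  also have "\<dots> = (\<Sum>i=1..Suc j. (-1) ^ (Suc j - i) * e i) + (-1) ^ Suc j"
  proof -
    have "(\<Sum>i=1..j. (-1) ^ (Suc j - i) * e i) = (\<Sum>i=1..j. - ((-1) ^ (j - i) * e i))"
      by (intro sum.cong) (auto simp: Suc_diff_le)
    then show ?thesis unfolding Suc.IH by (simp add: sum_negf)
  qed
  finally show ?case .
qed simp

text \<open>With \<open>r = Suc m\<close>, \<open>r - j + 1\<close> has the parity of
  \<open>m - j\<close>, and minus \<open>(-1) ^ r\<close> is \<open>(-1) ^ m\<close>, so
  \<open>tail_rec_1\<close> gives the defining formula. The point \<open>u\<close> is arbitrary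
  because it enters only as an exponent of 1.\<close>

lemma F_eq_tail_rec:
  assumes "\<And>j. j \<in> {1..m} \<Longrightarrow> EZ_zeta j (last_coords (Suc m) j s) = e j"
  shows "F (Suc m) s = tail_rec m e u m 1"
proof -
  have "F (Suc m) s = (\<Sum>j=1..m. (-1) ^ (Suc m - j + 1) * e j) - (-1) ^ Suc m"
  proof -
    have "(\<Sum>j=1..m. (-1) ^ (Suc m - j + 1) * EZ_zeta j (last_coords (Suc m) j s)) =
        (\<Sum>j=1..m. (-1) ^ (Suc m - j + 1) * e j)"
      using assms by (intro sum.cong) auto
    then show ?thesis unfolding F_def diff_Suc_1 by (rule arg_cong)
  qed
  also have "(\<Sum>j=1..m. (-1) ^ (Suc m - j + 1) * e j) = (\<Sum>j=1..m. (-1) ^ (m - j) * e j)"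
    by (intro sum.cong) (auto simp: Suc_diff_le)
  finally show ?thesis unfolding tail_rec_1 by simp
qed

lemma shift_cspace: "s \<in> cspace {1..Suc m} \<Longrightarrow> shift s \<in> cspace {1..m}"
  by (auto simp: cspace_def shift_def)

lemma cspace_2_subset: "s \<in> cspace {2..r} \<Longrightarrow> s \<in> cspace {1..r}"
  by (auto simp: cspace_def)

lemma shift_upd_1 [simp]: "shift (s(1 := z)) = shift s" "shift (s(Suc 0 := z)) = shift s"
  by (auto simp: shift_def)

text \<open>The equations in \<open>S1\<close> involve only the last coordinates; under
  \<open>shift\<close> they become exactly those of the depth-\<open>m\<close> hyperplanes.\<close>

lemma shift_mem_regular_pts:
  assumes m: "m \<ge> 1" and s: "s \<in> cspace {1..Suc m}" "s \<notin> S1 (Suc m)" shows "shift s \<in> regular_pts m"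
proof -
  have "s \<notin> hyp (Suc m) j n" if "j \<in> {2..m}" for j n
    using s that by (auto simp: S1_def)
  then have "(\<Sum>k=m-j+1..m. shift s k) \<noteq> of_nat j - of_nat n" if "j \<in> {2..m}" for j n
    using that s by (subst sum_shift_tail) (auto simp: hyp_def)
  moreover have "shift s m \<noteq> 1" using s m by (auto simp: S1_def hyp1_def shift_def)
  ultimately have "shift s \<notin> EZ_sing m" by (auto simp: EZ_sing_def hyp_def hyp1_def)
  then show ?thesis using mem_regular_pts_iff_not_EZ_sing[OF m shift_cspace[OF s(1)]] by simp
qed

lemma H_iff_EZ_tail:
  assumes m: "m \<ge> 1" and \<rho>: "\<rho> \<in> cspace {2..Suc m}" "shift \<rho> \<in> regular_pts m"
  shows "\<rho> \<in> H (Suc m) \<longleftrightarrow> EZ_tail m 1 (shift \<rho>) = 0"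
proof -
  let ?u = "shift \<rho>"
  have u: "?u \<in> cspace {1..m}" using shift_cspace cspace_2_subset \<rho>(1) by blast
  have g: "last_coords (Suc m) j \<rho> \<in> regular_pts j" "last_coords (Suc m) j \<rho> = last_coords m j ?u" if "j \<in> {1..m}" for j
    using last_coords_regular_pts[OF u \<rho>(2), of j] last_coords_Suc[of j m \<rho>] that by simp_all
  have "EZ_holomorphic_at j (last_coords (Suc m) j \<rho>)" if "j \<in> {1..m}" for j
    using EZ_holomorphic_at_regular_pts[OF _ last_coords_cspace g(1)[OF that]] that by simp
  moreover have "F (Suc m) \<rho> = EZ_tail m 1 ?u"
  proof -
    have "EZ_zeta j (last_coords (Suc m) j \<rho>) = EZ_tail j 0 (last_coords m j ?u)" if "j \<in> {1..m}" for j
      using EZ_zeta_eq_EZ_tail[OF _ last_coords_cspace g(1)[OF that]] that g(2)[OF that] by simp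
    then have "F (Suc m) \<rho> = tail_rec m (\<lambda>j. EZ_tail j 0 (last_coords m j ?u)) ?u m 1"
      by (rule F_eq_tail_rec)
    also have "\<dots> = EZ_tail m 1 (last_coords m m ?u)" by (rule tail_rec_eq_EZ_tail) auto
    finally show ?thesis by (simp add: last_coords_self[OF u])
  qed
  ultimately show ?thesis using \<rho>(1) by (simp add: H_def)
qed

section \<open>Part (i): limits of zeros\<close>

text \<open>At a zero, \<open>EZ_tail_approx\<close> bounds the tail with \<open>N = 1\<close>
  itself. The bound is a constant times \<open>2 powr (M + 2 - Re (p n 1))\<close> with
  \<open>M\<close> independent of \<open>n\<close>, so the tail tends to 0 and continuity transfers
  this to the limit point.\<close>

lemma zeros_limit_in_H:
  assumes m: "m \<ge> 1" and p: "\<And>n. EZ_zero (Suc m) (p n)"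
    and lim: "(\<lambda>n. (p n)(1 := 0)) \<longlonglongrightarrow> \<rho>" and re: "filterlim (\<lambda>n. Re (p n 1)) at_top sequentially"
    and \<rho>: "\<rho> \<in> cspace {2..Suc m}" "\<rho> \<notin> S1 (Suc m)"
  shows "\<rho> \<in> H (Suc m)"
proof -
  let ?u = "shift \<rho>"
  have u: "?u \<in> regular_pts m" using shift_mem_regular_pts[OF m cspace_2_subset] \<rho> by simp
  have lims: "(\<lambda>n. shift (p n)) \<longlonglongrightarrow> ?u"
    using filterlim_compose[OF tendsto_shift lim] by simp
  obtain C where C: "C \<ge> 0" "\<forall>\<^sub>F s in nhds ?u. \<forall>N\<ge>1. norm (EZ_tail m N s) \<le> C * real N powr (- Re (excess m s))"
    using bigO_nearE[OF EZ_tail_bound[OF u]] .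
  \<comment> \<open>\<open>M\<close> dominates the varying exponent \<open>- Re (excess m s)\<close>
    on a neighbourhood of the limit point.\<close>
  define M where "M = norm (excess m ?u) + 1"
  have M0: "M \<ge> 0" by (simp add: M_def)
  have "isCont (excess m) ?u"
    using hol_continuous[OF hol_excess[of UNIV m]] by (simp add: continuous_on_eq_continuous_at)
  then have "\<forall>\<^sub>F s in nhds ?u. norm (excess m s) \<le> M" unfolding M_def by (rule isCont_eventually_norm_le)
  with C(2) have "\<forall>\<^sub>F s in nhds ?u. s \<in> regular_pts m \<and> norm (excess m s) \<le> M \<and> (\<forall>N\<ge>1. norm (EZ_tail m N s) \<le> C * real N powr M)"
    using eventually_nhds_in_open[OF open_regular_pts u]
  proof eventually_elim
    case (elim s)
    have "norm (EZ_tail m N s) \<le> C * real N powr M" if "N \<ge> 1" for N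
    proof -
      have "- Re (excess m s) \<le> M" using elim(2) abs_Re_le_cmod[of "excess m s"] by linarith
      then have "C * real N powr (- Re (excess m s)) \<le> C * real N powr M"
        using C(1) that by (intro mult_left_mono powr_mono) auto
      then show ?thesis using elim(1) that by fastforce
    qed
    then show ?case using elim by blast
  qed
  from eventually_compose_filterlim[OF this lims]
  have ev: "\<forall>\<^sub>F n in sequentially. shift (p n) \<in> regular_pts m \<and> norm (excess m (shift (p n))) \<le> M \<and>
      (\<forall>N\<ge>1. norm (EZ_tail m N (shift (p n))) \<le> C * real N powr M)" .
  have big: "\<forall>\<^sub>F n in sequentially. Re (p n 1) \<ge> M + 2"
    using re by (simp add: filterlim_at_top)
  have bound: "\<forall>\<^sub>F n in sequentially. norm (EZ_tail m 1 (shift (p n))) \<le> C * 2 powr (M + 2 - Re (p n 1))"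
    using ev big
  proof eventually_elim
    case (elim n)
    \<comment> \<open>A large \<open>Re (p n 1)\<close> also moves the point off the hyperplanes
      involving all coordinates, so regularity of \<open>p n\<close> is automatic for large
      \<open>n\<close>.\<close>
    have excess: "Re (excess (Suc m) (p n)) > 0"
    proof -
      have "norm (excess m (shift (p n))) \<le> M" using elim(1) by (elim conjE)
      then have "Re (p n 1) + Re (excess m (shift (p n))) \<ge> 2"
        using elim(2) abs_Re_le_cmod[of "excess m (shift (p n))"] by linarith
      then show ?thesis unfolding excess_Suc by simp
    qed
    have regular_pts: "p n \<in> regular_pts (Suc m)" using elim excess by (intro regular_pts_SucI) auto
    have "EZ_tail (Suc m) 0 (p n) = 0"
      using EZ_zeta_eq_EZ_tail[OF _ EZ_zero_cspace[OF p] regular_pts] p[of n] by (simp add: EZ_zero_def)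
    with EZ_tail_approx[OF regular_pts excess, of C M] elim C(1) show ?case by simp
  qed
  have "(\<lambda>n. C * 2 powr (M + 2 - Re (p n 1))) \<longlonglongrightarrow> 0"
  proof (rule tendsto_mult_right_zero)
    have "filterlim (\<lambda>n. (M + 2) - Re (p n 1)) at_bot sequentially"
      using filterlim_uminus_at_top[THEN iffD1, OF filterlim_tendsto_add_at_top[OF tendsto_const re], of "- (M + 2)"]
      by (simp add: add.commute)
    then have "filterlim (\<lambda>n. ln 2 * ((M + 2) - Re (p n 1))) at_bot sequentially"
      by (intro filterlim_tendsto_pos_mult_at_bot[OF tendsto_const]) simp_all
    from filterlim_compose[OF exp_at_bot this]
    show "(\<lambda>n. 2 powr (M + 2 - Re (p n 1))) \<longlonglongrightarrow> 0"
      by (simp add: powr_def mult.commute)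
  qed
  from Lim_null_comparison[OF bound this] have "(\<lambda>n. EZ_tail m 1 (shift (p n))) \<longlonglongrightarrow> 0" .
  moreover have "isCont (EZ_tail m 1) ?u"
    using hol_continuous[OF hol_EZ_tail[of m 1]] open_regular_pts u continuous_on_eq_continuous_at by blast
  then have "(\<lambda>n. EZ_tail m 1 (shift (p n))) \<longlonglongrightarrow> EZ_tail m 1 ?u" using lims by (rule isCont_tendsto_compose)
  ultimately have "EZ_tail m 1 ?u = 0" by (rule LIMSEQ_unique[rotated])
  then show ?thesis using H_iff_EZ_tail[OF m \<rho>(1) u] by simp
qed

text \<open>The metric of the function type is not the Euclidean one, so compactness is taken from
  Tychonoff's theorem: the set is closed and lies in a product of discs and of singletons
  \<open>{0}\<close>.\<close>

lemma compact_cspace_bounded: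
  assumes "cbounded I D" "D \<subseteq> cspace I" "closedin (top_of_set (cspace I)) D"
  shows "compact D"
proof -
  obtain B where B: "\<forall>s\<in>D. \<forall>i\<in>I. cmod (s i) \<le> B" using assms(1) unfolding cbounded_def by blast
  define K where "K = (\<lambda>i. if i \<in> I then cball (0::complex) B else {0})"
  have "compactin (product_topology (\<lambda>i. euclidean) UNIV) (PiE UNIV K)"
    unfolding compactin_PiE by (simp add: K_def)
  then have cK: "compact (PiE UNIV K)" unfolding euclidean_product_topology by simp
  have "closed ((\<lambda>s::pt. s i) -` {0})" for i
    by (intro closed_vimage closed_singleton continuous_on_coord)
  then have "closed (\<Inter>i\<in>-I. (\<lambda>s::pt. s i) -` {0})" by (intro closed_INT) auto
  moreover have "cspace I = (\<Inter>i\<in>-I. (\<lambda>s::pt. s i) -` {0})" by (auto simp: cspace_def)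
  ultimately have "closed (cspace I)" by simp
  then have "closed D" using assms(3) closedin_closed_trans by blast
  moreover have "D \<subseteq> PiE UNIV K" using B assms(2) by (auto simp: K_def cspace_def)
  ultimately show ?thesis using compact_Int_closed[OF cK, of D] by (simp add: Int_absorb1)
qed

lemma cdist_tendsto_0: "x \<longlonglongrightarrow> \<rho> \<Longrightarrow> (\<lambda>n. cdist I (x n) \<rho>) \<longlonglongrightarrow> 0"
proof -
  assume x: "x \<longlonglongrightarrow> \<rho>"
  have "(\<lambda>n. x n i) \<longlonglongrightarrow> \<rho> i" for i
  proof (rule isCont_tendsto_compose[of \<rho> "\<lambda>s. s i", OF _ x])
    show "isCont (\<lambda>s::pt. s i) \<rho>"
      using continuous_on_coord[of UNIV i] unfolding continuous_on_eq_continuous_at[OF open_UNIV] by blast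
  qed
  then have "(\<lambda>n. sqrt (\<Sum>i\<in>I. (cmod (x n i - \<rho> i))\<^sup>2)) \<longlonglongrightarrow> sqrt (\<Sum>i\<in>I. (cmod (\<rho> i - \<rho> i))\<^sup>2)"
    by (intro tendsto_intros)
  then show ?thesis by (simp add: cdist_def L2_set_def)
qed

lemma upd_1_id: "s \<in> cspace {2..r} \<Longrightarrow> s(1 := 0) = s"
  by (auto simp: cspace_def fun_eq_iff)

lemma zeros_subsequence:
  assumes m: "m \<ge> 1"
    and D: "D \<subseteq> cspace {2..Suc m}" "cbounded {2..Suc m} D" "closedin (top_of_set (cspace {2..Suc m})) D"
      "{s \<in> cspace {1..Suc m}. s(1 := 0) \<in> D} \<inter> S1 (Suc m) = {}"
    and p: "\<And>n. EZ_zero (Suc m) (p n)" "\<And>n. (p n)(1 := 0) \<in> D"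
    and re: "filterlim (\<lambda>n. Re (p n 1)) at_top sequentially"
  shows "\<exists>k \<rho>. strict_mono k \<and> \<rho> \<in> H (Suc m) \<and> (\<lambda>n. (p (k n))(1 := 0)) \<longlonglongrightarrow> \<rho>"
proof -
  have "seq_compact D"
    using compact_cspace_bounded[OF D(2,1,3)] by (simp add: compact_eq_seq_compact_metric)
  then obtain \<rho> k where k: "\<rho> \<in> D" "strict_mono k" "((\<lambda>n. (p n)(1 := 0)) \<circ> k) \<longlonglongrightarrow> \<rho>"
    using seq_compactE[of D "\<lambda>n. (p n)(1 := 0)"] p(2) by blast
  have \<rho>: "\<rho> \<in> cspace {2..Suc m}" using D(1) k(1) by blast
  have "\<rho> \<notin> S1 (Suc m)"
    using D(4) k(1) cspace_2_subset[OF \<rho>] upd_1_id[OF \<rho>] by auto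
  then have "\<rho> \<in> H (Suc m)"
    using zeros_limit_in_H[OF m, of "p \<circ> k" \<rho>] p(1) k \<rho>
      filterlim_compose[OF re filterlim_subseq[OF k(2)]] by (simp add: o_def)
  then show ?thesis using k by (auto simp: o_def)
qed

text \<open>Counterexamples with \<open>Re (s 1) > n\<close> for every \<open>n\<close> would have a
  subsequence converging to a point of \<open>H\<close>, contradicting their distance from
  it.\<close>

lemma zeros_uniformly_near_H:
  assumes m: "m \<ge> 1"
    and D: "D \<subseteq> cspace {2..Suc m}" "cbounded {2..Suc m} D" "closedin (top_of_set (cspace {2..Suc m})) D"
      "{s \<in> cspace {1..Suc m}. s(1 := 0) \<in> D} \<inter> S1 (Suc m) = {}"
    and \<epsilon>: "\<epsilon> > 0"
  shows "\<exists>K::real. \<forall>s. EZ_zero (Suc m) s \<and> s(1 := 0) \<in> D \<and> Re (s 1) > K \<longrightarrow>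
     (\<exists>h\<in>H (Suc m). cdist {2..Suc m} (s(1 := 0)) h < \<epsilon>)"
proof (rule ccontr)
  assume "\<not> ?thesis"
  then have "\<forall>n::nat. \<exists>s. EZ_zero (Suc m) s \<and> s(1 := 0) \<in> D \<and> Re (s 1) > real n \<and>
     \<not> (\<exists>h\<in>H (Suc m). cdist {2..Suc m} (s(1 := 0)) h < \<epsilon>)" by blast
  then obtain p where p: "\<And>n. EZ_zero (Suc m) (p n)" "\<And>n. (p n)(1 := 0) \<in> D" "\<And>n. Re (p n 1) > real n"
     and far: "\<And>n h. h \<in> H (Suc m) \<Longrightarrow> \<not> cdist {2..Suc m} ((p n)(1 := 0)) h < \<epsilon>"
    by metis
  have "filterlim (\<lambda>n. Re (p n 1)) at_top sequentially"
    by (rule filterlim_at_top_mono[OF filterlim_real_sequentially]) (intro always_eventually allI less_imp_le p(3))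
  from zeros_subsequence[OF m D p(1,2) this] obtain k \<rho> where
    \<rho>: "\<rho> \<in> H (Suc m)" "(\<lambda>n. (p (k n))(1 := 0)) \<longlonglongrightarrow> \<rho>" by blast
  have "\<forall>\<^sub>F n in sequentially. cdist {2..Suc m} ((p (k n))(1 := 0)) \<rho> < \<epsilon>"
    using order_tendstoD(2)[OF cdist_tendsto_0[OF \<rho>(2)] \<epsilon>] .
  then show False using far[OF \<rho>(1)] by (auto simp: eventually_sequentially)
qed

lemma INF_cdist_tendsto_0:
  assumes "\<And>\<epsilon>. \<epsilon> > 0 \<Longrightarrow> \<forall>\<^sub>F n in sequentially. \<exists>h\<in>A. cdist I (x n) h < \<epsilon>" and A: "A \<noteq> {}"
  shows "(\<lambda>n. INF h\<in>A. cdist I (x n) h) \<longlonglongrightarrow> 0"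
proof (rule tendstoI)
  fix e :: real assume "e > 0"
  from assms(1)[OF this] show "\<forall>\<^sub>F n in sequentially. dist (INF h\<in>A. cdist I (x n) h) 0 < e"
  proof eventually_elim
    case (elim n)
    then obtain h where h: "h \<in> A" "cdist I (x n) h < e" by blast
    have nn: "cdist I s t \<ge> 0" for s t by (simp add: cdist_def L2_set_nonneg)
    have "(INF h\<in>A. cdist I (x n) h) \<le> cdist I (x n) h"
      using nn h(1) by (intro cINF_lower bdd_belowI2[of _ 0]) auto
    moreover have "(INF h\<in>A. cdist I (x n) h) \<ge> 0" using A nn by (intro cINF_greatest) auto
    ultimately show ?case using h(2) by simp
  qed
qed

section \<open>Vanishing Dirichlet coefficients and polynomial bounds on compact sets\<close>

text \<open>If all coefficients before \<open>N\<close> vanish, the \<open>N\<close>-th term equals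
  the negative of the remaining series. Multiplying by \<open>N ^ k\<close> bounds
  \<open>x N\<close> by a constant times \<open>(N / Suc N) ^ k\<close>, which tends to 0.\<close>

lemma dirichlet_zero:
  fixes x :: "nat \<Rightarrow> complex"
  assumes x: "\<And>n. n \<ge> 1 \<Longrightarrow> norm (x n) \<le> C * real n powr B" and C: "C \<ge> 0"
    and z: "\<And>k. k \<ge> K \<Longrightarrow> (\<Sum>n. of_nat (Suc n) powr (- of_nat k) * x (Suc n)) = 0"
  shows "N \<ge> 1 \<Longrightarrow> x N = 0"
proof (induction N rule: less_induct)
  case (less N)
  define K' where "K' = max K (nat \<lceil>B + 2\<rceil>)"
  have bound: "norm (x N) \<le> C * real (Suc N) powr (B + 2) * (real N / real (Suc N)) ^ k" if k: "k \<ge> K'" for k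
  proof -
    have kB: "Re (of_nat k) \<ge> B + 2" using k unfolding K'_def by simp linarith
    have "(\<Sum>n=1..N. of_nat n powr (- of_nat k) * x n) = of_nat N powr (- of_nat k) * x N"
    proof -
      have "(\<Sum>n\<in>{1..N}-{N}. of_nat n powr (- of_nat k) * x n) = 0"
        using less.IH by (intro sum.neutral) auto
      then show ?thesis using less.prems by (subst sum.remove[of _ N]) auto
    qed
    then have "norm (of_nat N powr (- of_nat k) * x N) \<le> C * real (Suc N) powr (B + 2 - real k)"
      using dirichlet_tail(2)[OF x C kB less.prems] z[of k] k by (simp add: K'_def del: of_nat_Suc)
    moreover have "norm (of_nat N powr (- of_nat k) * x N) = norm (x N) / real N ^ k"
      unfolding norm_mult norm_of_nat_powr[OF less.prems]
      using less.prems by (simp add: powr_minus powr_realpow divide_inverse)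
    moreover have "real (Suc N) powr (B + 2 - real k) = real (Suc N) powr (B + 2) / real (Suc N) ^ k"
      by (simp add: powr_diff powr_realpow del: of_nat_Suc)
    ultimately have "norm (x N) / real N ^ k \<le> C * (real (Suc N) powr (B + 2) / real (Suc N) ^ k)"
      by simp
    then have "norm (x N) \<le> C * (real (Suc N) powr (B + 2) / real (Suc N) ^ k) * real N ^ k"
      using less.prems by (simp add: pos_divide_le_eq)
    then show ?thesis by (simp add: power_divide)
  qed
  have "(\<lambda>k. C * real (Suc N) powr (B + 2) * (real N / real (Suc N)) ^ k) \<longlonglongrightarrow> 0"
    by (intro tendsto_mult_right_zero LIMSEQ_power_zero) simp
  from tendsto_lowerbound[OF this, of "norm (x N)"] bound show ?case
    by (auto simp: eventually_sequentially)
qed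

text \<open>Consecutive tails of depth \<open>Suc j\<close> differ by a nonzero factor times a tail
  of depth \<open>j\<close>. Vanishing from some \<open>M\<close> on would therefore descend to
  depth 0, where the tail is 1.\<close>

lemma tail_rec_not_eventually_zero: "\<exists>N\<ge>M. tail_rec m e u j N \<noteq> 0"
proof (induction j arbitrary: M)
  case 0 show ?case by auto
next
  case (Suc j)
  show ?case
  proof (rule ccontr)
    assume "\<not> ?thesis"
    then have z: "tail_rec m e u (Suc j) N = 0" if "N \<ge> M" for N using that by blast
    obtain N where N: "N \<ge> Suc M" "tail_rec m e u j N \<noteq> 0" using Suc.IH by blast
    then obtain N' where N': "N = Suc N'" "N' \<ge> M" by (cases N) auto
    have "tail_rec m e u (Suc j) N' - tail_rec m e u (Suc j) N = of_nat N powr (- u (m - j)) * tail_rec m e u j N"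
      unfolding N' by simp
    moreover have "tail_rec m e u (Suc j) N' = 0" "tail_rec m e u (Suc j) N = 0" using z[of N'] z[of N] N(1) N'(2) by (simp_all del: tail_rec.simps)
    moreover have "of_nat N \<noteq> (0::complex)" using N(1) by simp
    ultimately show False using N(2) by (simp del: tail_rec.simps)
  qed
qed

text \<open>Using one number \<open>k\<close> both as constant and as exponent makes the sets
  \<open>U k\<close> increasing, so a finite subcover reduces to a single set.\<close>

lemma compact_polynomial_bound:
  fixes f :: "nat \<Rightarrow> complex \<Rightarrow> complex"
  assumes K: "compact K"
    and loc: "\<And>z. z \<in> K \<Longrightarrow> \<exists>C B. C \<ge> 0 \<and> (\<forall>\<^sub>F w in nhds z. \<forall>N\<ge>1. norm (f N w) \<le> C * real N powr B)"
  shows "\<exists>C B. C \<ge> 0 \<and> B \<ge> 0 \<and> (\<forall>w\<in>K. \<forall>N\<ge>1. norm (f N w) \<le> C * real N powr B)"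
proof -
  define U where "U = (\<lambda>k::nat. interior {w. \<forall>N\<ge>1. norm (f N w) \<le> real k * real N powr real k})"
  have mono: "U k \<subseteq> U l" if "k \<le> l" for k l
    unfolding U_def
  proof (intro interior_mono Collect_mono impI allI)
    fix w N assume "\<forall>N\<ge>1. norm (f N w) \<le> real k * real N powr real k" and N: "(N::nat) \<ge> 1"
    then have "norm (f N w) \<le> real k * real N powr real k" by simp
    also have "\<dots> \<le> real l * real N powr real l" using that N by (intro mult_mono powr_mono) auto
    finally show "norm (f N w) \<le> real l * real N powr real l" .
  qed
  have "K \<subseteq> (\<Union>k\<in>UNIV. U k)"
  proof
    fix z assume "z \<in> K"
    then obtain C B where C: "C \<ge> 0" and ev: "\<forall>\<^sub>F w in nhds z. \<forall>N\<ge>1. norm (f N w) \<le> C * real N powr B"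
      using loc by blast
    obtain S where S: "open S" "z \<in> S" "\<And>w. w \<in> S \<Longrightarrow> \<forall>N\<ge>1. norm (f N w) \<le> C * real N powr B"
      using ev unfolding eventually_nhds by blast
    obtain k :: nat where k: "real k \<ge> max C B" using real_arch_simple by blast
    have "S \<subseteq> {w. \<forall>N\<ge>1. norm (f N w) \<le> real k * real N powr real k}"
    proof (clarify)
      fix w N assume w: "w \<in> S" and N: "(N::nat) \<ge> 1"
      have "norm (f N w) \<le> C * real N powr B" using S(3)[OF w] N by blast
      also have "\<dots> \<le> real k * real N powr real k" using k N C by (intro mult_mono powr_mono) auto
      finally show "norm (f N w) \<le> real k * real N powr real k" .
    qed
    then have "z \<in> U k" unfolding U_def using S(1,2) by (rule interiorI[rotated 2])
    then show "z \<in> (\<Union>k\<in>UNIV. U k)" by blast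
  qed
  then obtain A where A: "finite A" "K \<subseteq> (\<Union>k\<in>A. U k)"
    using compactE_image[OF K, of UNIV U] unfolding U_def by (metis (no_types, lifting) open_interior subset_UNIV)
  define n where "n = Max (insert 0 A)"
  have "K \<subseteq> U n"
  proof
    fix z assume "z \<in> K"
    then obtain k where k: "k \<in> A" "z \<in> U k" using A by blast
    have "k \<le> n" unfolding n_def using A k by (intro Max_ge) auto
    then show "z \<in> U n" using mono k by blast
  qed
  then have "\<forall>w\<in>K. \<forall>N\<ge>1. norm (f N w) \<le> real n * real N powr real n"
    unfolding U_def using interior_subset by fastforce
  then show ?thesis by (intro exI[of _ "real n"] exI[of _ "real n"]) simp
qed

subsection \<open>Zeros near a point of the limiting hypersurface\<close>

locale solution =
  fixes m :: nat and \<rho> :: pt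
  assumes m: "m \<ge> 1" and \<rho>: "\<rho> \<in> H (Suc m)"
begin

definition u :: pt where "u = shift \<rho>"

definition segment :: "complex \<Rightarrow> pt" where
  "segment w = line u (\<lambda>i. all_threes {1..m} i - u i) w"

lemma u_cspace: "u \<in> cspace {1..m}"
  using \<rho> shift_cspace cspace_2_subset unfolding u_def H_def by blast

lemma segment_cspace: "segment w \<in> cspace {1..m}"
  unfolding segment_def using u_cspace by (rule line_cspace) (simp add: all_threes_def cspace_def)

lemma segment_0: "segment 0 = u" and segment_1: "segment 1 = all_threes {1..m}"
  by (simp_all add: segment_def)

lemma segment_1_regular_pts: "segment 1 \<in> regular_pts m"
  unfolding segment_1 by (rule all_threes_regular_pts)

lemma last_coords_segment:
  "last_coords m j (segment w) = line (last_coords m j u) (\<lambda>i. last_coords m j (all_threes {1..m}) i - last_coords m j u i) w"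
  by (auto simp: segment_def last_coords_def line_def fun_eq_iff)

text \<open>At \<open>w = 0\<close> the point may lie on a hyperplane, where nothing is known of
  \<open>EZ_tail\<close>; the value of the holomorphic extension is inserted instead.\<close>

definition e :: "nat \<Rightarrow> complex \<Rightarrow> complex" where
  "e j w = (if w = 0 then EZ_zeta j (last_coords m j u) else EZ_tail j 0 (last_coords m j (segment w)))"

definition t :: "nat \<Rightarrow> nat \<Rightarrow> complex \<Rightarrow> complex" where
  "t j N w = tail_rec m (\<lambda>j. e j w) (segment w) j N"

lemma t_0 [simp]: "t 0 N w = 1"
  by (simp add: t_def)

lemma t_Suc: "t (Suc j) N w = e (Suc j) w - (\<Sum>n=1..N. of_nat n powr (- segment w (m - j)) * t j n w)"
  by (simp add: t_def)

lemma t_eq_EZ_tail: "w \<noteq> 0 \<Longrightarrow> t m N w = EZ_tail m N (segment w)"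
  using tail_rec_eq_EZ_tail[of m m "\<lambda>j. e j w" "segment w" N] by (simp add: t_def e_def last_coords_self[OF segment_cspace])

lemma t_1_0: "t m 1 0 = 0"
proof -
  have "F (Suc m) \<rho> = tail_rec m (\<lambda>j. e j 0) u m 1"
    by (rule F_eq_tail_rec) (simp add: e_def u_def last_coords_Suc)
  then show ?thesis using \<rho> by (simp add: t_def segment_0 H_def)
qed

lemma e_tendsto:
  assumes j: "j \<in> {1..m}" shows "(e j \<longlongrightarrow> e j 0) (at 0)"
proof -
  have "EZ_holomorphic_at j (last_coords (Suc m) j \<rho>)" using \<rho> j by (simp add: H_def)
  then obtain v where v: "EZ_value_at j (last_coords m j u) v"
    using j by (auto simp: EZ_holomorphic_at_def u_def last_coords_Suc)
  have ev: "e j 0 = v" using EZ_zeta_eqI[OF _ v] j by (simp add: e_def)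
  let ?b = "\<lambda>i. last_coords m j (all_threes {1..m}) i - last_coords m j u i"
  have "((\<lambda>w. EZ_tail j 0 (line (last_coords m j u) ?b w)) \<longlongrightarrow> v) (at 0)"
  proof (rule EZ_value_tendsto)
    show "1 \<le> j" using j by simp
    show "EZ_value_at j (line (last_coords m j u) ?b 0) v" using v by simp
    show "line (last_coords m j u) ?b w \<in> cspace {1..j}" for w
      unfolding last_coords_segment[symmetric] by (rule last_coords_cspace)
    show "line (last_coords m j u) ?b 1 \<in> regular_pts j"
      unfolding last_coords_segment[symmetric] using j by (intro last_coords_regular_pts segment_cspace segment_1_regular_pts) simp
  qed
  then show ?thesis unfolding ev
    by (rule Lim_transform_eventually) (simp add: eventually_at_filter e_def last_coords_segment)
qed

lemma radius:
  obtains R where "R > 0" "\<And>w. w \<noteq> 0 \<Longrightarrow> norm w < R \<Longrightarrow> segment w \<in> regular_pts m"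
proof -
  have "\<forall>\<^sub>F w in at 0. segment w \<in> regular_pts m"
    unfolding segment_def by (rule eventually_line_regular_pts[of _ _ 1]) (use segment_1_regular_pts in \<open>simp add: segment_def\<close>)
  then obtain R where "R > 0" "\<forall>w. w \<noteq> 0 \<and> dist w 0 < R \<longrightarrow> segment w \<in> regular_pts m"
    unfolding eventually_at by auto
  then show ?thesis using that by simp
qed

context
  fixes R :: real
  assumes R: "R > 0" "\<And>w. w \<noteq> 0 \<Longrightarrow> norm w < R \<Longrightarrow> segment w \<in> regular_pts m"
begin

text \<open>Riemann's theorem on removable singularities: the punctured disc consists of regular
  points, and the guard in \<open>H\<close> yields continuity at 0.\<close>

lemma e_holomorphic:
  assumes j: "j \<in> {1..m}" shows "e j holomorphic_on ball 0 R"
proof (rule no_isolated_singularity'[of "{0}"])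
  show "(e j \<longlongrightarrow> e j z) (at z within ball 0 R)" if "z \<in> {0}" for z
    using e_tendsto[OF j] that by (auto intro: tendsto_within_subset)
  have "(\<lambda>w. EZ_tail j 0 (last_coords m j (segment w))) holomorphic_on ball 0 R - {0}"
  proof -
    have "last_coords m j (segment w) \<in> regular_pts j" if "w \<in> ball 0 R - {0}" for w
      using R(2)[of w] that j by (intro last_coords_regular_pts segment_cspace) auto
    then show ?thesis
      unfolding last_coords_segment by (intro holomorphic_on_subset[OF hol_along_line[OF hol_EZ_tail]]) auto
  qed
  then show "e j holomorphic_on ball 0 R - {0}"
    by (rule holomorphic_transform) (simp add: e_def)
qed auto

text \<open>The recursion involves only the values \<open>e\<close> and finitely many exponentials,
  not the coefficients of the expansion, so it survives at \<open>w = 0\<close>.\<close>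

lemma t_holomorphic: "j \<le> m \<Longrightarrow> t j N holomorphic_on ball 0 R"
proof (induction j arbitrary: N)
  case 0
  have "t 0 N = (\<lambda>w. 1)" by (simp add: fun_eq_iff)
  then show ?case by simp
next
  case (Suc j)
  have "(\<lambda>w. e (Suc j) w - (\<Sum>n=1..N. of_nat n powr (- segment w (m - j)) * t j n w)) holomorphic_on ball 0 R"
  proof (intro holomorphic_on_diff holomorphic_on_sum holomorphic_on_mult)
    show "e (Suc j) holomorphic_on ball 0 R" using Suc.prems by (intro e_holomorphic) simp
    show "t j n holomorphic_on ball 0 R" for n using Suc by simp
    fix n :: nat assume "n \<in> {1..N}"
    then show "(\<lambda>w. of_nat n powr (- segment w (m - j))) holomorphic_on ball 0 R"
      unfolding segment_def line_def by (intro holomorphic_intros) auto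
  qed
  moreover have "t (Suc j) N = (\<lambda>w. e (Suc j) w - (\<Sum>n=1..N. of_nat n powr (- segment w (m - j)) * t j n w))"
    by (rule ext) (rule t_Suc)
  ultimately show ?case by simp
qed

lemma t_local_bound:
  assumes z: "z \<noteq> 0" "norm z < R"
  shows "\<exists>C B. C \<ge> 0 \<and> (\<forall>\<^sub>F w in nhds z. \<forall>N\<ge>1. norm (t m N w) \<le> C * real N powr B)"
proof -
  have regular_pts: "segment z \<in> regular_pts m" using R z by simp
  obtain C where C: "C \<ge> 0" "\<forall>\<^sub>F s in nhds (segment z). \<forall>N\<ge>1. norm (EZ_tail m N s) \<le> C * real N powr (- Re (excess m s))"
    using bigO_nearE[OF EZ_tail_bound[OF regular_pts]] .
  have "isCont (excess m) (segment z)"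
    using hol_continuous[OF hol_excess[of UNIV m]] by (simp add: continuous_on_eq_continuous_at)
  from isCont_eventually_norm_le[OF this]
  have excess: "\<forall>\<^sub>F s in nhds (segment z). norm (excess m s) \<le> norm (excess m (segment z)) + 1" .
  have lim: "filterlim segment (nhds (segment z)) (nhds z)"
    using continuous_on_line[of UNIV u "\<lambda>i. all_threes {1..m} i - u i"] unfolding segment_def[abs_def]
    by (simp add: continuous_on_eq_continuous_at isCont_def tendsto_at_iff_tendsto_nhds)
  have ne: "\<forall>\<^sub>F w in nhds z. w \<noteq> 0" using z(1) by (rule t1_space_nhds)
  have "\<forall>\<^sub>F w in nhds z. \<forall>N\<ge>1. norm (t m N w) \<le> C * real N powr (norm (excess m (segment z)) + 1)"
    using eventually_compose_filterlim[OF C(2) lim] eventually_compose_filterlim[OF excess lim] ne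
  proof eventually_elim
    case (elim w)
    show ?case
    proof (intro allI impI)
      fix N :: nat assume N: "N \<ge> 1"
      have "norm (t m N w) \<le> C * real N powr (- Re (excess m (segment w)))"
        using elim N by (simp add: t_eq_EZ_tail)
      also have "\<dots> \<le> C * real N powr (norm (excess m (segment z)) + 1)"
        using C(1) N elim(2) abs_Re_le_cmod[of "excess m (segment w)"] by (intro mult_left_mono powr_mono) auto
      finally show "norm (t m N w) \<le> C * real N powr (norm (excess m (segment z)) + 1)" .
    qed
  qed
  then show ?thesis using C(1) by blast
qed

text \<open>The local bounds are restricted to \<open>w \<noteq> 0\<close>. They hold with common
  constants on the circle, and the maximum principle, applied for each \<open>N\<close>, extends
  them to the disc including its centre.\<close>

lemma t_uniform_bound:
  assumes r: "0 < r" "r < R"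
  obtains C B where "C \<ge> 0" "B \<ge> 0" "\<And>w N. norm w \<le> r \<Longrightarrow> N \<ge> 1 \<Longrightarrow> norm (t m N w) \<le> C * real N powr B"
proof -
  have "\<exists>C B. C \<ge> 0 \<and> B \<ge> 0 \<and> (\<forall>w\<in>sphere 0 r. \<forall>N\<ge>1. norm (t m N w) \<le> C * real N powr B)"
  proof (rule compact_polynomial_bound)
    fix z :: complex assume "z \<in> sphere 0 r"
    then show "\<exists>C B. C \<ge> 0 \<and> (\<forall>\<^sub>F w in nhds z. \<forall>N\<ge>1. norm (t m N w) \<le> C * real N powr B)"
      using r by (intro t_local_bound) auto
  qed simp
  then obtain C B where CB: "C \<ge> 0" "B \<ge> 0" "\<forall>w\<in>sphere 0 r. \<forall>N\<ge>1. norm (t m N w) \<le> C * real N powr B"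
    by blast
  have h: "t m N holomorphic_on cball 0 r" for N
    by (rule holomorphic_on_subset[OF t_holomorphic]) (use r in auto)
  have "norm (t m N w) \<le> C * real N powr B" if "norm w \<le> r" "N \<ge> 1" for w N
  proof (rule maximum_modulus_frontier[of "t m N" "cball 0 r"])
    show "t m N holomorphic_on interior (cball 0 r)"
      by (rule holomorphic_on_subset[OF h interior_subset])
    show "continuous_on (closure (cball 0 r)) (t m N)"
      using holomorphic_on_imp_continuous_on[OF h] by simp
    show "norm (t m N z) \<le> C * real N powr B" if "z \<in> frontier (cball 0 r)" for z
      using CB(3) that \<open>N \<ge> 1\<close> by (simp add: frontier_cball)
  qed (use that in auto)
  then show ?thesis using that CB by blast
qed

text \<open>Otherwise the function would vanish near 0, and by the identity theorem on the connected
  set of regular parameters also at \<open>w = 1\<close>, where the tail is a positive sum.\<close>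

lemma t_1_not_constant:
  assumes \<delta>: "0 < \<delta>" "\<delta> < R" shows "\<not> t m 1 constant_on ball 0 \<delta>"
proof
  assume "t m 1 constant_on ball 0 \<delta>"
  then have z: "t m 1 w = 0" if "w \<in> ball 0 \<delta>" for w
    using that t_1_0 \<delta> unfolding constant_on_def by (metis centre_in_ball)
  have hT: "(\<lambda>w. EZ_tail m 1 (segment w)) holomorphic_on {w. segment w \<in> regular_pts m}"
    unfolding segment_def by (rule hol_along_line[OF hol_EZ_tail])
  have "EZ_tail m 1 (segment 1) = 0"
  proof (rule analytic_continuation_open[where s = "ball 0 \<delta> - {0}" and s' = "{w. segment w \<in> regular_pts m}" and f = "\<lambda>w. EZ_tail m 1 (segment w)" and g = "\<lambda>w. 0"])
    show "open (ball 0 \<delta> - {0::complex})" by (simp add: open_delete)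
    show "open {w. segment w \<in> regular_pts m}" unfolding segment_def by (rule open_line_vimage[OF open_regular_pts])
    have "complex_of_real (\<delta> / 2) \<in> ball 0 \<delta> - {0}" using \<delta> by simp
    then show "ball 0 \<delta> - {0::complex} \<noteq> {}" by blast
    show "connected {w. segment w \<in> regular_pts m}"
      unfolding segment_def using segment_1_regular_pts unfolding segment_def by (rule connected_line_regular_pts)
    show "ball 0 \<delta> - {0} \<subseteq> {w. segment w \<in> regular_pts m}" using R(2) \<delta> by auto
    show "EZ_tail m 1 (segment w) = 0" if "w \<in> ball 0 \<delta> - {0}" for w
      using z[of w] t_eq_EZ_tail[of w 1] that by simp
    show "(1::complex) \<in> {w. segment w \<in> regular_pts m}" using segment_1_regular_pts by simp
    show "(\<lambda>w. EZ_tail m 1 (segment w)) holomorphic_on {w. segment w \<in> regular_pts m}" by (rule hT)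
  qed simp
  then show False unfolding segment_1 using EZ_tail_nonzero[of m "all_threes {1..m}" 1] by (simp add: all_threes_def)
qed

text \<open>For \<open>w \<noteq> 0\<close> in the disc and large \<open>k\<close> this is the value
  of zeta at first coordinate \<open>k\<close> and remaining coordinates \<open>segment w\<close>.
  At \<open>w = 0\<close> it is the Dirichlet series formed from the extended tails.\<close>

definition h :: "nat \<Rightarrow> complex \<Rightarrow> complex" where
  "h k w = (\<Sum>n. of_nat (Suc n) powr (- of_nat k) * t m (Suc n) w)"

lemma zeros_near:
  assumes \<delta>: "0 < \<delta>" "\<delta> < R"
  shows "\<exists>s. EZ_zero (Suc m) s \<and> (\<exists>w. norm w < \<delta> \<and> s(1 := 0) = line \<rho> (\<lambda>i. all_threes {2..Suc m} i - \<rho> i) w)"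
proof (rule ccontr)
  assume contra: "\<not> ?thesis"
  obtain C B where C: "C \<ge> 0" and B: "B \<ge> 0"
    and b: "\<And>w N. norm w \<le> \<delta> \<Longrightarrow> N \<ge> 1 \<Longrightarrow> norm (t m N w) \<le> C * real N powr B"
    using t_uniform_bound[OF \<delta>] by metis
  have "compact (cball (0::complex) \<delta>)" by simp
  moreover have "continuous_on (cball 0 \<delta>) (\<lambda>w. excess m (segment w))"
    unfolding segment_def by (rule continuous_on_compose2[OF hol_continuous[OF hol_excess[of UNIV]] continuous_on_line]) simp
  ultimately have "bounded ((\<lambda>w. excess m (segment w)) ` cball 0 \<delta>)"
    by (intro compact_imp_bounded compact_continuous_image)
  then obtain M where "\<forall>w\<in>cball 0 \<delta>. norm (excess m (segment w)) \<le> M"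
    unfolding bounded_iff by auto
  then have M: "norm (excess m (segment w)) \<le> M" if "norm w \<le> \<delta>" for w using that by simp
  \<comment> \<open>\<open>B + 3\<close> makes the remainder of the series O(1/N) uniformly on the
    disc; \<open>M + 2\<close> makes \<open>excess (Suc m)\<close> positive in real part, hence the
    points regular.\<close>
  define K where "K = nat \<lceil>max (B + 3) (M + 2)\<rceil>"
  have K: "real k \<ge> B + 3" "real k \<ge> M + 2" if "k \<ge> K" for k using that unfolding K_def by linarith+
  have tail: "norm (h k w - (\<Sum>n=1..N. of_nat n powr (- of_nat k) * t m n w)) \<le> C * real (Suc N) powr (B + 2 - real k)"
    if "k \<ge> K" "norm w \<le> \<delta>" "N \<ge> 1" for k w N
    using dirichlet_tail(2)[of "\<lambda>n. t m n w" C B "of_nat k" N] b[OF that(2)] C K(1)[OF that(1)] that(3)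
    unfolding h_def by (simp del: of_nat_Suc)
  have hol_h: "h k holomorphic_on ball 0 \<delta>" if k: "k \<ge> K" for k
  proof (rule holomorphic_uniform_sequence)
    show "(\<lambda>w. \<Sum>n=1..N. of_nat n powr (- of_nat k) * t m n w) holomorphic_on ball 0 \<delta>" for N
      by (intro holomorphic_intros holomorphic_on_subset[OF t_holomorphic]) (use \<delta> in auto)
    fix w :: complex assume "w \<in> ball 0 \<delta>"
    then obtain d where d: "d > 0" "cball w d \<subseteq> ball 0 \<delta>" using bspec[OF open_contains_cball[THEN iffD1, OF open_ball]] by blast
    have "uniform_limit (cball w d) (\<lambda>N w. \<Sum>n=1..N. of_nat n powr (- of_nat k) * t m n w) (h k) sequentially"
      unfolding uniform_limit_iff
    proof (intro allI impI)
      fix \<epsilon> :: real assume \<epsilon>: "\<epsilon> > 0"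
      obtain N0 :: nat where N0: "real N0 > C / \<epsilon>" using reals_Archimedean2 by blast
      show "\<forall>\<^sub>F N in sequentially. \<forall>z\<in>cball w d. dist (\<Sum>n=1..N. of_nat n powr (- of_nat k) * t m n z) (h k z) < \<epsilon>"
      proof (rule eventually_sequentiallyI[of "max 1 N0"], intro ballI)
        fix N z assume N: "N \<ge> max 1 N0" and "z \<in> cball w d"
        then have "norm z \<le> \<delta>" using d(2) by (auto simp: subset_iff dist_norm intro: less_imp_le)
        then have "norm (h k z - (\<Sum>n=1..N. of_nat n powr (- of_nat k) * t m n z)) \<le> C * real (Suc N) powr (B + 2 - real k)"
          using N by (intro tail k) auto
        also have "\<dots> \<le> C * real (Suc N) powr (-1)" using C K(1)[OF k] by (intro mult_left_mono powr_mono) auto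
        also have "\<dots> = C / real (Suc N)" by (simp add: powr_minus divide_inverse)
        also have "\<dots> < \<epsilon>"
        proof -
          have "C / \<epsilon> < real (Suc N)" using N0 N by simp
          then show ?thesis using \<epsilon> by (simp add: field_simps)
        qed
        finally show "dist (\<Sum>n=1..N. of_nat n powr (- of_nat k) * t m n z) (h k z) < \<epsilon>"
          by (simp add: dist_norm norm_minus_commute)
      qed
    qed
    then show "\<exists>d>0. cball w d \<subseteq> ball 0 \<delta> \<and>
       uniform_limit (cball w d) (\<lambda>N w. \<Sum>n=1..N. of_nat n powr (- of_nat k) * t m n w) (h k) sequentially"
      using d by blast
  qed simp
  \<comment> \<open>Only for \<open>w \<noteq> 0\<close> is the point known to be regular, so only
    there does a zero of \<open>h k\<close> contradict the assumption.\<close>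
  have nz: "h k w \<noteq> 0" if k: "k \<ge> K" and w: "w \<noteq> 0" "norm w < \<delta>" for k w
  proof
    assume h0: "h k w = 0"
    define s where "s = (line \<rho> (\<lambda>i. all_threes {2..Suc m} i - \<rho> i) w)(1 := of_nat k)"
    have sh: "shift s = segment w"
      by (auto simp: s_def shift_def segment_def line_def u_def all_threes_def fun_eq_iff)
    have \<rho>c: "\<rho> \<in> cspace {2..Suc m}" using \<rho> by (simp add: H_def)
    have Lc: "line \<rho> (\<lambda>i. all_threes {2..Suc m} i - \<rho> i) w \<in> cspace {2..Suc m}"
      by (rule line_cspace[OF \<rho>c]) (simp add: all_threes_def cspace_def)
    have sc: "s \<in> cspace {1..Suc m}" using cspace_2_subset[OF Lc] by (auto simp: s_def cspace_def)
    have s1: "s 1 = of_nat k" by (simp add: s_def)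
    have "\<bar>Re (excess m (segment w))\<bar> \<le> M" using M[of w] w abs_Re_le_cmod[of "excess m (segment w)"] by simp
    then have Ws: "Re (excess (Suc m) s) > 0" using K(2)[OF k] unfolding excess_Suc sh s1 by simp
    have regular_pts: "s \<in> regular_pts (Suc m)" using R(2)[of w] w \<delta> by (intro regular_pts_SucI Ws) (simp add: sh)
    have "EZ_tail (Suc m) 0 s = (\<Sum>n. of_nat (Suc n) powr (- s 1) * EZ_tail m (Suc n) (shift s))"
    proof (rule EZ_tail_Suc_eq_suminf[OF regular_pts Ws])
      show "norm (EZ_tail m n (shift s)) \<le> C * real n powr B" if "n \<ge> 1" for n
        using b[of w n] w that t_eq_EZ_tail[of w n] by (simp add: sh)
      show "B + 2 \<le> Re (s 1)" using K(1)[OF k] unfolding s1 by simp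
    qed fact
    also have "\<dots> = h k w" unfolding h_def sh s1 t_eq_EZ_tail[OF w(1)] ..
    finally have "EZ_zeta (Suc m) s = 0" using EZ_zeta_eq_EZ_tail[OF _ sc regular_pts] h0 by simp
    then have "EZ_zero (Suc m) s" using EZ_holomorphic_at_regular_pts[OF _ sc regular_pts] by (simp add: EZ_zero_def)
    moreover have "s(1 := 0) = line \<rho> (\<lambda>i. all_threes {2..Suc m} i - \<rho> i) w"
      unfolding s_def fun_upd_upd using upd_1_id[OF Lc] .
    ultimately show False using contra w(2) by blast
  qed
  show False
  proof (cases "\<forall>n. \<exists>k\<ge>max n K. h k 0 \<noteq> 0")
    case True
    \<comment> \<open>Along \<open>\<kappa>\<close> the functions vanish nowhere in the disc, the
      centre included. Since \<open>\<kappa> n \<ge> n\<close>, they converge uniformly to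
      \<open>t m 1\<close>, their term \<open>n = 1\<close>.\<close>
    then obtain \<kappa> where \<kappa>: "\<And>n. \<kappa> n \<ge> max n K" "\<And>n. h (\<kappa> n) 0 \<noteq> 0" by metis
    have "t m 1 0 \<noteq> 0"
    proof (rule Hurwitz_no_zeros[of "ball 0 \<delta>" "\<lambda>n. h (\<kappa> n)" "t m 1"])
      show "h (\<kappa> n) holomorphic_on ball 0 \<delta>" for n using \<kappa>(1)[of n] by (intro hol_h) simp
      show "t m 1 holomorphic_on ball 0 \<delta>"
        by (rule holomorphic_on_subset[OF t_holomorphic]) (use \<delta> in auto)
      show "\<not> t m 1 constant_on ball 0 \<delta>" by (rule t_1_not_constant[OF \<delta>])
      show "h (\<kappa> n) z \<noteq> 0" if "z \<in> ball 0 \<delta>" for n z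
        using \<kappa>(1,2)[of n] nz[of "\<kappa> n" z] that by (cases "z = 0") auto
      show "0 \<in> ball (0::complex) \<delta>" using \<delta> by simp
      fix A :: "complex set" assume A: "A \<subseteq> ball 0 \<delta>"
      have "uniform_limit A (\<lambda>n. h (\<kappa> n)) (t m 1) sequentially"
      proof (rule uniform_limitI)
        fix \<epsilon> :: real assume \<epsilon>: "\<epsilon> > 0"
        have "(\<lambda>n. C * 2 powr (B + 2) * (1/2) ^ n) \<longlonglongrightarrow> 0"
          by (intro tendsto_mult_right_zero LIMSEQ_power_zero) simp
        then have "\<forall>\<^sub>F n in sequentially. C * 2 powr (B + 2) * (1/2) ^ n < \<epsilon>"
          using \<epsilon> by (rule order_tendstoD(2))
        then show "\<forall>\<^sub>F n in sequentially. \<forall>z\<in>A. dist (h (\<kappa> n) z) (t m 1 z) < \<epsilon>"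
        proof eventually_elim
          case (elim n)
          show ?case
          proof
            fix z assume "z \<in> A"
            then have "norm z \<le> \<delta>" using A by (auto simp: subset_iff intro: less_imp_le)
            then have "norm (h (\<kappa> n) z - t m 1 z) \<le> C * 2 powr (B + 2 - real (\<kappa> n))"
              using tail[of "\<kappa> n" z 1] \<kappa>(1)[of n] by simp
            also have "\<dots> \<le> C * 2 powr (B + 2 - real n)"
              using \<kappa>(1)[of n] C by (intro mult_left_mono powr_mono) auto
            also have "\<dots> = C * 2 powr (B + 2) * (1/2) ^ n"
              by (simp add: powr_diff powr_realpow power_one_over)
            finally show "dist (h (\<kappa> n) z) (t m 1 z) < \<epsilon>" using elim by (simp add: dist_norm)
          qed
        qed
      qed
      then show "uniform_limit A (\<lambda>n. h (\<kappa> n)) (t m 1) sequentially" .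
    qed auto
    then show False using t_1_0 by simp
  next
    case False
    then obtain n where n: "\<And>k. k \<ge> max n K \<Longrightarrow> h k 0 = 0" by blast
    have "t m N 0 = 0" if "N \<ge> 1" for N
    proof (rule dirichlet_zero[of "\<lambda>N. t m N 0" C B, OF _ C _ that])
      show "norm (t m N 0) \<le> C * real N powr B" if "N \<ge> 1" for N using b[of 0 N] \<delta> that by simp
      show "(\<Sum>n. of_nat (Suc n) powr (- of_nat k) * t m (Suc n) 0) = 0" if "k \<ge> max n K" for k
        using n[OF that] by (simp add: h_def)
    qed
    then show False using tail_rec_not_eventually_zero[of 1 m "\<lambda>j. e j 0" "segment 0" m] by (auto simp: t_def)
  qed
qed

end

lemma zeros_approach:
  "\<exists>p. (\<forall>n. EZ_zero (Suc m) (p n)) \<and> (\<lambda>n. (p n)(1 := 0)) \<longlonglongrightarrow> \<rho>"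
proof -
  obtain R where R: "R > 0" "\<And>w. w \<noteq> 0 \<Longrightarrow> norm w < R \<Longrightarrow> segment w \<in> regular_pts m" using radius by blast
  let ?L = "line \<rho> (\<lambda>i. all_threes {2..Suc m} i - \<rho> i)"
  \<comment> \<open>The shift by 2 keeps the radius strictly below \<open>R\<close> already for
    \<open>n = 0\<close>.\<close>
  define \<delta> where "\<delta> = (\<lambda>n. R / real (n + 2))"
  have \<delta>: "0 < \<delta> n" "\<delta> n < R" for n using R(1) by (auto simp: \<delta>_def field_simps add_pos_nonneg)
  have "\<forall>n. \<exists>s. EZ_zero (Suc m) s \<and> (\<exists>w. norm w < \<delta> n \<and> s(1 := 0) = ?L w)"
    using zeros_near[OF R \<delta>] by blast
  then obtain p w where p: "\<And>n. EZ_zero (Suc m) (p n)" "\<And>n. norm (w n) < \<delta> n" "\<And>n. (p n)(1 := 0) = ?L (w n)"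
    by metis
  have "\<delta> \<longlonglongrightarrow> 0"
    unfolding \<delta>_def using LIMSEQ_ignore_initial_segment[OF lim_const_over_n[of R], of 2] .
  then have "w \<longlonglongrightarrow> 0"
    by (rule Lim_null_comparison[rotated]) (intro always_eventually allI less_imp_le p(2))
  moreover have "isCont ?L 0"
    using continuous_on_line[of UNIV] by (simp add: continuous_on_eq_continuous_at)
  ultimately have "(\<lambda>n. ?L (w n)) \<longlonglongrightarrow> ?L 0" by (rule isCont_tendsto_compose[rotated])
  then have "(\<lambda>n. (p n)(1 := 0)) \<longlonglongrightarrow> \<rho>" unfolding p(3) line_to .
  then show ?thesis using p(1) by blast
qed

end

theorem theorem3:
  fixes r :: nat
  assumes "r \<ge> 2"
  shows
    "(\<forall>D. D \<subseteq> cspace {2..r} \<and> cbounded {2..r} D \<and> closedin (top_of_set (cspace {2..r})) D \<and>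
          {s \<in> cspace {1..r}. s(1 := 0) \<in> D} \<inter> S1 r = {} \<longrightarrow>
        (\<forall>\<epsilon>>0. \<exists>K::real. \<forall>V s. EZ_zero_set r V \<and> s \<in> V \<and> s(1 := 0) \<in> D \<and> Re (s 1) > K \<longrightarrow>
            (\<exists>h\<in>H r. cdist {2..r} (s(1 := 0)) h < \<epsilon>)) \<and>
        (\<forall>V (p :: nat \<Rightarrow> nat \<Rightarrow> complex).
            EZ_zero_set r V \<and> (\<forall>m. p m \<in> V) \<and>
            filterlim (\<lambda>m. Re (p m 1)) at_top sequentially \<and>
            (\<forall>m. (p m)(1 := 0) \<in> D) \<longrightarrow>
            (H r \<noteq> {} \<and> (\<lambda>m. INF h\<in>H r. cdist {2..r} ((p m)(1 := 0)) h) \<longlonglongrightarrow> 0) \<and>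
            (\<exists>k \<rho>. strict_mono k \<and> \<rho> \<in> H r \<and> (\<lambda>m. (p (k m))(1 := 0)) \<longlonglongrightarrow> \<rho>))) \<and>
     (\<forall>\<rho>\<in>H r. \<exists>V (p :: nat \<Rightarrow> nat \<Rightarrow> complex).
        EZ_zero_set r V \<and> (\<forall>m. p m \<in> V) \<and> (\<lambda>m. (p m)(1 := 0)) \<longlonglongrightarrow> \<rho>)"
proof -
  obtain m where r: "r = Suc m" and m: "m \<ge> 1"
    using assms by (cases r) auto
  show ?thesis
    unfolding r
  proof (intro conjI allI ballI impI; (elim conjE)?)
    fix D and \<epsilon> :: real
    assume D: "D \<subseteq> cspace {2..Suc m}" "cbounded {2..Suc m} D" "closedin (top_of_set (cspace {2..Suc m})) D"
      "{s \<in> cspace {1..Suc m}. s(1 := 0) \<in> D} \<inter> S1 (Suc m) = {}" and \<epsilon>: "0 < \<epsilon>"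
    from zeros_uniformly_near_H[OF m D \<epsilon>]
    show "\<exists>K::real. \<forall>V s. EZ_zero_set (Suc m) V \<and> s \<in> V \<and> s(1 := 0) \<in> D \<and> Re (s 1) > K \<longrightarrow>
            (\<exists>h\<in>H (Suc m). cdist {2..Suc m} (s(1 := 0)) h < \<epsilon>)"
      unfolding EZ_zero_set_def by blast
  next
    fix D V and p :: "nat \<Rightarrow> nat \<Rightarrow> complex"
    assume D: "D \<subseteq> cspace {2..Suc m}" "cbounded {2..Suc m} D" "closedin (top_of_set (cspace {2..Suc m})) D"
      "{s \<in> cspace {1..Suc m}. s(1 := 0) \<in> D} \<inter> S1 (Suc m) = {}"
      and p: "EZ_zero_set (Suc m) V" "\<forall>n. p n \<in> V" "filterlim (\<lambda>m. Re (p m 1)) at_top sequentially" "\<forall>n. (p n)(1 := 0) \<in> D"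
    have z: "EZ_zero (Suc m) (p n)" for n using p by (auto simp: EZ_zero_set_def)
    \<comment> \<open>The subsequence comes before the distances because it shows \<open>H\<close>
      to be nonempty, so that the infimum is meaningful.\<close>
    show sub: "\<exists>k \<rho>. strict_mono k \<and> \<rho> \<in> H (Suc m) \<and> (\<lambda>m. (p (k m))(1 := 0)) \<longlonglongrightarrow> \<rho>"
      using zeros_subsequence[OF m D z _ p(3)] p(4) by blast
    then show ne: "H (Suc m) \<noteq> {}" by blast
    show "(\<lambda>n. INF h\<in>H (Suc m). cdist {2..Suc m} ((p n)(1 := 0)) h) \<longlonglongrightarrow> 0"
    proof (rule INF_cdist_tendsto_0[OF _ ne])
      fix \<epsilon> :: real assume \<epsilon>: "\<epsilon> > 0"
      obtain K :: real where K: "\<And>s. EZ_zero (Suc m) s \<Longrightarrow> s(1 := 0) \<in> D \<Longrightarrow> Re (s 1) > K \<Longrightarrow>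
          \<exists>h\<in>H (Suc m). cdist {2..Suc m} (s(1 := 0)) h < \<epsilon>"
        using zeros_uniformly_near_H[OF m D \<epsilon>] by blast
      have "\<forall>\<^sub>F n in sequentially. Re (p n 1) > K" using p(3) by (simp add: filterlim_at_top_dense)
      then show "\<forall>\<^sub>F n in sequentially. \<exists>h\<in>H (Suc m). cdist {2..Suc m} ((p n)(1 := 0)) h < \<epsilon>"
        by (rule eventually_mono) (use K z p(4) in blast)
    qed
  next
    fix \<rho> assume "\<rho> \<in> H (Suc m)"
    then interpret solution m \<rho> using m by unfold_locales
    \<comment> \<open>The set of all zeros is a zero-set and contains the whole sequence.\<close>
    show "\<exists>V p. EZ_zero_set (Suc m) V \<and> (\<forall>m. p m \<in> V) \<and> (\<lambda>m. (p m)(1 := 0)) \<longlonglongrightarrow> \<rho>"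
      using zeros_approach EZ_zero_set_all_zeros[of "Suc m"] by (intro exI[of _ "{s. EZ_zero (Suc m) s}"]) auto
  qed
qed

end
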